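(* Let $\mathcal{K}$ be a finite chiral polytope with directly regular facets and group $\Gamma^+(\mathcal{K})=\langle\sigma_1,\dots,\sigma_{n-1}\rangle$. Let $\mathcal{P}=U(\mathcal{K})$, and let $\mathcal{Q}$ be a finite directly regular polytope of the same rank as $\mathcal{P}$. If $\sigma_{n-1}=1$ or $\sigma_{n-1}=\sigma_{n-2}$ in $\Gamma^+(\mathcal{K})\Box\Gamma^+(\overline{\mathcal{K}})$, then $\mathcal{P}\diamond\mathcal{Q}$ is chiral, with an infinite chirality group.
   Context: All polytopes are abstract polytopes. A regular polytope is directly regular if its rotation group $\Gamma^+$, generated by $\sigma_i=\rho_{i-1}\rho_i$ ($\rho_i$ the standard generating involutions relative to a base flag), has index $2$ in the automorphism group. A polytope is chiral if its automorphism group has two orbits on flags, adjacent flags lying in distinct orbits; then $\Gamma^+(\mathcal{P})$ is its automorphism group, generated by standard rotations $\sigma_1,\dots,\sigma_{m-1}$ (rank $m$), satisfying $(\sigma_i\cdots\sigma_j)^2=1$ for $i<j$. For a chiral polytope $\mathcal{K}$ with directly regular facets, $U(\mathcal{K})$ denotes the universal chiral polytope with facets isomorphic to $\mathcal{K}$ (it exists and covers every chiral polytope with facets isomorphic to $\mathcal{K}$); its group is $\langle\sigma_1,\dots,\sigma_n\rangle$ with $\langle\sigma_1,\dots,\sigma_{n-1}\rangle=\Gamma^+(\mathcal{K})$. Let $W^+=\langle \sigma_1,\dots,\sigma_{m-1}\mid (\sigma_i\cdots\sigma_j)^2=1,\ i<j\rangle$; rotation groups are $W^+/M$ for normal subgroups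 $M$. Let $w\mapsto\overline{w}$ be the automorphism of $W^+$ with $\sigma_1\mapsto\sigma_1^{-1}$, $\sigma_2\mapsto\sigma_1^2\sigma_2$, $\sigma_j\mapsto\sigma_j$ ($j\ge3$); the mirror image $\overline{\mathcal{K}}$ of $\mathcal{K}$ with $\Gamma^+(\mathcal{K})=W^+/M$ has group $W^+/\overline M$, and the comix $\Gamma^+(\mathcal{K})\Box\Gamma^+(\overline{\mathcal{K}})=W^+/(M\overline M)$ (the group on generators $\sigma_i$ with the relations of both). Mix: if $\Gamma^+(\mathcal{P})=W^+/M$ and $\Gamma^+(\mathcal{Q})=W^+/K$, the mix $\mathcal{P}\diamond\mathcal{Q}$ is the (flag-connected pre-)polytope whose rotation group is the subgroup of $\Gamma^+(\mathcal{P})\times\Gamma^+(\mathcal{Q})$ generated by $(\sigma_i,\sigma_i')$, isomorphic to $W^+/N$ with $N=M\cap K$; it is chiral if $\overline N\ne N$ and directly regular otherwise. Chirality group: for rotation group $W^+/N$, $X=N\overline N/N$. *)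

theory Defs
  imports Main "HOL-Algebra.Algebra"
begin

section \<open>Abstract polytopes\<close>

text \<open>A poset is given by its order relation \<open>P\<close>; its set of faces is \<^term>\<open>Field P\<close>.\<close>

definition flags :: "'a rel \<Rightarrow> 'a set set" where
  "flags P = {C \<in> Chains P. \<forall>D\<in>Chains P. C \<subseteq> D \<longrightarrow> D = C}"

text \<open>The least face of a polytope has rank \<open>-1\<close>. The value does not depend on the flag through
  \<open>F\<close>.\<close>

definition face_rank :: "'a rel \<Rightarrow> 'a \<Rightarrow> int" where
  "face_rank P F = (THE k. \<exists>C\<in>flags P. F \<in> C \<and> k = int (card {G \<in> C. (G, F) \<in> P}) - 2)"

definition adjacent_flags :: "'a rel \<Rightarrow> 'a set \<Rightarrow> 'a set \<Rightarrow> bool" where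
  "adjacent_flags P A B \<longleftrightarrow>
     A \<in> flags P \<and> B \<in> flags P \<and> card (A - B) = 1 \<and> card (B - A) = 1"

definition strongly_flag_connected :: "'a rel \<Rightarrow> bool" where
  "strongly_flag_connected P \<longleftrightarrow>
     (\<forall>A\<in>flags P. \<forall>B\<in>flags P.
        (A, B) \<in> {(C, D). adjacent_flags P C D \<and> A \<inter> B \<subseteq> C \<and> A \<inter> B \<subseteq> D}\<^sup>*)"

definition diamond_condition :: "'a rel \<Rightarrow> bool" where
  "diamond_condition P \<longleftrightarrow>
     (\<forall>F G. (F, G) \<in> P \<and> face_rank P G = face_rank P F + 2 \<longrightarrow>
        card {H. (F, H) \<in> P \<and> (H, G) \<in> P \<and> H \<noteq> F \<and> H \<noteq> G} = 2)"

text \<open>Abstract polytopes of rank \<open>n\<close>: flags have \<open>n + 2\<close> faces, the two improper ones included.\<close>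

definition polytope :: "nat \<Rightarrow> 'a rel \<Rightarrow> bool" where
  "polytope n P \<longleftrightarrow>
     Partial_order P \<and>
     (\<exists>a\<in>Field P. \<forall>x\<in>Field P. (a, x) \<in> P) \<and>
     (\<exists>b\<in>Field P. \<forall>x\<in>Field P. (x, b) \<in> P) \<and>
     (\<forall>C\<in>flags P. card C = n + 2) \<and>
     strongly_flag_connected P \<and>
     diamond_condition P"

definition poset_iso :: "'a rel \<Rightarrow> 'b rel \<Rightarrow> bool" where
  "poset_iso P Q \<longleftrightarrow>
     (\<exists>f. bij_betw f (Field P) (Field Q) \<and>
          (\<forall>x\<in>Field P. \<forall>y\<in>Field P. (x, y) \<in> P \<longleftrightarrow> (f x, f y) \<in> Q))"

text \<open>As usual, a facet \<open>F\<close> of a rank \<open>n\<close> polytope (a face of rank \<open>n - 1\<close>) is identified with the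
  section of all faces below it, itself a polytope of rank \<open>n - 1\<close>.\<close>

definition facets :: "nat \<Rightarrow> 'a rel \<Rightarrow> 'a rel set" where
  "facets n P = {Restr P {G. (G, F) \<in> P} |F. F \<in> Field P \<and> face_rank P F = int n - 1}"

definition covers :: "'a rel \<Rightarrow> 'b rel \<Rightarrow> bool" where
  "covers P Q \<longleftrightarrow>
     (\<exists>f. f ` Field P = Field Q \<and>
          (\<forall>x y. (x, y) \<in> P \<longrightarrow> (f x, f y) \<in> Q) \<and>
          (\<forall>x\<in>Field P. face_rank Q (f x) = face_rank P x) \<and>
          (\<forall>A B. adjacent_flags P A B \<longrightarrow> adjacent_flags Q (f ` A) (f ` B)))"


section \<open>Automorphisms, regularity and chirality\<close>

text \<open>Automorphisms act on the left, and the product is composition of functions.\<close>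

definition aut_group :: "'a rel \<Rightarrow> ('a \<Rightarrow> 'a) monoid" where
  "aut_group P = (BijGroup (Field P))
     \<lparr>carrier := {f \<in> Bij (Field P).
        \<forall>x\<in>Field P. \<forall>y\<in>Field P. (x, y) \<in> P \<longleftrightarrow> (f x, f y) \<in> P}\<rparr>"

definition flag_orbit :: "'a rel \<Rightarrow> 'a set \<Rightarrow> 'a set set" where
  "flag_orbit P A = {f ` A |f. f \<in> carrier (aut_group P)}"

definition adj :: "'a rel \<Rightarrow> nat \<Rightarrow> 'a set \<Rightarrow> 'a set" where
  "adj P i A = (THE B. adjacent_flags P A B \<and> (\<exists>F\<in>A - B. face_rank P F = int i))"

definition flag_aut :: "'a rel \<Rightarrow> 'a set \<Rightarrow> 'a set \<Rightarrow> 'a \<Rightarrow> 'a" where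
  "flag_aut P A B = (THE f. f \<in> carrier (aut_group P) \<and> f ` A = B)"

definition rho :: "'a rel \<Rightarrow> 'a set \<Rightarrow> nat \<Rightarrow> 'a \<Rightarrow> 'a" where
  "rho P A i = flag_aut P A (adj P i A)"

definition regular_polytope :: "nat \<Rightarrow> 'a rel \<Rightarrow> bool" where
  "regular_polytope n P \<longleftrightarrow>
     polytope n P \<and> (\<forall>A\<in>flags P. flag_orbit P A = flags P)"

definition directly_regular_polytope :: "nat \<Rightarrow> 'a rel \<Rightarrow> bool" where
  "directly_regular_polytope n P \<longleftrightarrow>
     regular_polytope n P \<and>
     (\<forall>A\<in>flags P. card (rcosets\<^bsub>aut_group P\<^esub>
        (generate (aut_group P)
           {rho P A (i - 1) \<otimes>\<^bsub>aut_group P\<^esub> rho P A i |i. 1 \<le> i \<and> i < n})) = 2)"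

definition chiral_polytope :: "nat \<Rightarrow> 'a rel \<Rightarrow> bool" where
  "chiral_polytope n P \<longleftrightarrow>
     polytope n P \<and>
     card (flag_orbit P ` flags P) = 2 \<and>
     (\<forall>A B. adjacent_flags P A B \<longrightarrow> flag_orbit P A \<noteq> flag_orbit P B)"

text \<open>The standard rotation \<open>\<sigma>\<^sub>i\<close> relative to the base flag \<open>A\<close> is the automorphism that sends
  \<open>A\<close> to the flag obtained by changing first its \<open>(i-1)\<close>-face and then its \<open>i\<close>-face; it fixes the
  other faces of \<open>A\<close> and rotates the rank 2 section between the faces of rank \<open>i-2\<close> and \<open>i+1\<close>.
  Automorphisms commute with changing the \<open>j\<close>-face of a flag and are determined by the image of one
  flag, so for regular \<open>P\<close> this is \<open>\<rho>\<^sub>i\<^sub>-\<^sub>1 \<rho>\<^sub>i\<close>. With this convention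
  \<open>\<sigma>\<^sub>i \<dots> \<sigma>\<^sub>j\<close> (for \<open>i < j\<close>) sends \<open>A\<close> to \<open>adj P j (adj P (i - 1) A)\<close>, an involution.\<close>

definition rot :: "'a rel \<Rightarrow> 'a set \<Rightarrow> nat \<Rightarrow> 'a \<Rightarrow> 'a" where
  "rot P A i = flag_aut P A (adj P i (adj P (i - 1) A))"

definition rotation_group :: "nat \<Rightarrow> 'a rel \<Rightarrow> 'a set \<Rightarrow> ('a \<Rightarrow> 'a) monoid" where
  "rotation_group n P A = (aut_group P)
     \<lparr>carrier := generate (aut_group P) {rot P A i |i. 1 \<le> i \<and> i < n}\<rparr>"

text \<open>\<open>P\<close> is the universal chiral polytope with facets isomorphic to the rank \<open>n\<close> polytope \<open>K\<close>.
  Quantification over polytopes with faces in \<^typ>\<open>nat\<close> is no restriction: chiral polytopes have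
  finitely generated automorphism groups and two flag orbits, hence are countable.\<close>

definition universal_chiral :: "nat \<Rightarrow> 'a rel \<Rightarrow> 'b rel \<Rightarrow> bool" where
  "universal_chiral n K P \<longleftrightarrow>
     chiral_polytope (n + 1) P \<and> (\<forall>L\<in>facets (n + 1) P. poset_iso L K) \<and>
     (\<forall>R :: nat rel.
        chiral_polytope (n + 1) R \<and> (\<forall>L\<in>facets (n + 1) R. poset_iso L K) \<longrightarrow> covers P R)"


section \<open>The group \<open>W\<^sup>+\<close>\<close>

text \<open>\<open>W\<^sup>+\<close> for rank \<open>m\<close>, as signed words in \<open>\<sigma>\<^sub>1, \<dots>, \<sigma>\<^sub>m\<^sub>-\<^sub>1\<close> modulo the congruence generated
  by free cancellation and the relators \<open>(\<sigma>\<^sub>i \<dots> \<sigma>\<^sub>j)\<^sup>2\<close>. The letter \<open>(i, True)\<close> is \<open>\<sigma>\<^sub>i\<close> and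
  \<open>(i, False)\<close> is its inverse.\<close>

type_synonym word = "(nat \<times> bool) list"

definition W_words :: "nat \<Rightarrow> word set" where
  "W_words m = lists ({1..<m} \<times> UNIV)"

definition W_relators :: "nat \<Rightarrow> word set" where
  "W_relators m =
     {[(i, b), (i, \<not> b)] |i b. i \<in> {1..<m}} \<union>
     {map (\<lambda>k. (k, True)) ([i..<Suc j] @ [i..<Suc j]) |i j. 1 \<le> i \<and> i < j \<and> j < m}"

definition W_step :: "nat \<Rightarrow> word rel" where
  "W_step m = {(u @ r @ v, u @ v) |u r v. u \<in> W_words m \<and> r \<in> W_relators m \<and> v \<in> W_words m}"

definition W_eq :: "nat \<Rightarrow> word rel" where
  "W_eq m = (W_step m \<union> (W_step m)\<inverse>)\<^sup>* \<inter> W_words m \<times> W_words m"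

definition W_class :: "nat \<Rightarrow> word \<Rightarrow> word set" where
  "W_class m w = W_eq m `` {w}"

definition W_plus :: "nat \<Rightarrow> word set monoid" where
  "W_plus m =
     \<lparr>carrier = W_words m // W_eq m,
      monoid.mult = \<lambda>x y. \<Union>u\<in>x. \<Union>v\<in>y. W_class m (u @ v),
      one = W_class m []\<rparr>"

definition W_gen :: "nat \<Rightarrow> nat \<Rightarrow> word set" where
  "W_gen m i = W_class m [(i, True)]"

text \<open>The automorphism \<open>w \<mapsto> w\<close>-bar, on letters, on words and on \<open>W\<^sup>+\<close>.\<close>

definition bar_letter :: "nat \<times> bool \<Rightarrow> word" where
  "bar_letter = (\<lambda>(i, b).
     if i = 1 then [(1, \<not> b)]
     else if i = 2 then
       (if b then [(1, True), (1, True), (2, True)] else [(2, False), (1, False), (1, False)])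
     else [(i, b)])"

definition bar_word :: "word \<Rightarrow> word" where
  "bar_word w = concat (map bar_letter w)"

definition W_bar :: "nat \<Rightarrow> word set \<Rightarrow> word set" where
  "W_bar m x = (\<Union>w\<in>x. W_class m (bar_word w))"

text \<open>Evaluation of words in a group \<open>G\<close> at a family \<open>s\<close> of elements, and the kernel in \<open>W\<^sup>+\<close>
  of the resulting homomorphism \<open>\<sigma>\<^sub>i \<mapsto> s i\<close> (for \<open>s\<close> satisfying the relations of \<open>W\<^sup>+\<close>).\<close>

definition word_eval :: "('g, 'b) monoid_scheme \<Rightarrow> (nat \<Rightarrow> 'g) \<Rightarrow> word \<Rightarrow> 'g" where
  "word_eval G s w =
     foldr (\<lambda>(i, b) x. (if b then s i else inv\<^bsub>G\<^esub> (s i)) \<otimes>\<^bsub>G\<^esub> x) w \<one>\<^bsub>G\<^esub>"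

definition W_kernel :: "nat \<Rightarrow> ('g, 'b) monoid_scheme \<Rightarrow> (nat \<Rightarrow> 'g) \<Rightarrow> word set set" where
  "W_kernel m G s = W_class m ` {w \<in> W_words m. word_eval G s w = \<one>\<^bsub>G\<^esub>}"

text \<open>The normal subgroup \<open>M\<close> with \<open>\<Gamma>\<^sup>+(P) = W\<^sup>+/M\<close>, relative to the base flag \<open>A\<close>.\<close>

definition rotation_kernel :: "nat \<Rightarrow> 'a rel \<Rightarrow> 'a set \<Rightarrow> word set set" where
  "rotation_kernel m P A = W_kernel m (rotation_group m P A) (rot P A)"


section \<open>Comix, mix and chirality group\<close>

definition comix :: "nat \<Rightarrow> word set set \<Rightarrow> word set set \<Rightarrow> word set set monoid" where
  "comix m M L = W_plus m Mod (M <#>\<^bsub>W_plus m\<^esub> L)"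

definition comix_gen :: "nat \<Rightarrow> word set set \<Rightarrow> word set set \<Rightarrow> nat \<Rightarrow> word set set" where
  "comix_gen m M L i = (M <#>\<^bsub>W_plus m\<^esub> L) #>\<^bsub>W_plus m\<^esub> W_gen m i"

definition mix_gen :: "'a rel \<Rightarrow> 'a set \<Rightarrow> 'b rel \<Rightarrow> 'b set \<Rightarrow> nat \<Rightarrow> ('a \<Rightarrow> 'a) \<times> ('b \<Rightarrow> 'b)" where
  "mix_gen P A Q B i = (rot P A i, rot Q B i)"

definition mix_group ::
    "nat \<Rightarrow> 'a rel \<Rightarrow> 'a set \<Rightarrow> 'b rel \<Rightarrow> 'b set \<Rightarrow> (('a \<Rightarrow> 'a) \<times> ('b \<Rightarrow> 'b)) monoid" where
  "mix_group m P A Q B =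
     (let D = rotation_group m P A \<times>\<times> rotation_group m Q B
      in D\<lparr>carrier := generate D {mix_gen P A Q B i |i. 1 \<le> i \<and> i < m}\<rparr>)"

definition mix_kernel :: "nat \<Rightarrow> 'a rel \<Rightarrow> 'a set \<Rightarrow> 'b rel \<Rightarrow> 'b set \<Rightarrow> word set set" where
  "mix_kernel m P A Q B = W_kernel m (mix_group m P A Q B) (mix_gen P A Q B)"

text \<open>A mix is in general only a pre-polytope; it is called chiral or directly regular according to
  whether the kernel \<open>N\<close> of its rotation group differs from its mirror image.\<close>

definition mix_chiral :: "nat \<Rightarrow> 'a rel \<Rightarrow> 'a set \<Rightarrow> 'b rel \<Rightarrow> 'b set \<Rightarrow> bool" where
  "mix_chiral m P A Q B \<longleftrightarrow> W_bar m ` mix_kernel m P A Q B \<noteq> mix_kernel m P A Q B"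

text \<open>The chirality group \<open>X = N N\<close>-bar\<open>/N\<close> of the rotation group \<open>W\<^sup>+/N\<close>.\<close>

definition chirality_group :: "nat \<Rightarrow> word set set \<Rightarrow> word set set monoid" where
  "chirality_group m N =
     ((W_plus m)\<lparr>carrier := N <#>\<^bsub>W_plus m\<^esub> (W_bar m ` N)\<rparr>) Mod N"

end

theory Submission
  imports Defs
begin

text \<open>Words in the standard rotations act on flags, and the kernel of a rotation group consists of
  the words that fix the base flag; passing to the mirror image replaces the base flag by its
  \<open>0\<close>-adjacent flag. Write \<open>N\<close> for the kernel of the mix and \<open>N'\<close> for its mirror image.

  \<open>N N'\<close> has finite index in \<open>W\<^sup>+\<close>. As \<open>Q\<close> is finite, it suffices to see this for the kernel of
  \<open>P\<close> times its mirror image, that is, to see that a group \<open>\<langle>\<sigma>\<^sub>1, \<dots>, \<sigma>\<^sub>n\<rangle>\<close> is finite in which the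
  relations of \<open>K\<close> and of its mirror image and \<open>(\<sigma>\<^sub>i \<dots> \<sigma>\<^sub>n)\<^sup>2 = 1\<close> hold. The hypothesis on
  \<open>\<sigma>\<^sub>n\<^sub>-\<^sub>1\<close> gives \<open>\<sigma>\<^sub>n\<^sup>2 = 1\<close>, and then \<open>\<sigma>\<^sub>n\<close> inverts \<open>\<sigma>\<^sub>i \<dots> \<sigma>\<^sub>n\<^sub>-\<^sub>1\<close> for all \<open>i\<close>, so it normalizes the
  finite subgroup \<open>\<langle>\<sigma>\<^sub>1, \<dots>, \<sigma>\<^sub>n\<^sub>-\<^sub>1\<rangle>\<close>.

  \<open>N\<close> has infinite index, because \<open>P\<close> is infinite: a finite chiral polytope \<open>P\<close> with facets \<open>K\<close>
  has a larger finite chiral cover with the same facets, hence is not universal. The cover unfolds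
  the graph whose nodes are the facets and whose edges are the ridges of \<open>P\<close>, along the covering
  of that graph that belongs to its homology modulo 2.\<close>

section \<open>Flags of abstract polytopes\<close>

text \<open>A subgroup \<open>N\<close> of infinite index inside a product \<open>N N'\<close> of
  finite index makes \<open>N N' / N\<close> infinite, and \<open>N = N'\<close> would make this
  quotient trivial; so chirality of the mix is a by-product. That \<open>\<sigma>\<^sub>n\<close> is
  an involution is the relation \<open>(\<sigma>\<^sub>n\<^sub>-\<^sub>1 \<sigma>\<^sub>n)\<^sup>2 =
  1\<close> if \<open>\<sigma>\<^sub>n\<^sub>-\<^sub>1 = 1\<close>. If \<open>a\<close> is the
  common value of the last two rotations of \<open>K\<close> and
  \<open>b = \<sigma>\<^sub>n\<close>, it follows from
  \<open>(a b)\<^sup>2 = (a a b)\<^sup>2 = 1\<close>. Homology modulo 2 is finite for a finite graph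
  and canonical, so every automorphism of \<open>P\<close> acts on it and lifts to the cover. The
  unfolding takes place only across ridges and copies each facet unchanged. This keeps the cover
  chiral: an automorphism merging the two orbits could be chosen to fix a facet, which would then
  admit an automorphism between adjacent flags, unlike \<open>K\<close>. The main obstacle is strong
  flag-connectedness of the cover. It dictates that a face over \<open>G\<close> is a chain taken
  modulo the ridges above \<open>G\<close>: lifts that are joined by facets around \<open>G\<close>
  must be the same face.\<close>

lemma Chains_Field: "C \<in> Chains P \<Longrightarrow> C \<subseteq> Field P"
  unfolding Chains_def Field_def by blast

locale ranked_poset =
  fixes n :: nat and P :: "'a rel"
  assumes po: "Partial_order P"
    and flag_card: "\<And>C. C \<in> flags P \<Longrightarrow> card C = n + 2"
begin

abbreviation rk :: "'a \<Rightarrow> int" where "rk \<equiv> face_rank P"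

lemma leq_refl: "x \<in> Field P \<Longrightarrow> (x, x) \<in> P"
  using po unfolding order_on_defs refl_on_def by blast

lemma leq_trans: "(x, y) \<in> P \<Longrightarrow> (y, z) \<in> P \<Longrightarrow> (x, z) \<in> P"
  using po unfolding order_on_defs trans_def by blast

lemma leq_antisym: "(x, y) \<in> P \<Longrightarrow> (y, x) \<in> P \<Longrightarrow> x = y"
  using po unfolding order_on_defs antisym_def by blast

lemma flag_chain: "A \<in> flags P \<Longrightarrow> A \<in> Chains P"
  by (simp add: flags_def)

lemma flag_finite: "A \<in> flags P \<Longrightarrow> finite A"
  using flag_card by (metis card.infinite add_is_0 zero_neq_numeral)

lemma flag_Field: "A \<in> flags P \<Longrightarrow> F \<in> A \<Longrightarrow> F \<in> Field P"
  using Chains_Field flag_chain by blast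

lemma flag_total: "A \<in> flags P \<Longrightarrow> F \<in> A \<Longrightarrow> G \<in> A \<Longrightarrow> (F, G) \<in> P \<or> (G, F) \<in> P"
  using flag_chain unfolding Chains_def by blast

lemma flag_maximal:
  assumes "A \<in> flags P" "G \<in> Field P" "\<And>H. H \<in> A \<Longrightarrow> (G, H) \<in> P \<or> (H, G) \<in> P"
  shows "G \<in> A"
proof -
  have "insert G A \<in> Chains P"
    using flag_chain[OF assms(1)] assms(2,3) leq_refl unfolding Chains_def by blast
  then show ?thesis using assms(1) unfolding flags_def by blast
qed

text \<open>Flags are finite by assumption, but a chain is not known to be finite before it lies in
  a flag; the extension therefore rests on Zorn's lemma.\<close>

lemma chain_extend:
  assumes "C \<in> Chains P"
  shows "\<exists>A\<in>flags P. C \<subseteq> A"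
proof -
  let ?S = "{D \<in> Chains P. C \<subseteq> D}"
  have *: "\<exists>U\<in>?S. \<forall>V\<in>c. V \<subseteq> U" if c: "c \<in> chains ?S" for c
  proof (cases "c = {}")
    case True
    then show ?thesis using assms by blast
  next
    case False
    have tot: "V \<subseteq> Y \<or> Y \<subseteq> V" if "V \<in> c" "Y \<in> c" for V Y
      using c that unfolding chains_def chain_subset_def by blast
    have sub: "V \<in> Chains P" "C \<subseteq> V" if "V \<in> c" for V
      using c that unfolding chains_def by blast+
    have "\<Union>c \<in> Chains P"
      unfolding Chains_def
    proof (clarsimp)
      fix a b V Y assume *: "a \<in> V" "V \<in> c" "b \<in> Y" "Y \<in> c" "(b, a) \<notin> P"
      then consider "a \<in> Y" | "b \<in> V" using tot by blast
      then show "(a, b) \<in> P"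
        using * sub(1) unfolding Chains_def by cases blast+
    qed
    then show ?thesis using False sub by blast
  qed
  have "\<exists>M\<in>?S. \<forall>V\<in>?S. M \<subseteq> V \<longrightarrow> V = M"
    by (rule Zorn_Lemma2) (rule ballI, rule *)
  then obtain M where M: "M \<in> ?S" "\<forall>V\<in>?S. M \<subseteq> V \<longrightarrow> V = M" by auto
  then have "M \<in> flags P" unfolding flags_def by blast
  then show ?thesis using M(1) by blast
qed

lemma chain_card_flag:
  assumes "C \<in> Chains P" "card C = n + 2"
  shows "C \<in> flags P"
proof -
  obtain A where A: "A \<in> flags P" "C \<subseteq> A" using chain_extend[OF assms(1)] by blast
  then have "C = A" using flag_card[OF A(1)] assms(2) flag_finite[OF A(1)] card_subset_eq by metis
  then show ?thesis using A by simp
qed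

lemma in_flag: "F \<in> Field P \<Longrightarrow> \<exists>A\<in>flags P. F \<in> A"
  using chain_extend[of "{F}"] leq_refl unfolding Chains_def by blast

lemma le_in_flag:
  assumes "(F, G) \<in> P"
  shows "\<exists>A\<in>flags P. F \<in> A \<and> G \<in> A"
proof -
  have "F \<in> Field P" "G \<in> Field P" using assms by (auto intro: FieldI1 FieldI2)
  then have "{F, G} \<in> Chains P" using assms leq_refl unfolding Chains_def by blast
  from chain_extend[OF this] show ?thesis by simp
qed

text \<open>Splice the part of \<open>A\<close> below \<open>F\<close> with the part of
  \<open>B\<close> above \<open>F\<close>: this is a chain, so it has at most \<open>n + 2\<close>
  elements, as many as \<open>B\<close> itself. Applied in both directions, this makes the
  description in \<open>face_rank\<close> unique.\<close>

lemma card_below_le: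
  assumes "A \<in> flags P" "B \<in> flags P" "F \<in> A" "F \<in> B"
  shows "card {G \<in> A. (G, F) \<in> P} \<le> card {G \<in> B. (G, F) \<in> P}"
proof -
  let ?C = "{G \<in> A. (G, F) \<in> P}" and ?D = "{G \<in> B. \<not> (G, F) \<in> P}"
  let ?E = "{G \<in> B. (G, F) \<in> P}"
  have above: "(F, G) \<in> P" if "G \<in> ?D" for G
    using flag_total[OF assms(2), of F G] assms(4) that by auto
  have "(x, y) \<in> P \<or> (y, x) \<in> P" if "x \<in> ?C \<union> ?D" "y \<in> ?C \<union> ?D" for x y
    using that above flag_total[OF assms(1), of x y] flag_total[OF assms(2), of x y] leq_trans
    by blast
  then have "?C \<union> ?D \<in> Chains P" unfolding Chains_def by blast
  from chain_extend[OF this] obtain U where U: "U \<in> flags P" "?C \<union> ?D \<subseteq> U" by auto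
  then have "card (?C \<union> ?D) \<le> n + 2"
    using card_mono[OF flag_finite[OF U(1)] U(2)] flag_card[OF U(1)] by simp
  moreover have "card (?C \<union> ?D) = card ?C + card ?D"
    using flag_finite[OF assms(1)] flag_finite[OF assms(2)] by (intro card_Un_disjoint) auto
  moreover have "card (?E \<union> ?D) = card ?E + card ?D"
    using flag_finite[OF assms(2)] by (intro card_Un_disjoint) auto
  moreover have "?E \<union> ?D = B" by blast
  ultimately show ?thesis using flag_card[OF assms(2)] by simp
qed

lemma face_rank_eq:
  assumes "A \<in> flags P" "F \<in> A"
  shows "rk F = int (card {G \<in> A. (G, F) \<in> P}) - 2"
  unfolding face_rank_def
proof (rule the_equality)
  show "\<exists>C\<in>flags P. F \<in> C \<and> int (card {G \<in> A. (G, F) \<in> P}) - 2 = int (card {G \<in> C. (G, F) \<in> P}) - 2"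
    using assms by blast
next
  fix k assume "\<exists>C\<in>flags P. F \<in> C \<and> k = int (card {G \<in> C. (G, F) \<in> P}) - 2"
  then show "k = int (card {G \<in> A. (G, F) \<in> P}) - 2"
    using card_below_le[OF assms(1) _ assms(2)] card_below_le[OF _ assms(1) _ assms(2)] le_antisym by auto
qed

lemma rank_less:
  assumes "(F, G) \<in> P" "F \<noteq> G"
  shows "rk F < rk G"
proof -
  obtain A where A: "A \<in> flags P" "F \<in> A" "G \<in> A" using le_in_flag[OF assms(1)] by blast
  have "{H \<in> A. (H, F) \<in> P} \<subset> {H \<in> A. (H, G) \<in> P}"
    using assms A leq_trans leq_antisym leq_refl flag_Field by blast
  then show ?thesis
    using face_rank_eq[OF A(1,2)] face_rank_eq[OF A(1,3)] flag_finite[OF A(1)]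
      psubset_card_mono[of "{H \<in> A. (H, G) \<in> P}"] by simp
qed

lemma rank_le: "(F, G) \<in> P \<Longrightarrow> rk F \<le> rk G"
  using rank_less by force

lemma flag_le_iff:
  assumes "A \<in> flags P" "F \<in> A" "G \<in> A"
  shows "(F, G) \<in> P \<longleftrightarrow> rk F \<le> rk G"
  using flag_total[OF assms] rank_less[of G F] rank_le[of F G] leq_refl flag_Field assms by force

lemma flag_rank_inj: "A \<in> flags P \<Longrightarrow> inj_on rk A"
  unfolding inj_on_def using flag_total rank_less by (metis less_irrefl)

lemma flag_rank_bij:
  assumes "A \<in> flags P"
  shows "bij_betw rk A {-1..int n}"
proof -
  have "rk ` A \<subseteq> {-1..int n}"
  proof
    fix k assume "k \<in> rk ` A"
    then obtain F where F: "F \<in> A" "k = rk F" by blast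
    have fin: "finite {G \<in> A. (G, F) \<in> P}" using flag_finite[OF assms] by simp
    have "F \<in> {G \<in> A. (G, F) \<in> P}" using F assms leq_refl flag_Field by blast
    then have "card {G \<in> A. (G, F) \<in> P} \<noteq> 0" using fin by auto
    moreover have "card {G \<in> A. (G, F) \<in> P} \<le> n + 2"
      using card_mono[OF flag_finite[OF assms], of "{G \<in> A. (G, F) \<in> P}"] flag_card[OF assms] by auto
    ultimately show "k \<in> {-1..int n}" using F face_rank_eq[OF assms F(1)] by auto
  qed
  moreover have "card (rk ` A) = card {-1..int n}"
    using card_image[OF flag_rank_inj[OF assms]] flag_card[OF assms] by simp
  ultimately have "rk ` A = {-1..int n}" by (intro card_subset_eq) auto
  then show ?thesis using flag_rank_inj[OF assms] unfolding bij_betw_def by blast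
qed

lemma rank_range: "F \<in> Field P \<Longrightarrow> -1 \<le> rk F \<and> rk F \<le> int n"
  using in_flag flag_rank_bij bij_betw_apply by fastforce

definition face :: "'a set \<Rightarrow> int \<Rightarrow> 'a" where
  "face A i = (THE F. F \<in> A \<and> rk F = i)"

lemma face_props:
  assumes "A \<in> flags P" "-1 \<le> i" "i \<le> int n"
  shows "face A i \<in> A" "rk (face A i) = i"
proof -
  have "i \<in> rk ` A" using flag_rank_bij[OF assms(1)] assms(2,3) unfolding bij_betw_def by auto
  then have "\<exists>!F. F \<in> A \<and> rk F = i"
    using flag_rank_inj[OF assms(1)] unfolding inj_on_def by blast
  from theI'[OF this] show "face A i \<in> A" "rk (face A i) = i" unfolding face_def by auto
qed

lemma face_eqI:
  assumes "A \<in> flags P" "F \<in> A" "rk F = i"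
  shows "face A i = F"
  unfolding face_def using assms flag_rank_inj[OF assms(1)]
  by (intro the_equality) (auto simp: inj_on_def)

lemma face_rank_face: "A \<in> flags P \<Longrightarrow> F \<in> A \<Longrightarrow> face A (rk F) = F"
  by (rule face_eqI) auto

lemma face_le:
  assumes "A \<in> flags P" "-1 \<le> i" "i \<le> j" "j \<le> int n"
  shows "(face A i, face A j) \<in> P"
  using flag_le_iff[OF assms(1)] face_props[OF assms(1), of i] face_props[OF assms(1), of j] assms
  by auto

lemma flag_eq_faces:
  assumes "A \<in> flags P"
  shows "A = face A ` {-1..int n}"
proof -
  have "F \<in> face A ` {-1..int n}" if "F \<in> A" for F
    using face_rank_face[OF assms that] rank_range[OF flag_Field[OF assms that]]
    by (metis atLeastAtMost_iff imageI)
  moreover have "face A i \<in> A" if "i \<in> {-1..int n}" for i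
    using face_props[OF assms] that by auto
  ultimately show ?thesis by blast
qed

lemma flag_eqI:
  assumes "A \<in> flags P" "B \<in> flags P" "\<And>i. -1 \<le> i \<Longrightarrow> i \<le> int n \<Longrightarrow> face A i = face B i"
  shows "A = B"
proof -
  have "face A ` {-1..int n} = face B ` {-1..int n}" using assms(3) by (intro image_cong) auto
  then show ?thesis using flag_eq_faces[OF assms(1)] flag_eq_faces[OF assms(2)] by simp
qed

lemma adjacent_faces:
  assumes "adjacent_flags P A B"
  shows "\<exists>i. -1 \<le> i \<and> i \<le> int n \<and> face A i \<noteq> face B i \<and>
    (\<forall>j. -1 \<le> j \<and> j \<le> int n \<and> j \<noteq> i \<longrightarrow> face A j = face B j) \<and>
    A - B = {face A i} \<and> B - A = {face B i}"
proof -
  have A: "A \<in> flags P" and B: "B \<in> flags P" and c: "card (A - B) = 1" "card (B - A) = 1"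
    using assms unfolding adjacent_flags_def by auto
  obtain F where F: "A - B = {F}" using c(1) card_1_singletonE by blast
  obtain G where G: "B - A = {G}" using c(2) card_1_singletonE by blast
  have FA: "F \<in> A" "F \<notin> B" and GB: "G \<in> B" "G \<notin> A" using F G by auto
  have same: "face A j = face B j" if "-1 \<le> j" "j \<le> int n" "j \<noteq> rk F" for j
  proof -
    have "face A j \<in> A" "rk (face A j) = j" using face_props[OF A that(1,2)] by auto
    then have "face A j \<notin> A - B" using that(3) unfolding F by auto
    then have "face A j \<in> B" using \<open>face A j \<in> A\<close> by simp
    then show ?thesis using face_eqI[OF B _ \<open>rk (face A j) = j\<close>] by simp
  qed
  have r: "-1 \<le> rk F" "rk F \<le> int n" using rank_range flag_Field[OF A FA(1)] by auto
  have fA: "face A (rk F) = F" using face_rank_face[OF A FA(1)] .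
  have "rk G = rk F"
  proof (rule ccontr)
    assume "rk G \<noteq> rk F"
    then have "face A (rk G) = face B (rk G)" using same rank_range flag_Field[OF B GB(1)] by auto
    then have "face A (rk G) = G" using face_rank_face[OF B GB(1)] by simp
    then show False using GB(2) face_props(1)[OF A, of "rk G"] rank_range[OF flag_Field[OF B GB(1)]] by auto
  qed
  then have fB: "face B (rk F) = G" using face_eqI[OF B GB(1)] by simp
  show ?thesis
    by (rule exI[of _ "rk F"]) (use r fA fB FA GB same F G in auto)
qed

lemma adjacent_faceI:
  assumes "A \<in> flags P" "B \<in> flags P" "A \<noteq> B" "-1 \<le> i" "i \<le> int n"
    "\<And>j. -1 \<le> j \<Longrightarrow> j \<le> int n \<Longrightarrow> j \<noteq> i \<Longrightarrow> face A j = face B j"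
  shows "adjacent_flags P A B" "A - B = {face A i}" "B - A = {face B i}"
proof -
  have *: "C - D = {face C i}" if "C \<in> flags P" "D \<in> flags P" "C \<noteq> D"
    and eq: "\<And>j. -1 \<le> j \<Longrightarrow> j \<le> int n \<Longrightarrow> j \<noteq> i \<Longrightarrow> face C j = face D j" for C D
  proof -
    have "F = face C i" if "F \<in> C" "F \<notin> D" for F
    proof (rule ccontr)
      assume "F \<noteq> face C i"
      then have "rk F \<noteq> i" using face_rank_face[OF \<open>C \<in> flags P\<close> that(1)] by auto
      then have "F = face D (rk F)"
        using eq rank_range[OF flag_Field[OF \<open>C \<in> flags P\<close> that(1)]]
          face_rank_face[OF \<open>C \<in> flags P\<close> that(1)] by auto
      then show False
        using that(2) face_props(1)[OF \<open>D \<in> flags P\<close>, of "rk F"] rank_range[OF flag_Field[OF \<open>C \<in> flags P\<close> that(1)]]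
        by auto
    qed
    moreover have "face C i \<notin> D"
    proof
      assume "face C i \<in> D"
      then have "face D i = face C i"
        using face_eqI[OF \<open>D \<in> flags P\<close>] face_props(2)[OF \<open>C \<in> flags P\<close> assms(4,5)] by blast
      then have "C = D"
        using flag_eqI[OF \<open>C \<in> flags P\<close> \<open>D \<in> flags P\<close>] eq by metis
      then show False using \<open>C \<noteq> D\<close> by simp
    qed
    ultimately show ?thesis using face_props(1)[OF \<open>C \<in> flags P\<close> assms(4,5)] by blast
  qed
  show "A - B = {face A i}" using *[OF assms(1-3,6)] .
  moreover show "B - A = {face B i}"
    using *[OF assms(2,1)] assms(3,6) by metis
  ultimately show "adjacent_flags P A B"
    using assms(1,2) unfolding adjacent_flags_def by simp
qed

end

locale polytope_poset =
  fixes n :: nat and P :: "'a rel"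
  assumes poly: "polytope n P"

sublocale polytope_poset \<subseteq> ranked_poset n P
  using poly unfolding polytope_def by unfold_locales auto

context polytope_poset
begin

lemma bot_ex: "\<exists>a\<in>Field P. \<forall>x\<in>Field P. (a, x) \<in> P"
  and top_ex: "\<exists>b\<in>Field P. \<forall>x\<in>Field P. (x, b) \<in> P"
  and sfc: "strongly_flag_connected P"
  and diamond: "diamond_condition P"
  using poly unfolding polytope_def by auto

definition least_face :: 'a where "least_face = (SOME a. a \<in> Field P \<and> (\<forall>x\<in>Field P. (a, x) \<in> P))"
definition greatest_face :: 'a where "greatest_face = (SOME a. a \<in> Field P \<and> (\<forall>x\<in>Field P. (x, a) \<in> P))"

lemma least_face: "least_face \<in> Field P" "x \<in> Field P \<Longrightarrow> (least_face, x) \<in> P"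
  using someI_ex[of "\<lambda>a. a \<in> Field P \<and> (\<forall>x\<in>Field P. (a, x) \<in> P)"] bot_ex unfolding least_face_def by auto

lemma greatest_face: "greatest_face \<in> Field P" "x \<in> Field P \<Longrightarrow> (x, greatest_face) \<in> P"
  using someI_ex[of "\<lambda>a. a \<in> Field P \<and> (\<forall>x\<in>Field P. (x, a) \<in> P)"] top_ex unfolding greatest_face_def by auto

lemma least_face_in_flag: "A \<in> flags P \<Longrightarrow> least_face \<in> A"
  using flag_maximal least_face flag_Field by blast

lemma greatest_face_in_flag: "A \<in> flags P \<Longrightarrow> greatest_face \<in> A"
  using flag_maximal greatest_face flag_Field by blast

lemma flag_ex: "\<exists>A. A \<in> flags P"
  using in_flag least_face(1) by blast

lemma rank_bot: "rk least_face = -1"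
proof -
  obtain A where A: "A \<in> flags P" using flag_ex by blast
  have "(face A (-1), least_face) \<in> P \<or> (least_face, face A (-1)) \<in> P"
    using least_face(2) flag_Field[OF A face_props(1)[OF A]] by auto
  then have "rk least_face \<le> -1"
    using rank_le[of least_face "face A (-1)"] face_props[OF A, of "-1"] least_face(2) flag_Field[OF A] by auto
  then show ?thesis using rank_range[OF least_face(1)] by auto
qed

lemma rank_top: "rk greatest_face = int n"
proof -
  obtain A where A: "A \<in> flags P" using flag_ex by blast
  have "int n \<le> rk greatest_face"
    using rank_le[of "face A (int n)" greatest_face] face_props[OF A, of "int n"] greatest_face(2) flag_Field[OF A] by auto
  then show ?thesis using rank_range[OF greatest_face(1)] by auto
qed

lemma rank_eq_bot: "F \<in> Field P \<Longrightarrow> rk F = -1 \<longleftrightarrow> F = least_face"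
  using rank_less[of least_face F] least_face rank_bot by force

lemma rank_eq_top: "F \<in> Field P \<Longrightarrow> rk F = int n \<longleftrightarrow> F = greatest_face"
  using rank_less[of F greatest_face] greatest_face rank_top by force

lemma face_bot: "A \<in> flags P \<Longrightarrow> face A (-1) = least_face"
  using face_eqI least_face_in_flag rank_bot by blast

lemma face_top: "A \<in> flags P \<Longrightarrow> face A (int n) = greatest_face"
  using face_eqI greatest_face_in_flag rank_top by blast

lemma between:
  assumes "A \<in> flags P" "i < n"
  shows "\<exists>G. G \<noteq> face A (int i) \<and>
    {H. (face A (int i - 1), H) \<in> P \<and> (H, face A (int i + 1)) \<in> P \<and>
        H \<noteq> face A (int i - 1) \<and> H \<noteq> face A (int i + 1)} = {face A (int i), G}"
proof -
  let ?S = "{H. (face A (int i - 1), H) \<in> P \<and> (H, face A (int i + 1)) \<in> P \<and>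
        H \<noteq> face A (int i - 1) \<and> H \<noteq> face A (int i + 1)}"
  have "rk (face A (int i + 1)) = rk (face A (int i - 1)) + 2" "(face A (int i - 1), face A (int i + 1)) \<in> P"
    using face_props[OF assms(1)] face_le[OF assms(1)] assms(2) by auto
  then have c: "card ?S = 2" using diamond unfolding diamond_condition_def by blast
  have r: "rk (face A (int i)) = int i" "rk (face A (int i - 1)) = int i - 1" "rk (face A (int i + 1)) = int i + 1"
    using face_props[OF assms(1)] assms(2) by auto
  have "face A (int i) \<noteq> face A (int i - 1)" "face A (int i) \<noteq> face A (int i + 1)" using r by auto
  moreover have "(face A (int i - 1), face A (int i)) \<in> P" "(face A (int i), face A (int i + 1)) \<in> P"
    by (rule face_le[OF assms(1)]; use assms(2) in simp)+
  ultimately have "face A (int i) \<in> ?S" by auto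
  then show ?thesis using c unfolding card_2_iff by (metis doubleton_eq_iff insertE singletonD)
qed

text \<open>The diamond around the \<open>i\<close>-face supplies another face \<open>G\<close> of
  the same rank. Putting \<open>G\<close> in its place keeps the chain at \<open>n + 2\<close>
  elements, and this number alone makes it a flag.\<close>

lemma adj_ex:
  assumes A: "A \<in> flags P" and i: "i < n"
  shows "\<exists>B\<in>flags P. B \<noteq> A \<and> (\<forall>j. -1 \<le> j \<and> j \<le> int n \<and> j \<noteq> int i \<longrightarrow> face B j = face A j)"
proof -
  obtain G where G: "G \<noteq> face A (int i)" "(face A (int i - 1), G) \<in> P" "(G, face A (int i + 1)) \<in> P"
    "G \<noteq> face A (int i - 1)" "G \<noteq> face A (int i + 1)"
    using between[OF assms] by blast
  have rG: "rk G = int i"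
    using rank_less[OF G(2)] rank_less[OF G(3)] G(4,5) face_props(2)[OF A] i by auto
  have GF: "G \<in> Field P" using G(2) by (rule FieldI2)
  have GA: "G \<notin> A" using face_eqI[OF A _ rG] G(1) by auto
  let ?B = "insert G (A - {face A (int i)})"
  have cmp: "(H, G) \<in> P \<or> (G, H) \<in> P" if H: "H \<in> A - {face A (int i)}" for H
  proof -
    have HA: "H \<in> A" and "rk H \<noteq> int i" using H face_rank_face[OF A, of H] by auto
    then consider "rk H \<le> int i - 1" | "int i + 1 \<le> rk H" by linarith
    then show ?thesis
    proof cases
      case 1
      then have "(H, face A (int i - 1)) \<in> P"
        using flag_le_iff[OF A HA face_props(1)[OF A]] face_props(2)[OF A] i by auto
      then show ?thesis using G(2) leq_trans by blast
    next
      case 2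
      then have "(face A (int i + 1), H) \<in> P"
        using flag_le_iff[OF A face_props(1)[OF A] HA] face_props(2)[OF A] i by auto
      then show ?thesis using G(3) leq_trans by blast
    qed
  qed
  have "?B \<in> Chains P"
    using cmp flag_total[OF A] leq_refl[OF GF] unfolding Chains_def by blast
  moreover have "card ?B = n + 2"
    using GA flag_finite[OF A] flag_card[OF A] face_props(1)[OF A, of "int i"] i by simp
  ultimately have B: "?B \<in> flags P" by (rule chain_card_flag)
  have "face ?B j = face A j" if "-1 \<le> j" "j \<le> int n" "j \<noteq> int i" for j
  proof -
    have "face A j \<noteq> face A (int i)"
      using face_props(2)[OF A that(1,2)] face_props(2)[OF A, of "int i"] that i by auto
    then show ?thesis
      using face_props[OF A that(1,2)] by (intro face_eqI[OF B]) auto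
  qed
  moreover have "?B \<noteq> A" using GA by blast
  ultimately show ?thesis by (intro bexI[OF _ B]) simp
qed

lemma adj_unique:
  assumes A: "A \<in> flags P" and B: "B \<in> flags P" and C: "C \<in> flags P" and i: "i < n"
    and "B \<noteq> A" "C \<noteq> A"
    and eqB: "\<And>j. -1 \<le> j \<Longrightarrow> j \<le> int n \<Longrightarrow> j \<noteq> int i \<Longrightarrow> face B j = face A j"
    and eqC: "\<And>j. -1 \<le> j \<Longrightarrow> j \<le> int n \<Longrightarrow> j \<noteq> int i \<Longrightarrow> face C j = face A j"
  shows "B = C"
proof -
  obtain G where S: "{H. (face A (int i - 1), H) \<in> P \<and> (H, face A (int i + 1)) \<in> P \<and>
        H \<noteq> face A (int i - 1) \<and> H \<noteq> face A (int i + 1)} = {face A (int i), G}"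
    using between[OF A i] by blast
  have *: "face D (int i) = G" if D: "D \<in> flags P" "D \<noteq> A"
    and eq: "\<And>j. -1 \<le> j \<Longrightarrow> j \<le> int n \<Longrightarrow> j \<noteq> int i \<Longrightarrow> face D j = face A j" for D
  proof -
    have "face D (int i) \<noteq> face A (int i)"
      using flag_eqI[OF D(1) A] eq D(2) by metis
    moreover have "(face D (int i - 1), face D (int i)) \<in> P" "(face D (int i), face D (int i + 1)) \<in> P"
      by (rule face_le[OF D(1)]; use i in simp)+
    moreover have "face D (int i - 1) = face A (int i - 1)" "face D (int i + 1) = face A (int i + 1)"
      using eq i by auto
    moreover have "face D (int i) \<noteq> face D (int i - 1)" "face D (int i) \<noteq> face D (int i + 1)"
      using face_props(2)[OF D(1), of "int i"] face_props(2)[OF D(1), of "int i - 1"]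
        face_props(2)[OF D(1), of "int i + 1"] i by auto
    ultimately show ?thesis using S by auto
  qed
  show ?thesis
    using flag_eqI[OF B C] eqB eqC *[OF B assms(5) eqB] *[OF C assms(6) eqC] by metis
qed

text \<open>The definition of \<open>adj\<close> speaks of the rank of the exchanged face. Comparing
  the faces rank by rank is the form that later arguments can check directly.\<close>

lemma adj_iff:
  assumes A: "A \<in> flags P" and i: "i < n"
  shows "B = adj P i A \<longleftrightarrow> B \<in> flags P \<and> B \<noteq> A \<and>
    (\<forall>j. -1 \<le> j \<and> j \<le> int n \<and> j \<noteq> int i \<longrightarrow> face B j = face A j)"
proof -
  let ?Q = "\<lambda>B. adjacent_flags P A B \<and> (\<exists>F\<in>A - B. rk F = int i)"
  let ?R = "\<lambda>B. B \<in> flags P \<and> B \<noteq> A \<and>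
    (\<forall>j. -1 \<le> j \<and> j \<le> int n \<and> j \<noteq> int i \<longrightarrow> face B j = face A j)"
  have QR: "?Q B = ?R B" for B
  proof
    assume Q: "?Q B"
    then have "adjacent_flags P A B" ..
    from adjacent_faces[OF this] obtain k where k: "-1 \<le> k" "k \<le> int n" "face A k \<noteq> face B k"
      "\<forall>j. -1 \<le> j \<and> j \<le> int n \<and> j \<noteq> k \<longrightarrow> face A j = face B j" "A - B = {face A k}"
      by (elim exE conjE) (rule that)
    then have "k = int i" using Q face_props[OF A k(1,2)] by auto
    then show "?R B" using k Q unfolding adjacent_flags_def by auto
  next
    assume R: "?R B"
    then have "adjacent_flags P A B" "A - B = {face A (int i)}"
      using adjacent_faceI[OF A, of B "int i"] i by auto
    then show "?Q B" using face_props(2)[OF A, of "int i"] i by auto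
  qed
  have un: "B = C" if "?R B" "?R C" for B C
    using that adj_unique[OF A _ _ i, of B C] by blast
  obtain B0 where B0: "?R B0" using adj_ex[OF A i] by blast
  have "adj P i A = (THE B. ?R B)" unfolding adj_def QR ..
  also have "\<dots> = B0" by (rule the_equality) (rule B0, rule un, assumption, rule B0)
  finally have eq: "adj P i A = B0" .
  show ?thesis
  proof
    assume "B = adj P i A"
    then show "?R B" using B0 eq by simp
  next
    assume "?R B"
    then show "B = adj P i A" using un[OF _ B0] eq by simp
  qed
qed

lemma adj_flag: "A \<in> flags P \<Longrightarrow> i < n \<Longrightarrow> adj P i A \<in> flags P"
  and adj_neq: "A \<in> flags P \<Longrightarrow> i < n \<Longrightarrow> adj P i A \<noteq> A"
  and adj_face: "A \<in> flags P \<Longrightarrow> i < n \<Longrightarrow> -1 \<le> j \<Longrightarrow> j \<le> int n \<Longrightarrow> j \<noteq> int i \<Longrightarrow>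
    face (adj P i A) j = face A j"
  using adj_iff by auto

lemma adj_eqI:
  assumes "A \<in> flags P" "B \<in> flags P" "i < n" "B \<noteq> A"
    "\<And>j. -1 \<le> j \<Longrightarrow> j \<le> int n \<Longrightarrow> j \<noteq> int i \<Longrightarrow> face B j = face A j"
  shows "B = adj P i A"
  using adj_iff assms by blast

lemma adj_face_neq:
  assumes "A \<in> flags P" "i < n"
  shows "face (adj P i A) (int i) \<noteq> face A (int i)"
  using flag_eqI[OF adj_flag[OF assms] assms(1)] adj_face[OF assms] adj_neq[OF assms] by metis

lemma adj_adjacent:
  assumes "A \<in> flags P" "i < n"
  shows "adjacent_flags P A (adj P i A)"
  using adjacent_faceI[OF assms(1) adj_flag[OF assms] adj_neq[OF assms, symmetric], of "int i"]
    adj_face[OF assms] assms(2) by auto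

lemma adjacent_adj:
  assumes "adjacent_flags P A B"
  obtains i where "i < n" "B = adj P i A" "A - B = {face A (int i)}"
proof -
  have A: "A \<in> flags P" and B: "B \<in> flags P" using assms unfolding adjacent_flags_def by auto
  obtain k where k: "-1 \<le> k" "k \<le> int n" "face A k \<noteq> face B k"
      "\<forall>j. -1 \<le> j \<and> j \<le> int n \<and> j \<noteq> k \<longrightarrow> face A j = face B j" "A - B = {face A k}"
    using adjacent_faces[OF assms] by (elim exE conjE) (rule that)
  have "k \<noteq> -1" "k \<noteq> int n" using k(3) face_bot[OF A] face_bot[OF B] face_top[OF A] face_top[OF B] by auto
  define i where "i = nat k"
  have i: "k = int i" "i < n" using k(1,2) \<open>k \<noteq> -1\<close> \<open>k \<noteq> int n\<close> unfolding i_def by auto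
  have "A \<noteq> B" using k(3) by auto
  then have "B = adj P i A" using adj_eqI[OF A B i(2)] k(4) i(1) by auto
  then show ?thesis using that i k(5) by blast
qed

lemma adj_adj: "A \<in> flags P \<Longrightarrow> i < n \<Longrightarrow> adj P i (adj P i A) = A"
  using adj_eqI[OF adj_flag] adj_face adj_neq by metis

text \<open>Changing the \<open>j\<close>-face leaves the faces of ranks \<open>i - 1\<close>,
  \<open>i\<close> and \<open>i + 1\<close> alone, so both sides choose their \<open>i\<close>-face
  from the same diamond and must choose its other element.\<close>

lemma adj_commute:
  assumes A: "A \<in> flags P" and i: "i < n" and j: "j < n" and ij: "i + 1 < j \<or> j + 1 < i"
  shows "adj P i (adj P j A) = adj P j (adj P i A)"
proof -
  let ?B = "adj P j A" let ?C = "adj P i ?B" let ?D = "adj P i A"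
  have B: "?B \<in> flags P" and D: "?D \<in> flags P" using adj_flag A i j by auto
  have C: "?C \<in> flags P" using adj_flag B i by auto
  obtain G where G: "{H. (face A (int i - 1), H) \<in> P \<and> (H, face A (int i + 1)) \<in> P \<and>
        H \<noteq> face A (int i - 1) \<and> H \<noteq> face A (int i + 1)} = {face A (int i), G}"
    using between[OF A i] by blast
  have *: "face E (int i) \<in> {face A (int i), G}"
    if E: "E \<in> flags P" "face E (int i - 1) = face A (int i - 1)" "face E (int i + 1) = face A (int i + 1)" for E
  proof -
    have "(face E (int i - 1), face E (int i)) \<in> P" "(face E (int i), face E (int i + 1)) \<in> P"
      by (rule face_le[OF E(1)]; use i in simp)+
    moreover have "face E (int i) \<noteq> face E (int i - 1)" "face E (int i) \<noteq> face E (int i + 1)"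
      using face_props(2)[OF E(1), of "int i"] face_props(2)[OF E(1), of "int i - 1"]
        face_props(2)[OF E(1), of "int i + 1"] i by auto
    ultimately show ?thesis using G E(2,3) by auto
  qed
  have "face ?C (int i - 1) = face A (int i - 1)" "face ?C (int i + 1) = face A (int i + 1)"
    using adj_face[OF B i, of "int i - 1"] adj_face[OF B i, of "int i + 1"]
      adj_face[OF A j, of "int i - 1"] adj_face[OF A j, of "int i + 1"] i ij by auto
  then have c: "face ?C (int i) \<in> {face A (int i), G}" using *[OF C] by blast
  have "face ?D (int i) \<in> {face A (int i), G}"
    using *[OF D] adj_face[OF A i] i by auto
  moreover have "face ?D (int i) \<noteq> face A (int i)" using adj_face_neq[OF A i] .
  moreover have "face ?C (int i) \<noteq> face A (int i)"
    using adj_face_neq[OF B i] adj_face[OF A j, of "int i"] i ij by auto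
  ultimately have ci: "face ?C (int i) = face ?D (int i)" using c by auto
  have "face ?C k = face ?D k" if "-1 \<le> k" "k \<le> int n" "k \<noteq> int j" for k
    using ci adj_face[OF B i that(1,2)] adj_face[OF A j that] adj_face[OF A i that(1,2)]
    by (cases "k = int i") auto
  moreover have "?C \<noteq> ?D"
    using adj_face_neq[OF A j] adj_face[OF B i, of "int j"] adj_face[OF A i, of "int j"] i j ij by auto
  ultimately show ?thesis using adj_eqI[OF D C j] by blast
qed

text \<open>Strong flag-connectedness as an induction rule: the connecting sequence keeps all of
  \<open>A \<inter> B\<close>, hence every set \<open>C\<close> contained in both flags, and only
  adjacencies that keep \<open>C\<close> have to be treated.\<close>

lemma flag_connected_above:
  assumes A: "A \<in> S" "A \<in> flags P" "C \<subseteq> A" and B: "B \<in> flags P" "C \<subseteq> B"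
    and step: "\<And>D i. D \<in> S \<Longrightarrow> D \<in> flags P \<Longrightarrow> C \<subseteq> D \<Longrightarrow> i < n \<Longrightarrow> C \<subseteq> adj P i D \<Longrightarrow>
      adj P i D \<in> S"
  shows "B \<in> S"
proof -
  let ?r = "{(D, E). adjacent_flags P D E \<and> A \<inter> B \<subseteq> D \<and> A \<inter> B \<subseteq> E}"
  have "(A, B) \<in> ?r\<^sup>*" using sfc A B unfolding strongly_flag_connected_def by blast
  then show ?thesis
  proof (induction rule: rtrancl_induct)
    case base
    then show ?case using A(1) .
  next
    case (step D E)
    then have DE: "adjacent_flags P D E" "C \<subseteq> D" "C \<subseteq> E" using A(3) B(2) by auto
    obtain i where "i < n" "E = adj P i D" using adjacent_adj[OF DE(1)] by metis
    then show ?case using assms(6)[of D i] step DE unfolding adjacent_flags_def by auto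
  qed
qed

lemma flag_connected:
  assumes "A \<in> S" "A \<in> flags P" "B \<in> flags P"
    and "\<And>D i. D \<in> S \<Longrightarrow> D \<in> flags P \<Longrightarrow> i < n \<Longrightarrow> adj P i D \<in> S"
  shows "B \<in> S"
  using flag_connected_above[of A S "{}" B] assms by auto

end

text \<open>Serves to compare numbers of orbits: only the partition that a map induces on
  \<open>S\<close> counts, so \<open>f\<close> and \<open>g\<close> may have different target
  types.\<close>

lemma card_image_eqI:
  assumes "\<And>x y. x \<in> S \<Longrightarrow> y \<in> S \<Longrightarrow> f x = f y \<longleftrightarrow> g x = g y"
  shows "card (f ` S) = card (g ` S)"
proof -
  let ?h = "\<lambda>u. f (inv_into S g u)"
  have h: "?h (g x) = f x" if "x \<in> S" for x
  proof -
    have "g x \<in> g ` S" using that by blast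
    then have "inv_into S g (g x) \<in> S" "g (inv_into S g (g x)) = g x"
      by (rule inv_into_into, rule f_inv_into_f)
    then show ?thesis using assms that by blast
  qed
  then have "?h ` g ` S = f ` S" unfolding image_image by (intro image_cong) auto
  moreover have "inj_on ?h (g ` S)"
  proof (rule inj_onI)
    fix u v assume "u \<in> g ` S" "v \<in> g ` S" "?h u = ?h v"
    then obtain x y where "x \<in> S" "u = g x" "y \<in> S" "v = g y" "?h u = ?h v" by blast
    then show "u = v" using h assms by metis
  qed
  ultimately show ?thesis using card_image by metis
qed

text \<open>The isomorphism hidden in \<open>poset_iso\<close>. Its values off
  \<open>Field P\<close> are free, whereas elements of \<open>aut_group\<close> are extensional;
  automorphisms are handled in this form and restricted only when the group itself is
  involved.\<close>

definition poset_map :: "('a \<Rightarrow> 'b) \<Rightarrow> 'a rel \<Rightarrow> 'b rel \<Rightarrow> bool" where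
  "poset_map f P Q \<longleftrightarrow> bij_betw f (Field P) (Field Q) \<and>
     (\<forall>x\<in>Field P. \<forall>y\<in>Field P. (x, y) \<in> P \<longleftrightarrow> (f x, f y) \<in> Q)"

lemma poset_iso_map: "poset_iso P Q \<longleftrightarrow> (\<exists>f. poset_map f P Q)"
  unfolding poset_iso_def poset_map_def ..

lemma poset_map_comp:
  assumes "poset_map f P Q" "poset_map g Q R"
  shows "poset_map (g \<circ> f) P R"
  using assms bij_betw_trans[of f "Field P" "Field Q" g "Field R"]
  unfolding poset_map_def by (auto dest: bij_betwE)

lemma poset_map_inv:
  assumes "poset_map f P Q"
  shows "poset_map (inv_into (Field P) f) Q P"
proof -
  have b: "bij_betw f (Field P) (Field Q)" using assms unfolding poset_map_def by blast
  have "(x, y) \<in> Q \<longleftrightarrow> (inv_into (Field P) f x, inv_into (Field P) f y) \<in> P"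
    if "x \<in> Field Q" "y \<in> Field Q" for x y
    using assms that bij_betw_inv_into_right[OF b] bij_betwE[OF bij_betw_inv_into[OF b]]
    unfolding poset_map_def by metis
  then show ?thesis using bij_betw_inv_into[OF b] unfolding poset_map_def by blast
qed

lemma poset_map_id: "poset_map id P P"
  unfolding poset_map_def by auto

lemma poset_map_cong:
  assumes "\<And>x. x \<in> Field P \<Longrightarrow> f x = g x"
  shows "poset_map f P Q \<longleftrightarrow> poset_map g P Q"
  using assms bij_betw_cong[of "Field P" f g "Field Q"] unfolding poset_map_def by auto

locale poset_isom =
  fixes f :: "'a \<Rightarrow> 'b" and P :: "'a rel" and Q :: "'b rel"
  assumes pm: "poset_map f P Q"
begin

lemma bij: "bij_betw f (Field P) (Field Q)"
  and le_iff: "x \<in> Field P \<Longrightarrow> y \<in> Field P \<Longrightarrow> (f x, f y) \<in> Q \<longleftrightarrow> (x, y) \<in> P"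
  using pm unfolding poset_map_def by auto

lemma inj: "inj_on f (Field P)" and surj: "f ` Field P = Field Q"
  using bij unfolding bij_betw_def by auto

lemma map_Field: "x \<in> Field P \<Longrightarrow> f x \<in> Field Q"
  using surj by blast

lemma chain_image: "C \<in> Chains P \<Longrightarrow> f ` C \<in> Chains Q"
  using Chains_Field[of C P] le_iff unfolding Chains_def by blast

lemma card_image_Field: "C \<subseteq> Field P \<Longrightarrow> card (f ` C) = card C"
  using inj card_image inj_on_subset by blast

lemma inv_image: "C \<subseteq> Field P \<Longrightarrow> inv_into (Field P) f ` f ` C = C"
  using inj by (auto simp: image_iff subset_eq)

lemma image_inv: "D \<subseteq> Field Q \<Longrightarrow> f ` inv_into (Field P) f ` D = D"
  using surj image_inv_into_cancel by blast

lemma inv_isom: "poset_isom (inv_into (Field P) f) Q P"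
  using poset_map_inv[OF pm] by unfold_locales

lemma flag_image:
  assumes "A \<in> flags P"
  shows "f ` A \<in> flags Q"
proof -
  interpret I: poset_isom "inv_into (Field P) f" Q P by (rule inv_isom)
  have A: "A \<in> Chains P" "A \<subseteq> Field P" using assms Chains_Field unfolding flags_def by blast+
  have "D = f ` A" if D: "D \<in> Chains Q" "f ` A \<subseteq> D" for D
  proof -
    have "A \<subseteq> inv_into (Field P) f ` D" using D(2) inv_image[OF A(2)] by blast
    then have "inv_into (Field P) f ` D = A"
      using assms I.chain_image[OF D(1)] unfolding flags_def by blast
    then show ?thesis using image_inv[OF Chains_Field[OF D(1)]] by simp
  qed
  then show ?thesis using chain_image[OF A(1)] unfolding flags_def by blast
qed

lemma flags_eq: "flags Q = (`) f ` flags P"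
proof -
  interpret I: poset_isom "inv_into (Field P) f" Q P by (rule inv_isom)
  have "B \<in> (`) f ` flags P" if "B \<in> flags Q" for B
  proof -
    have "B \<subseteq> Field Q" using that Chains_Field unfolding flags_def by blast
    then have "B = f ` inv_into (Field P) f ` B" using image_inv by simp
    then show ?thesis using I.flag_image[OF that] by blast
  qed
  then show ?thesis using flag_image by blast
qed

lemma flag_sub: "A \<in> flags P \<Longrightarrow> A \<subseteq> Field P"
  using Chains_Field unfolding flags_def by blast

lemma face_rank_map:
  assumes "F \<in> Field P"
  shows "face_rank Q (f F) = face_rank P F"
proof -
  have mem: "f F \<in> f ` C \<longleftrightarrow> F \<in> C" if "C \<in> flags P" for C
    using inj_on_image_mem_iff[OF inj assms flag_sub[OF that]] .
  have "{G \<in> f ` C. (G, f F) \<in> Q} = f ` {G \<in> C. (G, F) \<in> P}" if "C \<in> flags P" for C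
    using le_iff[OF _ assms] flag_sub[OF that] by blast
  then have "card {G \<in> f ` C. (G, f F) \<in> Q} = card {G \<in> C. (G, F) \<in> P}" if "C \<in> flags P" for C
    using card_image_Field[of "{G \<in> C. (G, F) \<in> P}"] flag_sub[OF that] that by auto
  then have "(\<exists>C\<in>flags Q. f F \<in> C \<and> k = int (card {G \<in> C. (G, f F) \<in> Q}) - 2) \<longleftrightarrow>
    (\<exists>C\<in>flags P. F \<in> C \<and> k = int (card {G \<in> C. (G, F) \<in> P}) - 2)" for k
    unfolding flags_eq using mem by auto
  then show ?thesis unfolding face_rank_def by presburger
qed

lemma adjacent_map:
  assumes "A \<in> flags P" "B \<in> flags P"
  shows "adjacent_flags Q (f ` A) (f ` B) \<longleftrightarrow> adjacent_flags P A B"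
proof -
  have "f ` C - f ` D = f ` (C - D)" if "C \<in> flags P" "D \<in> flags P" for C D
    using inj_on_image_set_diff[OF inj, of C D] flag_sub[OF that(1)] flag_sub[OF that(2)] by blast
  note d = this
  have "card (f ` A - f ` B) = card (A - B)" "card (f ` B - f ` A) = card (B - A)"
    unfolding d[OF assms] d[OF assms(2,1)]
    by (rule card_image_Field; use flag_sub[OF assms(1)] flag_sub[OF assms(2)] in blast)+
  then show ?thesis
    using assms flag_image unfolding adjacent_flags_def by simp
qed

lemma polytope_map:
  assumes "polytope n P"
  shows "polytope n Q"
proof -
  interpret P: polytope_poset n P using assms by unfold_locales
  have Qx: "\<exists>x\<in>Field P. y = f x" if "y \<in> Field Q" for y
    using that surj by blast
  have "Partial_order Q"
    unfolding order_on_defs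
  proof (intro conjI)
    show "Q \<subseteq> Field Q \<times> Field Q" by (auto intro: FieldI1 FieldI2)
    show "Refl Q" unfolding refl_on_def using Qx le_iff P.leq_refl by blast
    show "trans Q"
    proof (rule transI)
      fix x y z assume *: "(x, y) \<in> Q" "(y, z) \<in> Q"
      then obtain x' y' z' where "x' \<in> Field P" "y' \<in> Field P" "z' \<in> Field P"
        "x = f x'" "y = f y'" "z = f z'"
        using Qx[of x] Qx[of y] Qx[of z] by (auto dest: FieldI1 FieldI2)
      then show "(x, z) \<in> Q" using * le_iff P.leq_trans by metis
    qed
    show "antisym Q"
    proof (rule antisymI)
      fix x y assume *: "(x, y) \<in> Q" "(y, x) \<in> Q"
      then obtain x' y' where "x' \<in> Field P" "y' \<in> Field P" "x = f x'" "y = f y'"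
        using Qx[of x] Qx[of y] by (auto dest: FieldI1 FieldI2)
      then show "x = y" using * le_iff P.leq_antisym by metis
    qed
  qed
  moreover have "\<exists>a\<in>Field Q. \<forall>x\<in>Field Q. (a, x) \<in> Q"
    using P.least_face le_iff Qx map_Field by metis
  moreover have "\<exists>b\<in>Field Q. \<forall>x\<in>Field Q. (x, b) \<in> Q"
    using P.greatest_face le_iff Qx map_Field by metis
  moreover have "\<forall>C\<in>flags Q. card C = n + 2"
    unfolding flags_eq using P.flag_card card_image_Field flag_sub by auto
  moreover have "strongly_flag_connected Q"
    unfolding strongly_flag_connected_def flags_eq
  proof (clarify)
    fix A B assume A: "A \<in> flags P" and B: "B \<in> flags P"
    have int: "f ` A \<inter> f ` B = f ` (A \<inter> B)"
      using inj_on_image_Int[OF inj] flag_sub[OF A] flag_sub[OF B] by blast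
    define I where "I = A \<inter> B"
    have "(A, B) \<in> {(C, D). adjacent_flags P C D \<and> I \<subseteq> C \<and> I \<subseteq> D}\<^sup>*"
      using P.sfc A B unfolding strongly_flag_connected_def I_def by blast
    then show "(f ` A, f ` B) \<in> {(C, D). adjacent_flags Q C D \<and> f ` A \<inter> f ` B \<subseteq> C \<and>
         f ` A \<inter> f ` B \<subseteq> D}\<^sup>*"
      unfolding int I_def[symmetric]
    proof (induction rule: rtrancl_induct)
      case base
      then show ?case by simp
    next
      case (step C D)
      then have "adjacent_flags Q (f ` C) (f ` D)"
        using adjacent_map unfolding adjacent_flags_def by blast
      moreover have "f ` I \<subseteq> f ` C" "f ` I \<subseteq> f ` D" using step.hyps by blast+
      ultimately have "(f ` C, f ` D) \<in> {(C, D). adjacent_flags Q C D \<and>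
          f ` I \<subseteq> C \<and> f ` I \<subseteq> D}" by simp
      with step.IH show ?case by (rule rtrancl_into_rtrancl)
    qed
  qed
  moreover have "diamond_condition Q"
    unfolding diamond_condition_def
  proof (clarify)
    fix F G assume *: "(F, G) \<in> Q" "face_rank Q G = face_rank Q F + 2"
    then obtain F' G' where F': "F' \<in> Field P" "G' \<in> Field P" "F = f F'" "G = f G'"
      using Qx[of F] Qx[of G] by (auto dest: FieldI1 FieldI2)
    let ?S = "{H. (F', H) \<in> P \<and> (H, G') \<in> P \<and> H \<noteq> F' \<and> H \<noteq> G'}"
    have c: "card ?S = 2"
      using P.diamond * F' le_iff face_rank_map unfolding diamond_condition_def by auto
    have sub: "?S \<subseteq> Field P" by (auto intro: FieldI1)
    have "{H. (F, H) \<in> Q \<and> (H, G) \<in> Q \<and> H \<noteq> F \<and> H \<noteq> G} = f ` ?S"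
    proof -
      have "H \<in> f ` ?S" if H: "(F, H) \<in> Q" "(H, G) \<in> Q" "H \<noteq> F" "H \<noteq> G" for H
      proof -
        obtain H' where "H' \<in> Field P" "H = f H'" using Qx[of H] H(1) by (auto dest: FieldI2)
        then show ?thesis using H F' le_iff by blast
      qed
      moreover have "(F, f H) \<in> Q \<and> (f H, G) \<in> Q \<and> f H \<noteq> F \<and> f H \<noteq> G" if "H \<in> ?S" for H
        using that sub F' le_iff inj_onD[OF inj] by blast
      ultimately show ?thesis by blast
    qed
    then show "card {H. (F, H) \<in> Q \<and> (H, G) \<in> Q \<and> H \<noteq> F \<and> H \<noteq> G} = 2"
      using card_image_Field[OF sub] c by simp
  qed
  ultimately show ?thesis unfolding polytope_def by blast
qed

lemma adj_map:
  assumes "polytope n P" "A \<in> flags P" "i < n"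
  shows "adj Q i (f ` A) = f ` adj P i A"
proof -
  interpret P: polytope_poset n P using assms(1) by unfold_locales
  interpret Q: polytope_poset n Q using polytope_map[OF assms(1)] by unfold_locales
  have face: "Q.face (f ` B) j = f (P.face B j)" if "B \<in> flags P" "-1 \<le> j" "j \<le> int n" for B j
    using P.face_props[OF that] face_rank_map flag_sub[OF that(1)]
    by (intro Q.face_eqI flag_image that(1)) auto
  have sub: "A \<subseteq> Field P" "adj P i A \<subseteq> Field P"
    using flag_sub assms P.adj_flag by auto
  have "f ` adj P i A \<noteq> f ` A"
    using inj_on_image_eq_iff[OF inj sub(2,1)] P.adj_neq[OF assms(2,3)] by simp
  then have "f ` adj P i A = adj Q i (f ` A)"
    using face P.adj_flag P.adj_face assms(2,3) flag_image
    by (intro Q.adj_eqI) auto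
  then show ?thesis ..
qed

end

lemma poset_isomI: "poset_map f P Q \<Longrightarrow> poset_isom f P Q"
  by unfold_locales

section \<open>Automorphisms\<close>

lemma aut_group_carrier:
  "f \<in> carrier (aut_group P) \<longleftrightarrow> f \<in> extensional (Field P) \<and> poset_map f P P"
  unfolding aut_group_def poset_map_def Bij_def by auto

lemma poset_map_restrict: "poset_map f P P \<Longrightarrow> restrict f (Field P) \<in> carrier (aut_group P)"
  using poset_map_cong[of P "restrict f (Field P)" f P] by (simp add: aut_group_carrier)

lemma aut_group_one: "\<one>\<^bsub>aut_group P\<^esub> = (\<lambda>x\<in>Field P. x)"
  and aut_group_mult: "f \<in> carrier (aut_group P) \<Longrightarrow> g \<in> carrier (aut_group P) \<Longrightarrow>
    f \<otimes>\<^bsub>aut_group P\<^esub> g = compose (Field P) f g"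
  unfolding aut_group_def BijGroup_def by auto

lemma group_aut_group: "group (aut_group P)"
proof -
  have c: "compose (Field P) f g \<in> carrier (aut_group P)"
    if "f \<in> carrier (aut_group P)" "g \<in> carrier (aut_group P)" for f g
    using that poset_map_comp[of g P P f P] poset_map_cong[of P "compose (Field P) f g" "f \<circ> g" P]
    by (auto simp: aut_group_carrier compose_eq)
  have i: "restrict (inv_into (Field P) f) (Field P) \<in> carrier (aut_group P)"
    if "f \<in> carrier (aut_group P)" for f
    by (rule poset_map_restrict, rule poset_map_inv) (use that aut_group_carrier in blast)
  have B: "f \<in> Bij (Field P)" if "f \<in> carrier (aut_group P)" for f
    using that unfolding aut_group_def by simp
  have "subgroup (carrier (aut_group P)) (BijGroup (Field P))"
  proof (rule group.subgroupI[OF group_BijGroup])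
    show "carrier (aut_group P) \<subseteq> carrier (BijGroup (Field P))"
      using B unfolding BijGroup_def by auto
    have "\<one>\<^bsub>aut_group P\<^esub> \<in> carrier (aut_group P)"
    proof -
      have "(\<lambda>x\<in>Field P. x) = restrict id (Field P)" by (auto simp: restrict_def)
      then show ?thesis
        unfolding aut_group_one using poset_map_restrict[OF poset_map_id[of P]] by (simp only:)
    qed
    then show "carrier (aut_group P) \<noteq> {}" by blast
  next
    fix f assume f: "f \<in> carrier (aut_group P)"
    have "inv\<^bsub>BijGroup (Field P)\<^esub> f = restrict (inv_into (Field P) f) (Field P)"
    proof (rule group.inv_equality[OF group_BijGroup])
      show "restrict (inv_into (Field P) f) (Field P) \<otimes>\<^bsub>BijGroup (Field P)\<^esub> f = \<one>\<^bsub>BijGroup (Field P)\<^esub>"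
        using B[OF f] restrict_inv_into_Bij[OF B[OF f]] Bij_compose_restrict_eq[OF B[OF f]]
        unfolding BijGroup_def by simp
    qed (use B[OF f] restrict_inv_into_Bij[OF B[OF f]] in \<open>simp_all add: BijGroup_def\<close>)
    then show "inv\<^bsub>BijGroup (Field P)\<^esub> f \<in> carrier (aut_group P)" using i[OF f] by simp
  next
    fix f g assume "f \<in> carrier (aut_group P)" "g \<in> carrier (aut_group P)"
    then show "f \<otimes>\<^bsub>BijGroup (Field P)\<^esub> g \<in> carrier (aut_group P)"
      using c B unfolding BijGroup_def by simp
  qed
  from group.subgroup_imp_group[OF group_BijGroup this] show ?thesis
    unfolding aut_group_def by simp
qed

lemma flag_orbit_alt:
  assumes "A \<subseteq> Field P"
  shows "flag_orbit P A = {f ` A |f. poset_map f P P}"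
proof -
  have "restrict f (Field P) ` A = f ` A" for f :: "'a \<Rightarrow> 'a"
    using assms by (intro image_cong) auto
  note eq = this
  show ?thesis
  proof
    show "flag_orbit P A \<subseteq> {f ` A |f. poset_map f P P}"
      unfolding flag_orbit_def aut_group_carrier by blast
    show "{f ` A |f. poset_map f P P} \<subseteq> flag_orbit P A"
      unfolding flag_orbit_def using poset_map_restrict eq by (smt (verit) Collect_mono)
  qed
qed

lemma flag_orbit_eq_iff:
  assumes "A \<subseteq> Field P" "B \<subseteq> Field P"
  shows "flag_orbit P A = flag_orbit P B \<longleftrightarrow> (\<exists>f. poset_map f P P \<and> f ` A = B)"
proof
  assume "flag_orbit P A = flag_orbit P B"
  moreover have "B \<in> flag_orbit P B"
    unfolding flag_orbit_alt[OF assms(2)] using poset_map_id[of P] by (auto intro!: exI[of _ id])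
  ultimately have "B \<in> flag_orbit P A" by simp
  then show "\<exists>f. poset_map f P P \<and> f ` A = B" unfolding flag_orbit_alt[OF assms(1)] by blast
next
  assume "\<exists>f. poset_map f P P \<and> f ` A = B"
  then obtain f where f: "poset_map f P P" "f ` A = B" by blast
  have "g ` B \<in> flag_orbit P A" if "poset_map g P P" for g
  proof -
    have "g ` B = (g \<circ> f) ` A" using f(2) by (metis image_comp)
    then show ?thesis
      unfolding flag_orbit_alt[OF assms(1)] using poset_map_comp[OF f(1) that] by blast
  qed
  moreover have "g ` A \<in> flag_orbit P B" if "poset_map g P P" for g
  proof -
    have "A = inv_into (Field P) f ` B"
      using poset_isom.inv_image[OF poset_isomI[OF f(1)] assms(1)] f(2) by simp
    then have "g ` A = (g \<circ> inv_into (Field P) f) ` B" by (metis image_comp)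
    then show ?thesis
      unfolding flag_orbit_alt[OF assms(2)] using poset_map_comp[OF poset_map_inv[OF f(1)] that] by blast
  qed
  ultimately show "flag_orbit P A = flag_orbit P B"
    using flag_orbit_alt[OF assms(1)] flag_orbit_alt[OF assms(2)] by auto
qed

text \<open>Conjugation by \<open>f\<close> turns automorphisms of \<open>P\<close> into
  automorphisms of \<open>Q\<close> and back, hence matches the orbits on flags.\<close>

lemma poset_isom_chiral:
  assumes "poset_map f P Q" "chiral_polytope n P"
  shows "chiral_polytope n Q"
proof -
  interpret poset_isom f P Q using assms(1) by unfold_locales
  have P: "polytope n P" "card (flag_orbit P ` flags P) = 2"
    "\<And>A B. adjacent_flags P A B \<Longrightarrow> flag_orbit P A \<noteq> flag_orbit P B"
    using assms(2) unfolding chiral_polytope_def by auto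
  have orb: "flag_orbit Q (f ` A) = flag_orbit Q (f ` B) \<longleftrightarrow> flag_orbit P A = flag_orbit P B"
    if "A \<in> flags P" "B \<in> flags P" for A B
  proof -
    have sub: "A \<subseteq> Field P" "B \<subseteq> Field P" "f ` A \<subseteq> Field Q" "f ` B \<subseteq> Field Q"
      using flag_sub that surj by auto
    have "\<exists>h. poset_map h P P \<and> h ` A = B" if g: "poset_map g Q Q" "g ` f ` A = f ` B" for g
    proof -
      have "(inv_into (Field P) f \<circ> (g \<circ> f)) ` A = B"
        unfolding image_comp[symmetric] g(2) by (rule inv_image[OF sub(2)])
      then show ?thesis
        using poset_map_comp[OF poset_map_comp[OF pm g(1)] poset_map_inv[OF pm]] by blast
    qed
    moreover have "\<exists>g. poset_map g Q Q \<and> g ` f ` A = f ` B" if h: "poset_map h P P" "h ` A = B" for h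
    proof -
      have "(f \<circ> h \<circ> inv_into (Field P) f) ` f ` A = f ` B"
        unfolding image_comp[symmetric] inv_image[OF sub(1)] h(2) ..
      then show ?thesis
        using poset_map_comp[OF poset_map_inv[OF pm] poset_map_comp[OF h(1) pm]] by blast
    qed
    ultimately show ?thesis
      unfolding flag_orbit_eq_iff[OF sub(1,2)] flag_orbit_eq_iff[OF sub(3,4)] by blast
  qed
  have "card (flag_orbit Q ` flags Q) = card (flag_orbit P ` flags P)"
    unfolding flags_eq image_image using orb by (rule card_image_eqI)
  moreover have "flag_orbit Q A \<noteq> flag_orbit Q B" if AB: "adjacent_flags Q A B" for A B
  proof -
    obtain A' B' where "A' \<in> flags P" "B' \<in> flags P" "A = f ` A'" "B = f ` B'"
      using AB flags_eq unfolding adjacent_flags_def by auto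
    then show ?thesis using AB adjacent_map orb P(3) by simp
  qed
  ultimately show ?thesis using P polytope_map unfolding chiral_polytope_def by simp
qed

context polytope_poset
begin

text \<open>Both maps commute with \<open>adj\<close>, so the flags on which they agree as sets are
  closed under adjacency and exhaust all flags. Within a flag the rank, which both maps preserve,
  tells the faces apart.\<close>

lemma poset_map_eqI:
  assumes f: "poset_map f P P" and g: "poset_map g P P" and A: "A \<in> flags P" "f ` A = g ` A"
    and "x \<in> Field P"
  shows "f x = g x"
proof -
  interpret f: poset_isom f P P using f by unfold_locales
  interpret g: poset_isom g P P using g by unfold_locales
  obtain B where B: "B \<in> flags P" "x \<in> B" using in_flag[OF \<open>x \<in> Field P\<close>] by blast
  have "B \<in> {B \<in> flags P. f ` B = g ` B}"
  proof (rule flag_connected[OF _ A(1) B(1)])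
    show "A \<in> {B \<in> flags P. f ` B = g ` B}" using A by simp
  next
    fix D i assume "D \<in> {B \<in> flags P. f ` B = g ` B}" "i < n"
    then show "adj P i D \<in> {B \<in> flags P. f ` B = g ` B}"
      using adj_flag f.adj_map[OF poly, symmetric] g.adj_map[OF poly, symmetric] by simp
  qed
  then have eq: "f ` B = g ` B" by blast
  have "f x \<in> f ` B" "g x \<in> f ` B" "rk (f x) = rk (g x)"
    using B(2) eq f.face_rank_map g.face_rank_map \<open>x \<in> Field P\<close> by auto
  then show ?thesis using flag_rank_inj[OF f.flag_image[OF B(1)]] unfolding inj_on_def by blast
qed

lemma aut_eqI:
  assumes "f \<in> carrier (aut_group P)" "g \<in> carrier (aut_group P)" "A \<in> flags P" "f ` A = g ` A"
  shows "f = g"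
  using assms poset_map_eqI[of f g A] by (intro extensionalityI[of _ "Field P"]) (auto simp: aut_group_carrier)

lemma flag_aut:
  assumes "A \<in> flags P" "poset_map f P P" "f ` A = B"
  shows "flag_aut P A B \<in> carrier (aut_group P)" "flag_aut P A B ` A = B"
proof -
  let ?f = "restrict f (Field P)"
  have f: "?f \<in> carrier (aut_group P)" "?f ` A = B"
    using poset_map_restrict[OF assms(2)] assms(1,3) flag_Field by (auto intro!: image_cong)
  then have "\<exists>!f. f \<in> carrier (aut_group P) \<and> f ` A = B"
    using aut_eqI[OF _ _ assms(1)] by metis
  from theI'[OF this] show "flag_aut P A B \<in> carrier (aut_group P)" "flag_aut P A B ` A = B"
    unfolding flag_aut_def by auto
qed

end

section \<open>Facets\<close>

context polytope_poset
begin

context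
  fixes m F
  assumes m: "n = Suc m" and F: "F \<in> Field P" "rk F = int m"
    and L: "polytope m (Restr P {G. (G, F) \<in> P})"
begin

abbreviation facet :: "'a rel" where "facet \<equiv> Restr P {G. (G, F) \<in> P}"

lemma facet_Field: "Field facet = {G. (G, F) \<in> P}"
  using leq_refl by (auto simp: Field_def)

lemma facet_flag_down:
  assumes "A \<in> flags P" "F \<in> A" "G \<in> A" "G \<noteq> greatest_face"
  shows "(G, F) \<in> P"
proof -
  have "rk G \<le> int m"
    using rank_eq_top[OF flag_Field[OF assms(1,3)]] rank_range[OF flag_Field[OF assms(1,3)]] assms(4) m
    by auto
  then show ?thesis using flag_le_iff[OF assms(1,3,2)] F(2) by simp
qed

lemma greatest_not_below: "(greatest_face, F) \<notin> P"
  using rank_le[of greatest_face F] rank_top F(2) m by auto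

text \<open>Since \<open>F\<close> has rank \<open>n - 1\<close>, a flag through \<open>F\<close>
  loses only its greatest face on passing to the section. That the section is a polytope is an
  assumption of this context; for the facets that occur it is supplied by their isomorphism with
  \<open>K\<close>.\<close>

lemma facet_flagI:
  assumes A: "A \<in> flags P" "F \<in> A"
  shows "A - {greatest_face} \<in> flags facet"
proof -
  have "A - {greatest_face} \<in> Chains facet"
    using facet_flag_down[OF A] flag_total[OF A(1)] unfolding Chains_def by blast
  moreover have "D = A - {greatest_face}" if D: "D \<in> Chains facet" "A - {greatest_face} \<subseteq> D" for D
  proof -
    have sub: "G \<in> Field P" "(G, F) \<in> P" if "G \<in> D" for G
      using Chains_Field[OF D(1)] that facet_Field by (auto intro: FieldI1)
    have "G \<in> A" if "G \<in> D" for G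
    proof (rule flag_maximal[OF A(1) sub(1)[OF that]])
      fix H assume "H \<in> A"
      then consider "H = greatest_face" | "H \<in> D" using D(2) by blast
      then show "(G, H) \<in> P \<or> (H, G) \<in> P"
        using D(1) that greatest_face(2) sub(1) unfolding Chains_def by cases blast+
    qed
    moreover have "greatest_face \<notin> D" using sub(2) greatest_not_below by blast
    ultimately show ?thesis using D(2) by blast
  qed
  ultimately show ?thesis unfolding flags_def by blast
qed

lemma facet_rank:
  assumes "(G, F) \<in> P"
  shows "face_rank facet G = rk G"
proof -
  interpret L: polytope_poset m facet using L by unfold_locales
  obtain A where A: "A \<in> flags P" "G \<in> A" "F \<in> A" using le_in_flag[OF assms] by blast
  have G: "G \<in> A - {greatest_face}" using A(2) assms greatest_not_below by blast
  have "(H, F) \<in> P" if "(H, G) \<in> P" for H using that assms leq_trans by blast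
  then have "{H \<in> A - {greatest_face}. (H, G) \<in> facet} = {H \<in> A. (H, G) \<in> P}"
    using assms greatest_not_below by blast
  then show ?thesis
    using L.face_rank_eq[OF facet_flagI[OF A(1,3)] G] face_rank_eq[OF A(1,2)] by simp
qed

lemma facet_adj:
  assumes A: "A \<in> flags P" "F \<in> A" and i: "i < m"
  shows "adj facet i (A - {greatest_face}) = adj P i A - {greatest_face}" "F \<in> adj P i A"
proof -
  interpret L: polytope_poset m facet using L by unfold_locales
  have B: "adj P i A \<in> flags P" using adj_flag A i m by simp
  have "face A (int m) = F" using face_eqI[OF A F(2)] .
  then have fB: "face (adj P i A) (int m) = F" using adj_face[OF A(1), of i "int m"] i m by simp
  then show FB: "F \<in> adj P i A" using face_props(1)[OF B, of "int m"] m by simp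
  have face: "L.face (C - {greatest_face}) j = face C j"
    if C: "C \<in> flags P" "F \<in> C" and j: "-1 \<le> j" "j \<le> int m" for C j
  proof (rule L.face_eqI[OF facet_flagI[OF C]])
    have p: "face C j \<in> C" "rk (face C j) = j" using face_props[OF C(1) j(1)] j(2) m by auto
    then show c: "face C j \<in> C - {greatest_face}" using rank_top j m by auto
    show "face_rank facet (face C j) = j" using facet_rank[OF facet_flag_down[OF C]] c p(2) by auto
  qed
  have "adj P i A - {greatest_face} \<noteq> A - {greatest_face}"
    using adj_neq[OF A(1), of i] i m greatest_face_in_flag[OF A(1)] greatest_face_in_flag[OF B] by auto
  then have "adj P i A - {greatest_face} = adj facet i (A - {greatest_face})"
    using face[OF A] face[OF B FB] adj_face[OF A(1), of i] i m
    by (intro L.adj_eqI facet_flagI A B FB) auto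
  then show "adj facet i (A - {greatest_face}) = adj P i A - {greatest_face}" ..
qed

end

end

section \<open>Rotations of chiral and regular polytopes\<close>

text \<open>Common ground of chiral and regular polytopes: two successive adjacencies are always
  realised by an automorphism, which is what makes \<open>rot\<close> well defined.\<close>

locale rotary_poset = polytope_poset +
  assumes rotary: "\<And>A i j. A \<in> flags P \<Longrightarrow> i < n \<Longrightarrow> j < n \<Longrightarrow>
    \<exists>f. poset_map f P P \<and> f ` A = adj P i (adj P j A)"

lemma regular_rotary:
  assumes "regular_polytope n P"
  shows "rotary_poset n P"
proof -
  interpret polytope_poset n P using assms unfolding regular_polytope_def by unfold_locales blast
  show ?thesis
  proof
    fix A i j assume A: "A \<in> flags P" "i < n" "j < n"
    then have B: "adj P i (adj P j A) \<in> flags P" using adj_flag by simp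
    then have "adj P i (adj P j A) \<in> flag_orbit P A"
      using assms A(1) unfolding regular_polytope_def by blast
    moreover have "A \<subseteq> Field P" using flag_Field[OF A(1)] by blast
    ultimately show "\<exists>f. poset_map f P P \<and> f ` A = adj P i (adj P j A)"
      using flag_orbit_alt[of A P] by auto
  qed
qed

locale chiral_poset = polytope_poset +
  assumes chiral: "chiral_polytope n P"
begin

lemma two_orbits: "card (flag_orbit P ` flags P) = 2"
  and adjacent_orbits: "adjacent_flags P A B \<Longrightarrow> flag_orbit P A \<noteq> flag_orbit P B"
  using chiral unfolding chiral_polytope_def by auto

lemma adj_orbit_neq: "A \<in> flags P \<Longrightarrow> i < n \<Longrightarrow> flag_orbit P A \<noteq> flag_orbit P (adj P i A)"
  using adjacent_orbits adj_adjacent by blast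

lemma orbit_cases:
  assumes "A \<in> flags P" "B \<in> flags P" "C \<in> flags P" "flag_orbit P A \<noteq> flag_orbit P B"
  shows "flag_orbit P C = flag_orbit P A \<or> flag_orbit P C = flag_orbit P B"
proof -
  obtain x y where "flag_orbit P ` flags P = {x, y}"
    using two_orbits unfolding card_2_iff by blast
  then have "flag_orbit P A \<in> {x, y}" "flag_orbit P B \<in> {x, y}" "flag_orbit P C \<in> {x, y}"
    using assms(1-3) by blast+
  then show ?thesis using assms(4) by auto
qed

lemma orbit_map:
  assumes "A \<in> flags P" "B \<in> flags P" "flag_orbit P A = flag_orbit P B"
  shows "\<exists>f. poset_map f P P \<and> f ` A = B"
  using flag_orbit_eq_iff[of A P B] assms flag_Field by blast

end

lemma chiral_posetI: "chiral_polytope n P \<Longrightarrow> chiral_poset n P"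
  unfolding chiral_polytope_def by unfold_locales (auto simp: chiral_polytope_def)

text \<open>Each adjacency switches between the only two orbits, so two adjacencies lead back to the
  first one.\<close>

sublocale chiral_poset \<subseteq> rotary_poset
proof
  fix A i j assume A: "A \<in> flags P" and i: "i < n" and j: "j < n"
  have B: "adj P j A \<in> flags P" and C: "adj P i (adj P j A) \<in> flags P"
    using adj_flag A i j by auto
  have "flag_orbit P A = flag_orbit P (adj P i (adj P j A))"
    using orbit_cases[OF A B C] adj_orbit_neq[OF A j] adj_orbit_neq[OF B i] by auto
  then show "\<exists>f. poset_map f P P \<and> f ` A = adj P i (adj P j A)"
    using orbit_map[OF A C] by blast
qed

context rotary_poset
begin

lemma rot:
  assumes "A \<in> flags P" "1 \<le> i" "i < n"
  shows "rot P A i \<in> carrier (aut_group P)" "rot P A i ` A = adj P i (adj P (i - 1) A)"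
proof -
  have "i - 1 < n" using assms by simp
  from rotary[OF assms(1,3) this]
  obtain f where "poset_map f P P" "f ` A = adj P i (adj P (i - 1) A)"
    by (elim exE conjE) (rule that)
  from flag_aut[OF assms(1) this]
  show "rot P A i \<in> carrier (aut_group P)" "rot P A i ` A = adj P i (adj P (i - 1) A)"
    unfolding rot_def by auto
qed

end

section \<open>The mod 2 ridge cover of a finite polytope\<close>

text \<open>Sets of ridges, with symmetric difference as addition, are the chains modulo 2 of the graph of
  facets and ridges; \<open>bdry x F F'\<close> says that \<open>x\<close> has boundary \<open>F + F'\<close>. A facet of the cover is a
  facet \<open>F\<close> of \<open>P\<close> with a chain \<open>x\<close> of boundary \<open>F\<close> plus the base facet, so that \<open>x\<close> determines
  \<open>F\<close>; a face of the cover over a lower face \<open>G\<close> is such a chain up to the ridges \<open>upr G\<close> above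
  \<open>G\<close>, represented by a set disjoint from \<open>upr G\<close>.\<close>

definition sd :: "'a set \<Rightarrow> 'a set \<Rightarrow> 'a set" where
  "sd x y = (x - y) \<union> (y - x)"

lemma sd_simps [simp]: "sd x {} = x" "sd {} x = x" "sd x x = {}" "sd (sd x y) y = x" "sd y (sd y x) = x"
  unfolding sd_def by auto

lemma sd_assoc: "sd (sd x y) z = sd x (sd y z)" and sd_commute: "sd x y = sd y x"
  unfolding sd_def by auto

lemma sd_subset: "x \<subseteq> U \<Longrightarrow> y \<subseteq> U \<Longrightarrow> sd x y \<subseteq> U"
  unfolding sd_def by auto

text \<open>Linearity modulo 2 of the incidence count behind \<open>bdry\<close>: elements of both
  sets are counted twice.\<close>

lemma odd_card_sd:
  assumes "finite x" "finite y"
  shows "odd (card {r \<in> sd x y. T r}) \<longleftrightarrow> odd (card {r \<in> x. T r}) \<noteq> odd (card {r \<in> y. T r})"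
proof -
  let ?a = "{r \<in> x - y. T r}" and ?b = "{r \<in> y - x. T r}" and ?c = "{r \<in> x \<inter> y. T r}"
  have "{r \<in> sd x y. T r} = ?a \<union> ?b" "{r \<in> x. T r} = ?a \<union> ?c" "{r \<in> y. T r} = ?b \<union> ?c"
    unfolding sd_def by auto
  moreover have "card (?a \<union> ?b) = card ?a + card ?b" "card (?a \<union> ?c) = card ?a + card ?c"
    "card (?b \<union> ?c) = card ?b + card ?c"
    using assms by (auto intro!: card_Un_disjoint)
  ultimately show ?thesis by auto
qed

locale ridge_cover = polytope_poset N P for N :: nat and P :: "'a rel" +
  fixes n :: nat
  assumes N: "N = Suc n" and n_pos: "1 \<le> n" and fin: "finite (Field P)"
begin

section \<open>Chains of ridges modulo 2 and their boundaries\<close>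

definition ridges :: "'a set" where "ridges = {r \<in> Field P. rk r = int n - 1}"

definition fcts :: "'a set" where "fcts = {F \<in> Field P. rk F = int n}"

definition base :: "'a set" where "base = (SOME A. A \<in> flags P)"

abbreviation fct :: "'a set \<Rightarrow> 'a" where "fct A \<equiv> face A (int n)"
abbreviation rdg :: "'a set \<Rightarrow> 'a" where "rdg A \<equiv> face A (int n - 1)"

definition bdry :: "'a set \<Rightarrow> 'a \<Rightarrow> 'a \<Rightarrow> bool" where
  "bdry x F F' \<longleftrightarrow> (\<forall>G\<in>fcts. odd (card {r \<in> x. (r, G) \<in> P}) \<longleftrightarrow> (G = F) \<noteq> (G = F'))"

definition adm :: "'a set \<Rightarrow> 'a \<Rightarrow> bool" where
  "adm x F \<longleftrightarrow> x \<subseteq> ridges \<and> F \<in> fcts \<and> bdry x F (fct base)"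

text \<open>At the greatest face all ridges are taken, although none lies above it: every chain
  becomes trivial there, and the face has a single lift. Facets get the empty set and keep their
  chain in full.\<close>

definition upr :: "'a \<Rightarrow> 'a set" where
  "upr G = (if G = greatest_face then ridges else {r \<in> ridges. (G, r) \<in> P})"

definition lf :: "'a set \<Rightarrow> 'a \<Rightarrow> 'a \<times> 'a set" where
  "lf x G = (G, x - upr G)"

definition cover_faces :: "('a \<times> 'a set) set" where
  "cover_faces = insert (greatest_face, {}) {lf x G |x F G. adm x F \<and> (G, F) \<in> P}"

text \<open>Going down from \<open>H\<close> to \<open>G\<close> forgets more of the chain, because
  \<open>upr G\<close> contains \<open>upr H\<close>. The greatest face breaks this monotonicity and
  is placed above all lifts by a separate clause.\<close>

definition cover :: "('a \<times> 'a set) rel" where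
  "cover = {((G, y), (H, z)). (G, y) \<in> cover_faces \<and> (H, z) \<in> cover_faces \<and> (G, H) \<in> P \<and>
     (H = greatest_face \<or> y = z - upr G)}"

lemma base: "base \<in> flags P"
  using flag_ex unfolding base_def by (rule someI_ex)

lemma ridges_finite: "x \<subseteq> ridges \<Longrightarrow> finite x"
  using fin finite_subset[of x "Field P"] unfolding ridges_def by auto

lemma fct_fcts: "A \<in> flags P \<Longrightarrow> fct A \<in> fcts"
  using face_props[of A "int n"] flag_Field N unfolding fcts_def by auto

lemma rdg_ridges: "A \<in> flags P \<Longrightarrow> rdg A \<in> ridges"
  using face_props[of A "int n - 1"] flag_Field N unfolding ridges_def by auto

lemma fct_eqI: "A \<in> flags P \<Longrightarrow> F \<in> fcts \<Longrightarrow> F \<in> A \<Longrightarrow> fct A = F"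
  using face_eqI unfolding fcts_def by auto

lemma rdg_eqI: "A \<in> flags P \<Longrightarrow> r \<in> ridges \<Longrightarrow> r \<in> A \<Longrightarrow> rdg A = r"
  using face_eqI unfolding ridges_def by auto

lemma fct_neq_greatest: "F \<in> fcts \<Longrightarrow> F \<noteq> greatest_face"
  using rank_top N unfolding fcts_def by auto

lemma in_flag_below: "A \<in> flags P \<Longrightarrow> G \<in> A \<Longrightarrow> (G, fct A) \<in> P \<or> G = greatest_face"
proof -
  assume A: "A \<in> flags P" "G \<in> A"
  have "rk G \<le> int n \<or> G = greatest_face"
    using rank_eq_top[OF flag_Field[OF A]] rank_range[OF flag_Field[OF A]] N by auto
  then show ?thesis
    using flag_le_iff[OF A face_props(1)[OF A(1), of "int n"]] face_props(2)[OF A(1), of "int n"] N by auto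
qed

text \<open>The diamond between a ridge and the greatest face: every edge of the graph of facets has
  exactly two ends and is no loop.\<close>

lemma ridge_facets:
  assumes A: "A \<in> flags P"
  shows "{F \<in> fcts. (rdg A, F) \<in> P} = {fct A, fct (adj P n A)}" "fct (adj P n A) \<noteq> fct A"
proof -
  have i: "n < N" using N by simp
  obtain G where G: "G \<noteq> fct A" "{H. (face A (int n - 1), H) \<in> P \<and> (H, face A (int n + 1)) \<in> P \<and>
        H \<noteq> face A (int n - 1) \<and> H \<noteq> face A (int n + 1)} = {fct A, G}"
    using between[OF A i] by blast
  have top: "face A (int n + 1) = greatest_face" using face_top[OF A] N by (simp add: add.commute)
  have rr: "rk (rdg A) = int n - 1" using face_props(2)[OF A, of "int n - 1"] N by simp
  have eq: "{F \<in> fcts. (rdg A, F) \<in> P} = {fct A, G}"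
  proof -
    have "F \<in> fcts \<and> (rdg A, F) \<in> P \<longleftrightarrow> (rdg A, F) \<in> P \<and> (F, greatest_face) \<in> P \<and> F \<noteq> rdg A \<and> F \<noteq> greatest_face"
      for F
    proof
      assume "F \<in> fcts \<and> (rdg A, F) \<in> P"
      then show "(rdg A, F) \<in> P \<and> (F, greatest_face) \<in> P \<and> F \<noteq> rdg A \<and> F \<noteq> greatest_face"
        using greatest_face(2)[of F] fct_neq_greatest[of F] rr unfolding fcts_def by auto
    next
      assume *: "(rdg A, F) \<in> P \<and> (F, greatest_face) \<in> P \<and> F \<noteq> rdg A \<and> F \<noteq> greatest_face"
      then show "F \<in> fcts \<and> (rdg A, F) \<in> P"
        using rank_less[of "rdg A" F] rank_less[of F greatest_face] rank_top rr N FieldI2[of _ F P]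
        unfolding fcts_def by auto
    qed
    then show ?thesis using G(2) unfolding top by blast
  qed
  show neq: "fct (adj P n A) \<noteq> fct A" using adj_face_neq[OF A i] .
  have "(rdg A, fct (adj P n A)) \<in> P"
    using face_le[OF adj_flag[OF A i], of "int n - 1" "int n"] adj_face[OF A i, of "int n - 1"] N by simp
  then have "fct (adj P n A) \<in> {fct A, G}" using eq fct_fcts[OF adj_flag[OF A i]] by blast
  then show "{F \<in> fcts. (rdg A, F) \<in> P} = {fct A, fct (adj P n A)}" using eq neq by auto
qed

lemma bdry_sd:
  assumes "finite x" "finite y" "bdry x F G" "bdry y G H"
  shows "bdry (sd x y) F H"
  using assms(3,4) odd_card_sd[OF assms(1,2)] unfolding bdry_def by auto

lemma bdry_commute: "bdry x F G \<longleftrightarrow> bdry x G F"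
  unfolding bdry_def by auto

lemma bdry_ridge:
  assumes "A \<in> flags P"
  shows "bdry {rdg A} (fct A) (fct (adj P n A))"
  unfolding bdry_def
proof
  fix G assume G: "G \<in> fcts"
  have "{r \<in> {rdg A}. (r, G) \<in> P} = (if (rdg A, G) \<in> P then {rdg A} else {})" by auto
  then have "odd (card {r \<in> {rdg A}. (r, G) \<in> P}) \<longleftrightarrow> (rdg A, G) \<in> P" by simp
  also have "\<dots> \<longleftrightarrow> G = fct A \<or> G = fct (adj P n A)" using ridge_facets(1)[OF assms] G by blast
  finally show "odd (card {r \<in> {rdg A}. (r, G) \<in> P}) \<longleftrightarrow> (G = fct A) \<noteq> (G = fct (adj P n A))"
    using ridge_facets(2)[OF assms] by auto
qed

text \<open>Adding the edge that is crossed moves the free end of the chain to the neighbouring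
  facet.\<close>

lemma adm_cross:
  assumes A: "A \<in> flags P" and x: "adm x (fct A)"
  shows "adm (sd x {rdg A}) (fct (adj P n A))"
proof -
  have "bdry (sd {rdg A} x) (fct (adj P n A)) (fct base)"
    using bdry_sd[of "{rdg A}" x] ridges_finite[of x] x bdry_ridge[OF A] bdry_commute
    unfolding adm_def by blast
  then show ?thesis
    using x rdg_ridges[OF A] fct_fcts[OF adj_flag[OF A]] N sd_commute[of x] sd_subset[of x ridges "{rdg A}"]
    unfolding adm_def by auto
qed

lemma adm_unique:
  assumes "adm x F" "adm x G"
  shows "F = G"
  using assms unfolding adm_def bdry_def by blast

lemma adm_base: "adm {} (fct base)"
  using fct_fcts[OF base] unfolding adm_def bdry_def by simp

lemma adm_ex:
  assumes "A \<in> flags P"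
  shows "\<exists>x. adm x (fct A)"
proof -
  have "A \<in> {A. \<exists>x. adm x (fct A)}"
  proof (rule flag_connected[OF _ base assms])
    show "base \<in> {A. \<exists>x. adm x (fct A)}" using adm_base by blast
  next
    fix D i assume D: "D \<in> {A. \<exists>x. adm x (fct A)}" "D \<in> flags P" "i < N"
    then obtain x where x: "adm x (fct D)" by blast
    show "adj P i D \<in> {A. \<exists>x. adm x (fct A)}"
    proof (cases "i = n")
      case True
      then show ?thesis using adm_cross[OF D(2) x] by blast
    next
      case False
      then have "fct (adj P i D) = fct D" using adj_face[OF D(2,3)] N by auto
      then show ?thesis using x by auto
    qed
  qed
  then show ?thesis by blast
qed

text \<open>The only other chain that agrees with \<open>x\<close> off the ridge differs from
  \<open>x\<close> by that ridge, and so ends at the facet on its other side.\<close>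

lemma adm_ridge_unique:
  assumes A: "A \<in> flags P" and "adm x (fct A)" "adm y (fct A)" "x - {rdg A} = y - {rdg A}"
  shows "x = y"
proof (rule ccontr)
  assume "x \<noteq> y"
  then have "y = sd x {rdg A}" using assms(4) unfolding sd_def by blast
  then have "fct (adj P n A) = fct A" using adm_cross[OF A assms(2)] adm_unique assms(3) by blast
  then show False using ridge_facets(2)[OF A] by simp
qed

section \<open>The faces of the cover and their order\<close>

lemma upr_ridges: "upr G \<subseteq> ridges"
  unfolding upr_def by auto

lemma upr_antimono: "(G, H) \<in> P \<Longrightarrow> H \<noteq> greatest_face \<Longrightarrow> upr H \<subseteq> upr G"
  unfolding upr_def using leq_trans by auto

lemma upr_fct: "F \<in> fcts \<Longrightarrow> upr F = {}"
  using fct_neq_greatest rank_le unfolding upr_def fcts_def ridges_def by force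

lemma upr_ridge: "r \<in> ridges \<Longrightarrow> upr r = {r}"
  using rank_less[of r] rank_top N leq_refl unfolding upr_def ridges_def by force

lemma lf_greatest: "x \<subseteq> ridges \<Longrightarrow> lf x greatest_face = (greatest_face, {})"
  unfolding lf_def upr_def by auto

lemma lf_in: "adm x F \<Longrightarrow> (G, F) \<in> P \<or> G = greatest_face \<Longrightarrow> lf x G \<in> cover_faces"
  using lf_greatest[of x] unfolding cover_faces_def adm_def by auto

lemma cover_facesE:
  assumes "p \<in> cover_faces"
  obtains x A where "A \<in> flags P" "adm x (fct A)" "fst p \<in> A" "p = lf x (fst p)"
proof -
  consider "p = (greatest_face, {})" | x F G where "p = lf x G" "adm x F" "(G, F) \<in> P"
    using assms unfolding cover_faces_def by blast
  then show thesis
  proof cases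
    case 1
    show ?thesis
      by (rule that[OF base adm_base]) (use 1 greatest_face_in_flag[OF base] lf_greatest[of "{}"] in auto)
  next
    case 2
    obtain A where A: "A \<in> flags P" "G \<in> A" "F \<in> A" using le_in_flag[OF 2(3)] by blast
    have "fct A = F" using fct_eqI[OF A(1) _ A(3)] 2(2) unfolding adm_def by blast
    then show ?thesis using that[OF A(1), of x] 2 A(2) by (simp add: lf_def)
  qed
qed

lemma cover_faces_fst: "p \<in> cover_faces \<Longrightarrow> fst p \<in> Field P"
  using flag_Field by (blast elim: cover_facesE)

lemma cover_faces_snd: "p \<in> cover_faces \<Longrightarrow> snd p \<subseteq> ridges - upr (fst p)"
  by (elim cover_facesE) (auto simp: lf_def adm_def prod_eq_iff)

lemma cover_faces_greatest: "p \<in> cover_faces \<Longrightarrow> fst p = greatest_face \<Longrightarrow> p = (greatest_face, {})"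
  using cover_faces_snd[of p] unfolding upr_def by (auto simp: prod_eq_iff)

lemma cover_leI:
  "p \<in> cover_faces \<Longrightarrow> q \<in> cover_faces \<Longrightarrow> (fst p, fst q) \<in> P \<Longrightarrow>
   fst q = greatest_face \<or> snd p = snd q - upr (fst p) \<Longrightarrow> (p, q) \<in> cover"
  unfolding cover_def by (cases p; cases q) auto

lemma cover_leD:
  assumes "(p, q) \<in> cover"
  shows "p \<in> cover_faces" "q \<in> cover_faces" "(fst p, fst q) \<in> P"
    "fst q = greatest_face \<or> snd p = snd q - upr (fst p)"
  using assms unfolding cover_def by auto

lemma cover_refl: "p \<in> cover_faces \<Longrightarrow> (p, p) \<in> cover"
  using cover_faces_fst cover_faces_snd leq_refl by (intro cover_leI) blast+

lemma cover_Field: "Field cover = cover_faces"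
  using cover_leD(1,2) cover_refl unfolding Field_def by blast

lemma cover_trans:
  assumes pq: "(p, q) \<in> cover" and qs: "(q, s) \<in> cover"
  shows "(p, s) \<in> cover"
proof (cases "fst s = greatest_face")
  case True
  then show ?thesis using cover_leD[OF pq] cover_leD[OF qs] leq_trans by (intro cover_leI) auto
next
  case False
  then have "fst q \<noteq> greatest_face"
    using cover_leD(3)[OF qs] rank_le[of "fst q" "fst s"] rank_less[of "fst s" greatest_face]
      greatest_face(2)[of "fst s"] cover_faces_fst[OF cover_leD(2)[OF qs]] by auto
  then have "snd p = snd q - upr (fst p)" "snd q = snd s - upr (fst q)"
    "upr (fst q) \<subseteq> upr (fst p)"
    using cover_leD[OF pq] cover_leD[OF qs] False upr_antimono by auto
  then have "snd p = snd s - upr (fst p)" by blast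
  then show ?thesis using cover_leD[OF pq] cover_leD[OF qs] leq_trans by (intro cover_leI) auto
qed

lemma cover_same_fst:
  assumes "(p, q) \<in> cover" "fst p = fst q"
  shows "p = q"
proof (cases "fst q = greatest_face")
  case True
  then show ?thesis using cover_faces_greatest cover_leD(1,2)[OF assms(1)] assms(2) by metis
next
  case False
  then have "snd p = snd q"
    using cover_leD(4)[OF assms(1)] cover_faces_snd[OF cover_leD(2)[OF assms(1)]] assms(2) by auto
  then show ?thesis using assms(2) by (simp add: prod_eq_iff)
qed

lemma cover_antisym: "(p, q) \<in> cover \<Longrightarrow> (q, p) \<in> cover \<Longrightarrow> p = q"
  using cover_leD(3) leq_antisym cover_same_fst by metis

lemma cover_po: "Partial_order cover"
  unfolding order_on_defs cover_Field
proof (intro conjI)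
  show "cover \<subseteq> cover_faces \<times> cover_faces" unfolding cover_def by auto
  show "refl_on cover_faces cover" unfolding refl_on_def using cover_refl by blast
  show "trans cover" by (rule transI) (rule cover_trans)
  show "antisym cover" by (rule antisymI) (rule cover_antisym)
qed

section \<open>Lifting flags along a chain\<close>

lemma lf_le:
  assumes "adm x F" "(G, H) \<in> P" "(H, F) \<in> P \<or> H = greatest_face" "(G, F) \<in> P \<or> G = greatest_face"
  shows "(lf x G, lf x H) \<in> cover"
proof (rule cover_leI)
  show "lf x G \<in> cover_faces" "lf x H \<in> cover_faces" using lf_in assms by blast+
  show "(fst (lf x G), fst (lf x H)) \<in> P" using assms(2) by (simp add: lf_def)
  show "fst (lf x H) = greatest_face \<or> snd (lf x G) = snd (lf x H) - upr (fst (lf x G))"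
    using upr_antimono[OF assms(2)] unfolding lf_def by auto
qed

lemma lf_flag_le_iff:
  assumes "A \<in> flags P" "adm x (fct A)" "G \<in> A" "H \<in> A"
  shows "(lf x G, lf x H) \<in> cover \<longleftrightarrow> (G, H) \<in> P"
  using lf_le[OF assms(2), of G H] in_flag_below[OF assms(1,3)] in_flag_below[OF assms(1,4)]
    cover_leD(3)[of "lf x G" "lf x H"] by (auto simp: lf_def)

lemma fst_lf [simp]: "fst (lf x G) = G"
  by (simp add: lf_def)

lemma fst_lf_image [simp]: "fst ` lf x ` A = A"
  by (simp add: image_image)

lemma lf_inj: "inj_on (lf x) A"
  by (auto simp: inj_on_def lf_def)

lemma lift_flag:
  assumes A: "A \<in> flags P" and x: "adm x (fct A)"
  shows "lf x ` A \<in> flags cover"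
proof -
  have ch: "lf x ` A \<in> Chains cover"
    using lf_flag_le_iff[OF A x] flag_total[OF A] unfolding Chains_def by blast
  have "D = lf x ` A" if D: "D \<in> Chains cover" "lf x ` A \<subseteq> D" for D
  proof -
    have "p \<in> lf x ` A" if p: "p \<in> D" for p
    proof -
      have tot: "(p, q) \<in> cover \<or> (q, p) \<in> cover" if "q \<in> D" for q
        using D(1) p that unfolding Chains_def by blast
      have pF: "p \<in> cover_faces" using Chains_Field[OF D(1)] p cover_Field by blast
      have "fst p \<in> A"
      proof (rule flag_maximal[OF A cover_faces_fst[OF pF]])
        fix H assume "H \<in> A"
        then have "lf x H \<in> D" using D(2) by blast
        then show "(fst p, H) \<in> P \<or> (H, fst p) \<in> P"
          using tot cover_leD(3) fst_lf by metis
      qed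
      then have "lf x (fst p) \<in> D" using D(2) by blast
      then have "p = lf x (fst p)" using tot cover_same_fst fst_lf by metis
      then show ?thesis using \<open>fst p \<in> A\<close> by blast
    qed
    then show ?thesis using D(2) by blast
  qed
  then show ?thesis using ch unfolding flags_def by blast
qed

lemma cover_chain_projection:
  assumes "D \<in> Chains cover"
  shows "fst ` D \<in> Chains P" "inj_on fst D"
proof -
  have tot: "(p, q) \<in> cover \<or> (q, p) \<in> cover" if "p \<in> D" "q \<in> D" for p q
    using assms that unfolding Chains_def by blast
  show "fst ` D \<in> Chains P" unfolding Chains_def using tot cover_leD(3) by blast
  show "inj_on fst D" unfolding inj_on_def using tot cover_same_fst by metis
qed

text \<open>All faces of a flag of the cover come from one chain: its largest face \<open>h\<close>
  below the greatest one is a reduction of some \<open>x\<close>, and each smaller face is a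
  reduction of \<open>h\<close>, hence of \<open>x\<close>.\<close>

lemma lift_flagE:
  assumes D: "D \<in> flags cover"
  obtains A x where "A \<in> flags P" "adm x (fct A)" "D = lf x ` A"
proof -
  have ch: "D \<in> Chains cover" using D unfolding flags_def by blast
  have tot: "(p, q) \<in> cover \<or> (q, p) \<in> cover" if "p \<in> D" "q \<in> D" for p q
    using ch that unfolding Chains_def by blast
  have DF: "D \<subseteq> cover_faces" using Chains_Field[OF ch] cover_Field by simp
  have maxD: "p \<in> D" if "p \<in> cover_faces" "\<And>q. q \<in> D \<Longrightarrow> (p, q) \<in> cover \<or> (q, p) \<in> cover" for p
  proof -
    have "insert p D \<in> Chains cover"
      using that tot cover_refl unfolding Chains_def by blast
    then show ?thesis using D unfolding flags_def by blast
  qed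
  have least_neq: "least_face \<noteq> greatest_face" using rank_bot rank_top by auto
  have least_in: "lf {} least_face \<in> cover_faces"
    using lf_in[OF adm_base] least_face(2) fct_fcts[OF base] unfolding fcts_def by blast
  \<comment> \<open>Guarantees a face of \<open>D\<close> other than the greatest one, so that the
    maximum \<open>m\<close> is taken over a nonempty set.\<close>
  have "lf {} least_face \<in> D"
  proof (rule maxD[OF least_in])
    fix q assume "q \<in> D"
    then have q: "q \<in> cover_faces" using DF by blast
    have "upr least_face = ridges"
      using least_neq least_face(2) unfolding upr_def ridges_def by auto
    then have "(lf {} least_face, q) \<in> cover"
      using cover_faces_snd[OF q] cover_faces_fst[OF q] least_face(2)
      by (intro cover_leI least_in q) (auto simp: lf_def)
    then show "(lf {} least_face, q) \<in> cover \<or> (q, lf {} least_face) \<in> cover" ..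
  qed
  then have ne: "lf {} least_face \<in> {p \<in> D. fst p \<noteq> greatest_face}" using least_neq by simp
  obtain B where B: "B \<in> flags P" "fst ` D \<subseteq> B"
    using chain_extend[OF cover_chain_projection(1)[OF ch]] by blast
  have "finite D"
    using finite_imageD[OF finite_subset[OF B(2) flag_finite[OF B(1)]] cover_chain_projection(2)[OF ch]] .
  then have finE: "finite {p \<in> D. fst p \<noteq> greatest_face}" by simp
  define m where "m = Max ((\<lambda>p. rk (fst p)) ` {p \<in> D. fst p \<noteq> greatest_face})"
  have "m \<in> (\<lambda>p. rk (fst p)) ` {p \<in> D. fst p \<noteq> greatest_face}"
    unfolding m_def by (rule Max_in) (use finE in simp, use ne in blast)
  then obtain h where h: "h \<in> D" "fst h \<noteq> greatest_face" "rk (fst h) = m" by auto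
  have max: "(p, h) \<in> cover" if p: "p \<in> D" "fst p \<noteq> greatest_face" for p
  proof -
    have "rk (fst p) \<le> m" unfolding m_def using finE p by (intro Max_ge) auto
    then have "fst p = fst h" if "(fst h, fst p) \<in> P" using rank_less[OF that] h(3) by force
    moreover have "fst p = fst h \<Longrightarrow> p = h"
      using cover_chain_projection(2)[OF ch] p(1) h(1) unfolding inj_on_def by blast
    ultimately show ?thesis using tot[OF p(1) h(1)] cover_leD(3)[of h p] cover_refl h(1) DF by auto
  qed
  obtain x C where C: "C \<in> flags P" "adm x (fct C)" "fst h \<in> C" "h = lf x (fst h)"
    using h(1) DF by (blast elim: cover_facesE)
  have hF: "(fst h, fct C) \<in> P" using in_flag_below[OF C(1,3)] h(2) by blast
  have rep: "p = lf x (fst p)" "(fst p, fct C) \<in> P \<or> fst p = greatest_face" if p: "p \<in> D" for p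
  proof -
    have "p = lf x (fst p) \<and> ((fst p, fct C) \<in> P \<or> fst p = greatest_face)"
    proof (cases "fst p = greatest_face")
      case True
      then have "p = lf x greatest_face"
        using cover_faces_greatest[of p] p DF lf_greatest[of x] C(2) unfolding adm_def by auto
      then show ?thesis using True by simp
    next
      case False
      have ph: "(fst p, fst h) \<in> P" "snd p = snd h - upr (fst p)"
        using cover_leD[OF max[OF p False]] h(2) by auto
      have "snd h = x - upr (fst h)" using C(4) by (metis lf_def snd_conv)
      then have "snd p = x - upr (fst p)" using ph(2) upr_antimono[OF ph(1) h(2)] by blast
      then show ?thesis using ph(1) hF leq_trans by (auto simp: lf_def prod_eq_iff)
    qed
    then show "p = lf x (fst p)" "(fst p, fct C) \<in> P \<or> fst p = greatest_face" by auto
  qed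
  \<comment> \<open>At this stage \<open>D\<close> might still miss a facet. The facet belonging to
    \<open>x\<close> is added before the projection is extended to a flag \<open>A\<close>; then
    \<open>D\<close> lies in the lift of \<open>A\<close> and equals it by maximality.\<close>
  have "insert (fct C) (fst ` D) \<in> Chains P"
  proof -
    have F: "fct C \<in> Field P" using fct_fcts[OF C(1)] unfolding fcts_def by blast
    have "(G, fct C) \<in> P \<or> (fct C, G) \<in> P" if G: "G \<in> fst ` D" for G
    proof -
      obtain p where "p \<in> D" "G = fst p" using G by blast
      then show ?thesis using rep(2)[of p] greatest_face(2)[OF F] by auto
    qed
    then show ?thesis
      using cover_chain_projection(1)[OF ch] leq_refl[OF F] unfolding Chains_def by blast
  qed
  from chain_extend[OF this] obtain A where A: "A \<in> flags P" "fct C \<in> A" "fst ` D \<subseteq> A" by auto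
  have fA: "fct A = fct C" using fct_eqI[OF A(1) fct_fcts[OF C(1)] A(2)] .
  have "D \<subseteq> lf x ` A" using rep(1) A(3) by blast
  then have "D = lf x ` A"
    using lift_flag[OF A(1), of x] fA C(2) D unfolding flags_def by auto
  then show thesis using that A(1) C(2) fA by simp
qed

lemma cover_ranked: "ranked_poset N cover"
proof
  show "Partial_order cover" by (rule cover_po)
  fix D assume "D \<in> flags cover"
  then show "card D = N + 2"
    using card_image[OF lf_inj] flag_card by (elim lift_flagE) simp
qed

sublocale cover: ranked_poset N cover
  by (rule cover_ranked)

lemma cover_rank:
  assumes "p \<in> cover_faces"
  shows "cover.rk p = rk (fst p)"
proof -
  obtain A x where A: "A \<in> flags P" "adm x (fct A)" "fst p \<in> A" "p = lf x (fst p)"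
    using assms by (elim cover_facesE) (rule that)
  have "{q \<in> lf x ` A. (q, p) \<in> cover} = lf x ` {G \<in> A. (G, fst p) \<in> P}"
    using lf_flag_le_iff[OF A(1,2) _ A(3)] A(4) by auto
  then have "card {q \<in> lf x ` A. (q, p) \<in> cover} = card {G \<in> A. (G, fst p) \<in> P}"
    using card_image[OF lf_inj] by metis
  moreover have "p \<in> lf x ` A" using A(3,4) by blast
  ultimately show ?thesis
    using cover.face_rank_eq[OF lift_flag[OF A(1,2)], of p] face_rank_eq[OF A(1,3)] by simp
qed

lemma cover_face:
  assumes A: "A \<in> flags P" and x: "adm x (fct A)" and j: "-1 \<le> j" "j \<le> int N"
  shows "cover.face (lf x ` A) j = lf x (face A j)"
proof (rule cover.face_eqI[OF lift_flag[OF A x]])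
  have *: "face A j \<in> A" "rk (face A j) = j" using face_props[OF A j] by auto
  then show "lf x (face A j) \<in> lf x ` A" by blast
  have "lf x (face A j) \<in> cover_faces" using lf_in[OF x] in_flag_below[OF A *(1)] by blast
  then show "cover.rk (lf x (face A j)) = j" using cover_rank *(2) by simp
qed

lemma cover_greatest: "(greatest_face, {}) \<in> cover_faces" "p \<in> cover_faces \<Longrightarrow> (p, (greatest_face, {})) \<in> cover"
proof -
  show *: "(greatest_face, {}) \<in> cover_faces" unfolding cover_faces_def by simp
  show "(p, (greatest_face, {})) \<in> cover" if "p \<in> cover_faces"
    using cover_leI[OF that *] greatest_face(2) cover_faces_fst[OF that] by simp
qed

lemma cover_least: "(least_face, {}) \<in> cover_faces" "p \<in> cover_faces \<Longrightarrow> ((least_face, {}), p) \<in> cover"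
proof -
  have least_neq: "least_face \<noteq> greatest_face" using rank_bot rank_top by auto
  have up: "upr least_face = ridges"
    using least_neq least_face(2) unfolding upr_def ridges_def by auto
  have "lf {} least_face \<in> cover_faces"
    using lf_in[OF adm_base] least_face(2) fct_fcts[OF base] unfolding fcts_def by blast
  then show *: "(least_face, {}) \<in> cover_faces" by (simp add: lf_def)
  show "((least_face, {}), p) \<in> cover" if "p \<in> cover_faces"
    using cover_leI[OF * that] least_face(2) cover_faces_fst[OF that] cover_faces_snd[OF that] up by auto
qed

text \<open>Below a proper face the section is the lift of a section of \<open>P\<close> along a
  single chain. Below the greatest face, \<open>p\<close> lies over a ridge \<open>r\<close> and
  carries a chain \<open>x\<close> modulo \<open>r\<close>: the facets above \<open>p\<close> are
  given by \<open>x\<close> and by \<open>x\<close> plus \<open>r\<close>, which end at the two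
  facets containing \<open>r\<close>.\<close>

lemma cover_diamond: "diamond_condition cover"
  unfolding diamond_condition_def
proof (intro allI impI)
  fix p q assume *: "(p, q) \<in> cover \<and> cover.rk q = cover.rk p + 2"
  let ?S = "{s. (p, s) \<in> cover \<and> (s, q) \<in> cover \<and> s \<noteq> p \<and> s \<noteq> q}"
  have pq: "(p, q) \<in> cover" and P: "p \<in> cover_faces" "q \<in> cover_faces" "(fst p, fst q) \<in> P"
    "fst q = greatest_face \<or> snd p = snd q - upr (fst p)"
    using * cover_leD[of p q] by auto
  have r: "rk (fst q) = rk (fst p) + 2" using * cover_rank P by auto
  show "card ?S = 2"
  proof (cases "fst q = greatest_face")
    case False
    let ?T = "{H. (fst p, H) \<in> P \<and> (H, fst q) \<in> P \<and> H \<noteq> fst p \<and> H \<noteq> fst q}"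
    obtain A x where A: "A \<in> flags P" "adm x (fct A)" "fst q \<in> A" "q = lf x (fst q)"
      using P(2) by (elim cover_facesE) (rule that)
    have qF: "(fst q, fct A) \<in> P" using in_flag_below[OF A(1,3)] False by blast
    have sq: "snd q = x - upr (fst q)" using A(4) by (metis lf_def snd_conv)
    have rep: "snd s = x - upr (fst s)" if "(s, q) \<in> cover" for s
      using cover_leD[OF that] sq upr_antimono[of "fst s" "fst q"] False by auto
    have "?S = lf x ` ?T"
    proof
      show "?S \<subseteq> lf x ` ?T"
      proof
        fix s assume s: "s \<in> ?S"
        then have "s = lf x (fst s)" using rep[of s] by (auto simp: lf_def prod_eq_iff)
        moreover have "fst s \<in> ?T"
          using s cover_leD(3)[of p s] cover_leD(3)[of s q] cover_same_fst[of p s] cover_same_fst[of s q]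
          by auto
        ultimately show "s \<in> lf x ` ?T" by blast
      qed
      show "lf x ` ?T \<subseteq> ?S"
      proof
        fix s assume "s \<in> lf x ` ?T"
        then obtain H where H: "s = lf x H" "(fst p, H) \<in> P" "(H, fst q) \<in> P" "H \<noteq> fst p" "H \<noteq> fst q"
          by blast
        have "p = lf x (fst p)" using rep[OF pq] by (auto simp: lf_def prod_eq_iff)
        then have "(p, s) \<in> cover" "(s, q) \<in> cover"
          using lf_le[OF A(2) H(2)] lf_le[OF A(2) H(3)] qF leq_trans[OF H(3) qF]
            leq_trans[OF P(3) qF] H(1) A(4) by auto
        then show "s \<in> ?S" using H by auto
      qed
    qed
    then have "card ?S = card ?T" using card_image[OF lf_inj, of x ?T] by simp
    then show ?thesis using diamond P(3) r unfolding diamond_condition_def by auto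
  next
    case True
    then have q: "q = (greatest_face, {})" using cover_faces_greatest P(2) by blast
    obtain A x where A: "A \<in> flags P" "adm x (fct A)" "fst p \<in> A" "p = lf x (fst p)"
      using P(1) by (elim cover_facesE) (rule that)
    have rp: "rk (fst p) = int n - 1" using r True rank_top N by simp
    then have pr: "fst p \<in> ridges" using cover_faces_fst[OF P(1)] unfolding ridges_def by simp
    have rdg: "rdg A = fst p" using rdg_eqI[OF A(1) pr A(3)] .
    have p: "p = (rdg A, x - {rdg A})" using A(4) upr_ridge[OF pr] rdg by (simp add: lf_def)
    let ?B = "adj P n A" and ?y = "sd x {rdg A}"
    have B: "?B \<in> flags P" using adj_flag[OF A(1)] N by simp
    have y: "adm ?y (fct ?B)" using adm_cross[OF A(1,2)] .
    have rB: "rdg ?B = rdg A" using adj_face[OF A(1), of n "int n - 1"] N by simp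
    have F: "fct A \<in> fcts" "fct ?B \<in> fcts" using fct_fcts A(1) B by auto
    have le: "(rdg A, fct A) \<in> P" "(rdg A, fct ?B) \<in> P" using ridge_facets(1)[OF A(1)] by auto
    have in_facesI: "(G, z) \<in> cover_faces" if "adm z G" for G z
      using lf_in[OF that, of G] that upr_fct[of G] leq_refl[of G] unfolding adm_def fcts_def lf_def by auto
    have in_S: "(G, z) \<in> ?S" if z: "adm z G" "(rdg A, G) \<in> P" "z - {rdg A} = x - {rdg A}" for G z
    proof -
      have G: "G \<in> fcts" using z unfolding adm_def by blast
      then have "G \<noteq> greatest_face" "G \<noteq> rdg A" using fct_neq_greatest rp rdg unfolding fcts_def by auto
      moreover have "(p, (G, z)) \<in> cover"
      proof (rule cover_leI[OF P(1) in_facesI[OF z(1)]])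
        show "(fst p, fst (G, z)) \<in> P" using z(2) rdg by simp
        have "snd p = x - {rdg A}" using p by (metis snd_conv)
        then show "fst (G, z) = greatest_face \<or> snd p = snd (G, z) - upr (fst p)"
          using z(3) upr_ridge[OF pr] rdg by simp
      qed
      moreover have "((G, z), q) \<in> cover" using cover_greatest(2)[OF in_facesI[OF z(1)]] q by simp
      ultimately show ?thesis using p q by auto
    qed
    have "?S = {(fct A, x), (fct ?B, ?y)}"
    proof
      show "{(fct A, x), (fct ?B, ?y)} \<subseteq> ?S"
        using in_S[OF A(2) le(1)] in_S[OF y le(2)] by (auto simp: sd_def)
      show "?S \<subseteq> {(fct A, x), (fct ?B, ?y)}"
      proof
        fix s assume s: "s \<in> ?S"
        then have sF: "s \<in> cover_faces" and ps: "(fst p, fst s) \<in> P" "fst s \<noteq> fst p"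
          using cover_leD[of p s] cover_same_fst[of p s] by auto
        have ps3: "fst s \<noteq> greatest_face" using s cover_same_fst[of s q] True by auto
        note ps = ps ps3
        have "rk (fst s) < int N"
          using rank_eq_top[OF cover_faces_fst[OF sF]] rank_range[OF cover_faces_fst[OF sF]] ps(3) by auto
        then have "fst s \<in> fcts"
          using rank_less[OF ps(1)] ps(2) rp N cover_faces_fst[OF sF] unfolding fcts_def by auto
        moreover obtain C z where C: "C \<in> flags P" "adm z (fct C)" "fst s \<in> C" "s = lf z (fst s)"
          using sF by (elim cover_facesE) (rule that)
        ultimately have z: "adm z (fst s)" "s = (fst s, z)"
          using fct_eqI[of C "fst s"] upr_fct[of "fst s"] by (auto simp: lf_def)
        have "fst s \<in> {fct A, fct ?B}" using ridge_facets(1)[OF A(1)] \<open>fst s \<in> fcts\<close> ps(1) rdg by auto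
        moreover have "snd p = snd s - upr (fst p)" using s cover_leD(4)[of p s] ps(3) by blast
        then have e: "x - {rdg A} = z - {rdg A}" using p z(2) upr_ridge[OF pr] rdg by (metis snd_conv)
        ultimately consider "fst s = fct A" | "fst s = fct ?B" by blast
        then show "s \<in> {(fct A, x), (fct ?B, ?y)}"
        proof cases
          case 1
          then have "z = x" using adm_ridge_unique[OF A(1), of z x] z(1) A(2) e by simp
          then show ?thesis using z(2) 1 by simp
        next
          case 2
          have "?y - {rdg A} = z - {rdg A}" using e unfolding sd_def by blast
          then have "z = ?y" using adm_ridge_unique[OF B, of z ?y] z(1) y rB 2 by simp
          then show ?thesis using z(2) 2 by simp
        qed
      qed
    qed
    then show ?thesis using ridge_facets(2)[OF A(1)] by auto
  qed
qed

text \<open>A state pairs a flag with an arbitrary chain, admissible or not, so that a walk can be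
  translated to any other starting chain. \<open>C\<close> is the set of faces to be kept,
  \<open>U\<close> the set of ridges that may be crossed.\<close>

definition walk_step :: "'a set \<Rightarrow> 'a set \<Rightarrow> (('a set \<times> 'a set) \<times> ('a set \<times> 'a set)) set" where
  "walk_step C U = {((A, x), (B, y)). A \<in> flags P \<and> C \<subseteq> A \<and> C \<subseteq> B \<and>
     (y = x \<and> (\<exists>i<n. B = adj P i A) \<or> y = sd x {rdg A} \<and> rdg A \<in> U \<and> B = adj P n A)}"

lemma walk_stay: "A \<in> flags P \<Longrightarrow> C \<subseteq> A \<Longrightarrow> i < n \<Longrightarrow> C \<subseteq> adj P i A \<Longrightarrow>
    ((A, x), (adj P i A, x)) \<in> walk_step C U"
  and walk_cross: "A \<in> flags P \<Longrightarrow> C \<subseteq> A \<Longrightarrow> C \<subseteq> adj P n A \<Longrightarrow> rdg A \<in> U \<Longrightarrow>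
    ((A, x), (adj P n A, sd x {rdg A})) \<in> walk_step C U"
  unfolding walk_step_def by auto

lemma walk_stepE:
  assumes "((A, x), (B, y)) \<in> walk_step C U"
  obtains (stay) i where "A \<in> flags P" "C \<subseteq> A" "i < n" "C \<subseteq> adj P i A" "B = adj P i A" "y = x"
  | (cross) "A \<in> flags P" "C \<subseteq> A" "C \<subseteq> adj P n A" "rdg A \<in> U" "B = adj P n A" "y = sd x {rdg A}"
  using assms unfolding walk_step_def by auto

abbreviation walk :: "'a set \<Rightarrow> 'a set \<Rightarrow> (('a set \<times> 'a set) \<times> ('a set \<times> 'a set)) set" where
  "walk C U \<equiv> (walk_step C U)\<^sup>*"

lemma walk_sym: "(s, t) \<in> walk C U \<Longrightarrow> (t, s) \<in> walk C U"
proof -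
  have "((B, y), (A, x)) \<in> walk_step C U" if st: "((A, x), (B, y)) \<in> walk_step C U" for A x B y
    using st
  proof (cases rule: walk_stepE)
    case (stay i)
    then have "((adj P i A, x), (adj P i (adj P i A), x)) \<in> walk_step C U"
      using adj_flag[of A i] adj_adj[of A i] N by (intro walk_stay) auto
    then show ?thesis using stay adj_adj[of A i] N by simp
  next
    case cross
    have "rdg (adj P n A) = rdg A" using adj_face[OF cross(1), of n "int n - 1"] N by simp
    then have "((adj P n A, sd x {rdg A}), (adj P n (adj P n A), sd (sd x {rdg A}) {rdg (adj P n A)})) \<in> walk_step C U"
      using cross adj_flag[of A n] adj_adj[of A n] N by (intro walk_cross) auto
    then show ?thesis using cross adj_adj[of A n] N \<open>rdg (adj P n A) = rdg A\<close> by simp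
  qed
  then have "sym (walk_step C U)" unfolding sym_def by auto
  then have "sym (walk C U)" by (rule sym_rtrancl)
  then show "(s, t) \<in> walk C U \<Longrightarrow> (t, s) \<in> walk C U" by (rule symD)
qed

lemma walk_same_facet:
  assumes A: "A \<in> flags P" "C \<subseteq> A" and B: "B \<in> flags P" "C \<subseteq> B" and "fct A = fct B"
  shows "((A, x), (B, x)) \<in> walk C U"
proof -
  have "B \<in> {B. ((A, x), (B, x)) \<in> walk C U}"
  proof (rule flag_connected_above[OF _ A(1) _ B(1), of _ "insert (fct A) C"])
    show "A \<in> {B. ((A, x), (B, x)) \<in> walk C U}" by simp
    show "insert (fct A) C \<subseteq> A" "insert (fct A) C \<subseteq> B"
      using face_props(1)[OF A(1), of "int n"] face_props(1)[OF B(1), of "int n"] assms N by auto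
  next
    fix D i assume D: "D \<in> {B. ((A, x), (B, x)) \<in> walk C U}" "D \<in> flags P" "insert (fct A) C \<subseteq> D"
      "i < N" "insert (fct A) C \<subseteq> adj P i D"
    have "i \<noteq> n"
    proof
      assume "i = n"
      then have "fct D = fct A" "fct (adj P n D) = fct A"
        using fct_eqI fct_fcts[OF A(1)] D adj_flag[OF D(2,4)] by auto
      then show False using ridge_facets(2)[OF D(2)] by simp
    qed
    then have "((D, x), (adj P i D, x)) \<in> walk_step C U"
      using D N by (intro walk_stay) auto
    then show "adj P i D \<in> {B. ((A, x), (B, x)) \<in> walk C U}"
      using D(1) by (simp add: rtrancl_into_rtrancl)
  qed
  then show ?thesis by blast
qed

context
  fixes C H
  assumes H: "H \<in> C" "H \<noteq> greatest_face" "\<And>G. G \<in> C \<Longrightarrow> (G, H) \<in> P \<or> G = greatest_face"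
    and C: "C \<in> Chains P"
begin

text \<open>Strong connectedness of \<open>P\<close> provides some walk, and the chain
  \<open>w\<close> collected on it does not depend on where the chain starts: the same way can be
  walked again, or backwards, from any other chain. As \<open>H\<close> is the largest face of
  \<open>C\<close> below the greatest one, every ridge crossed lies above \<open>H\<close>.\<close>

lemma walk_somehow:
  assumes A: "A \<in> flags P" "C \<subseteq> A" and B: "B \<in> flags P" "C \<subseteq> B"
  shows "\<exists>w. \<forall>x. ((A, x), (B, sd x w)) \<in> walk C (upr H)"
proof -
  let ?S = "{B. \<exists>w. \<forall>x. ((A, x), (B, sd x w)) \<in> walk C (upr H)}"
  have "B \<in> ?S"
  proof (rule flag_connected_above[OF _ A B])
    show "A \<in> ?S" by (auto intro: exI[of _ "{}"])
  next
    fix D i assume D: "D \<in> ?S" "D \<in> flags P" "C \<subseteq> D" "i < N" "C \<subseteq> adj P i D"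
    then obtain w where w: "\<And>x. ((A, x), (D, sd x w)) \<in> walk C (upr H)" by blast
    show "adj P i D \<in> ?S"
    proof (cases "i = n")
      case False
      then have "((D, y), (adj P i D, y)) \<in> walk_step C (upr H)" for y
        using D N by (intro walk_stay) auto
      then have "((A, x), (adj P i D, sd x w)) \<in> walk C (upr H)" for x
        using w rtrancl_into_rtrancl by metis
      then show ?thesis by blast
    next
      case True
      have HD: "H \<in> D" "H \<in> adj P n D" using H(1) D True by auto
      have "rk H \<noteq> int n"
      proof
        assume "rk H = int n"
        then have "fct D = H" "fct (adj P n D) = H"
          using face_eqI[OF D(2) HD(1)] face_eqI[OF adj_flag[OF D(2)] HD(2)] N by auto
        then show False using ridge_facets(2)[OF D(2)] by simp
      qed
      then have "rk H \<le> int n - 1"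
        using rank_range[OF flag_Field[OF D(2) HD(1)]] rank_eq_top[OF flag_Field[OF D(2) HD(1)]] H(2) N by auto
      then have "(H, rdg D) \<in> P"
        using flag_le_iff[OF D(2) HD(1) face_props(1)[OF D(2), of "int n - 1"]]
          face_props(2)[OF D(2), of "int n - 1"] N by auto
      then have "rdg D \<in> upr H" using rdg_ridges[OF D(2)] H(2) unfolding upr_def by simp
      then have "((D, y), (adj P n D, sd y {rdg D})) \<in> walk_step C (upr H)" for y
        using D True by (intro walk_cross) auto
      then have "((A, x), (adj P n D, sd (sd x w) {rdg D})) \<in> walk C (upr H)" for x
        using w rtrancl_into_rtrancl by metis
      then show ?thesis unfolding sd_assoc True by blast
    qed
  qed
  then show ?thesis by blast
qed

text \<open>The faces of \<open>C\<close> other than the greatest lie below \<open>r\<close>. Hence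
  \<open>r\<close> and \<open>F\<close> can be added to the chain \<open>C\<close>, and since
  \<open>C\<close> has no face of rank \<open>n\<close>, crossing \<open>r\<close> keeps it.\<close>

lemma ridge_flag:
  assumes "r \<in> upr H" "F \<in> fcts" "(r, F) \<in> P"
  shows "\<exists>D\<in>flags P. C \<subseteq> D \<and> C \<subseteq> adj P n D \<and> rdg D = r \<and> fct D = F"
proof -
  have r: "r \<in> ridges" "(H, r) \<in> P" using assms(1) H(2) unfolding upr_def by auto
  have Gr: "(G, r) \<in> P \<and> (G, F) \<in> P \<or> G = greatest_face" if "G \<in> C" for G
    using H(3)[OF that] r(2) assms(3) leq_trans by blast
  have F: "r \<in> Field P" "F \<in> Field P" using assms(2) r(1) unfolding fcts_def ridges_def by auto
  have "insert r (insert F C) \<in> Chains P"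
    unfolding Chains_def
    using Gr greatest_face(2) F assms(3) leq_refl C unfolding Chains_def by blast
  from chain_extend[OF this] obtain D where D: "D \<in> flags P" "r \<in> D" "F \<in> D" "C \<subseteq> D" by auto
  have "G \<in> adj P n D" if "G \<in> C" for G
  proof -
    have GD: "G \<in> D" using that D(4) by blast
    have "rk G \<noteq> int n"
      using Gr[OF that] rank_le[of G r] rank_top r(1) N unfolding ridges_def by auto
    then have "face (adj P n D) (rk G) = G"
      using adj_face[OF D(1), of n "rk G"] face_rank_face[OF D(1) GD] rank_range[OF flag_Field[OF D(1) GD]] N
      by simp
    then show ?thesis
      using face_props(1)[OF adj_flag[OF D(1)], of n "rk G"] rank_range[OF flag_Field[OF D(1) GD]] N by auto
  qed
  then show ?thesis
    using D rdg_eqI[OF D(1) r(1)] fct_eqI[OF D(1) assms(2)] by blast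
qed

text \<open>A chain \<open>z\<close> of ridges above \<open>H\<close> whose boundary joins the facets of \<open>A\<close> and \<open>B\<close> is crossed
  by a walk: peel off a ridge of \<open>z\<close> at the facet of \<open>A\<close>, or, if \<open>z\<close> is a cycle, make a detour
  to a ridge of \<open>z\<close> and return along the same way after running through the rest of \<open>z\<close>.\<close>

lemma walk_chain:
  assumes "A \<in> flags P" "C \<subseteq> A" "B \<in> flags P" "C \<subseteq> B" "z \<subseteq> upr H" "bdry z (fct A) (fct B)"
  shows "((A, x), (B, sd x z)) \<in> walk C (upr H)"
  using assms
proof (induction "card z" arbitrary: z A B x rule: less_induct)
  case less
  note A = less.prems(1,2) and B = less.prems(3,4) and z = less.prems(5,6)
  have finz: "finite z" using z(1) upr_ridges ridges_finite by blast
  have smaller: "((adj P n D, x), (E, sd x (sd {r} z))) \<in> walk C (upr H)"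
    if D: "D \<in> flags P" "C \<subseteq> adj P n D" "rdg D = r" and E: "E \<in> flags P" "C \<subseteq> E"
      and r: "r \<in> z" and b: "bdry z (fct D) (fct E)" for D E r x
  proof -
    have "sd {r} z = z - {r}" using r unfolding sd_def by auto
    then have "card (sd {r} z) < card z" "sd {r} z \<subseteq> upr H"
      using card_Diff1_less[OF finz r] z(1) by auto
    moreover have "bdry (sd {r} z) (fct (adj P n D)) (fct E)"
      using bdry_sd[OF _ finz _ b, of "{r}"] bdry_ridge[OF D(1)] D(3) bdry_commute by auto
    ultimately show ?thesis using less.hyps adj_flag[OF D(1), of n] D(2) E N by simp
  qed
  show ?case
  proof (cases "z = {}")
    case True
    then have "fct A = fct B" using z(2) fct_fcts[OF A(1)] unfolding bdry_def by auto
    then show ?thesis using walk_same_facet[OF A B] True by simp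
  next
    case nonempty: False
    show ?thesis
    proof (cases "fct A = fct B")
      case False
      \<comment> \<open>The facet of \<open>A\<close> is an end of \<open>z\<close>, so an odd
        number of ridges of \<open>z\<close>, hence at least one, lies on it.\<close>
      then have "odd (card {r \<in> z. (r, fct A) \<in> P})"
        using z(2) fct_fcts[OF A(1)] unfolding bdry_def by auto
      then have "{r \<in> z. (r, fct A) \<in> P} \<noteq> {}" by (metis card.empty dvd_0_right)
      then obtain r where r: "r \<in> z" "(r, fct A) \<in> P" by blast
      then obtain D where D: "D \<in> flags P" "C \<subseteq> D" "C \<subseteq> adj P n D" "rdg D = r" "fct D = fct A"
        using ridge_flag[OF _ fct_fcts[OF A(1)]] z(1) by blast
      have "((A, x), (D, x)) \<in> walk C (upr H)" using walk_same_facet[OF A D(1,2)] D(5) by simp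
      moreover have "((D, x), (adj P n D, sd x {r})) \<in> walk_step C (upr H)"
        using walk_cross[OF D(1,2,3), of "upr H" x] D(4) r(1) z(1) by auto
      moreover have "((adj P n D, sd x {r}), (B, sd x z)) \<in> walk C (upr H)"
        using smaller[OF D(1,3,4) B r(1), of "sd x {r}"] D(5) z(2) by (simp add: sd_assoc)
      ultimately show ?thesis by (meson rtrancl_into_rtrancl rtrancl_trans)
    next
      case True
      obtain r where r: "r \<in> z" using nonempty by blast
      then have r': "r \<in> upr H" "r \<in> ridges" using z(1) upr_ridges by blast+
      obtain E where E: "E \<in> flags P" "r \<in> E" using in_flag[of r] r'(2) unfolding ridges_def by blast
      have "(r, fct E) \<in> P" using ridge_facets(1)[OF E(1)] rdg_eqI[OF E(1) r'(2) E(2)] by auto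
      then obtain D where D: "D \<in> flags P" "C \<subseteq> D" "C \<subseteq> adj P n D" "rdg D = r"
        using ridge_flag[OF r'(1) fct_fcts[OF E(1)]] by blast
      obtain w where w: "\<And>x. ((A, x), (D, sd x w)) \<in> walk C (upr H)"
        using walk_somehow[OF A D(1,2)] by blast
      have "bdry z (fct D) (fct D)" using z(2) True unfolding bdry_def by simp
      then have "((adj P n D, sd (sd x w) {r}), (D, sd (sd (sd x w) {r}) (sd {r} z))) \<in> walk C (upr H)"
        using smaller[OF D(1,3,4) D(1,2) r] by blast
      moreover have "sd (sd (sd x w) {r}) (sd {r} z) = sd (sd x z) w"
        unfolding sd_def by blast
      moreover have "((D, sd x w), (adj P n D, sd (sd x w) {r})) \<in> walk_step C (upr H)"
        using walk_cross[OF D(1,2,3), of "upr H" "sd x w"] D(4) r'(1) by auto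
      ultimately have "((A, x), (D, sd (sd x z) w)) \<in> walk C (upr H)"
        using w[of x] by (metis rtrancl_into_rtrancl rtrancl_trans)
      \<comment> \<open>The way back starts from a chain that has changed by \<open>z\<close>; this
        uses that \<open>w\<close> serves for every starting chain.\<close>
      also have "((D, sd (sd x z) w), (A, sd x z)) \<in> walk C (upr H)"
        using w by (rule walk_sym)
      also have "((A, sd x z), (B, sd x z)) \<in> walk C (upr H)"
        using walk_same_facet[OF A B True] .
      finally show ?thesis .
    qed
  qed
qed

end

lemma cover_adjacent:
  assumes A: "A \<in> flags P" "adm x (fct A)" and B: "B \<in> flags P" "adm y (fct B)"
    and st: "((A, x), (B, y)) \<in> walk_step C U"
  shows "adjacent_flags cover (lf x ` A) (lf y ` B)"
proof -
  have neq: "lf x ` A \<noteq> lf y ` B" if "A \<noteq> B"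
    using that fst_lf_image by metis
  from st show ?thesis
  proof (cases rule: walk_stepE)
    case (stay i)
    have i: "i < N" using stay N by simp
    show ?thesis
    proof (rule cover.adjacent_faceI(1)[OF lift_flag[OF A] lift_flag[OF B] neq, of "int i"])
      show "A \<noteq> B" using adj_neq[OF A(1) i] stay by auto
      fix j assume "-1 \<le> j" "j \<le> int N" "j \<noteq> int i"
      then show "cover.face (lf x ` A) j = cover.face (lf y ` B) j"
        using cover_face[OF A] cover_face[OF B] adj_face[OF A(1) i] stay by simp
    qed (use i in auto)
  next
    case cross
    have i: "n < N" using N by simp
    show ?thesis
    proof (rule cover.adjacent_faceI(1)[OF lift_flag[OF A] lift_flag[OF B] neq, of "int n"])
      show "A \<noteq> B" using adj_neq[OF A(1) i] cross by auto
      fix j assume j: "-1 \<le> j" "j \<le> int N" "j \<noteq> int n"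
      have fj: "face A j \<in> A" "rk (face A j) = j" using face_props[OF A(1) j(1,2)] by auto
      \<comment> \<open>All faces of \<open>A\<close> other than its facet lie below the crossed
        ridge or are the greatest face, so their lifts do not see whether the chain contains this
        ridge.\<close>
      have "rdg A \<in> upr (face A j)"
      proof (cases "face A j = greatest_face")
        case True
        then show ?thesis using rdg_ridges[OF A(1)] unfolding upr_def by simp
      next
        case False
        then have "j \<noteq> int N" using rank_eq_top[OF flag_Field[OF A(1) fj(1)]] fj(2) by auto
        then have "(face A j, rdg A) \<in> P" using face_le[OF A(1) j(1), of "int n - 1"] j N by auto
        then show ?thesis using rdg_ridges[OF A(1)] False unfolding upr_def by simp
      qed
      then have "lf y (face A j) = lf x (face A j)" using cross unfolding lf_def sd_def by auto
      then show "cover.face (lf x ` A) j = cover.face (lf y ` B) j"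
        using cover_face[OF A j(1,2)] cover_face[OF B j(1,2)] adj_face[OF A(1) i j] cross by simp
    qed (use i in auto)
  qed
qed

text \<open>The ridges that may be crossed belong to \<open>upr G\<close> for every face
  \<open>G\<close> in \<open>C\<close>, so the lifts of the kept faces remain the same faces of the
  cover along the whole walk, while \<open>adm_cross\<close> keeps the chain admissible.\<close>

lemma walk_lift:
  assumes "(s, t) \<in> walk C U" "s = (A, x)" "A \<in> flags P" "adm x (fct A)" "C \<subseteq> A"
    and U: "\<And>G. G \<in> C \<Longrightarrow> U \<subseteq> upr G"
  shows "fst t \<in> flags P \<and> adm (snd t) (fct (fst t)) \<and> lf (snd t) ` C = lf x ` C \<and>
    (lf x ` A, lf (snd t) ` fst t) \<in>
      {(D, E). adjacent_flags cover D E \<and> lf x ` C \<subseteq> D \<and> lf x ` C \<subseteq> E}\<^sup>*"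
  using assms(1)
proof (induction rule: rtrancl_induct)
  case base
  then show ?case using assms by simp
next
  case (step t u)
  obtain B y where t: "t = (B, y)" by fastforce
  obtain D z where u: "u = (D, z)" by fastforce
  have B: "B \<in> flags P" "adm y (fct B)" and lfC: "lf y ` C = lf x ` C" using step.IH t by auto
  have st: "((B, y), (D, z)) \<in> walk_step C U" using step.hyps t u by simp
  have CB: "C \<subseteq> B" and CD: "C \<subseteq> D" and D: "D \<in> flags P" "adm z (fct D)" and eq: "lf z ` C = lf y ` C"
  proof -
    from st have "C \<subseteq> B \<and> C \<subseteq> D \<and> D \<in> flags P \<and> adm z (fct D) \<and> lf z ` C = lf y ` C"
    proof (cases rule: walk_stepE)
      case (stay i)
      then show ?thesis using adj_flag[OF B(1), of i] adj_face[OF B(1), of i "int n"] B(2) N by auto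
    next
      case cross
      have "lf z G = lf y G" if "G \<in> C" for G
        using U[OF that] cross unfolding lf_def sd_def by auto
      then have "lf z ` C = lf y ` C" by (rule image_cong[OF refl])
      then show ?thesis using cross adm_cross[OF B] adj_flag[OF B(1), of n] N by auto
    qed
    then show "C \<subseteq> B" "C \<subseteq> D" "D \<in> flags P" "adm z (fct D)" "lf z ` C = lf y ` C" by auto
  qed
  have "lf x ` C \<subseteq> lf y ` B" "lf x ` C \<subseteq> lf z ` D" using lfC eq CB CD by blast+
  then have "(lf y ` B, lf z ` D) \<in>
      {(D, E). adjacent_flags cover D E \<and> lf x ` C \<subseteq> D \<and> lf x ` C \<subseteq> E}"
    using cover_adjacent[OF B D st] by simp
  then show ?case using step.IH D eq lfC unfolding t u by (auto intro: rtrancl_into_rtrancl)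
qed

text \<open>The common faces of the two flags are the lifts of the set \<open>C\<close> of faces on
  which \<open>x\<close> and \<open>y\<close> agree. For the largest face \<open>H\<close> of
  \<open>C\<close> below the greatest one, agreement means that the sum of \<open>x\<close> and
  \<open>y\<close> lies in \<open>upr H\<close>; its boundary joins the two facets, so
  \<open>walk_chain\<close> turns it into a walk.\<close>

lemma cover_connected: "strongly_flag_connected cover"
  unfolding strongly_flag_connected_def
proof (intro ballI)
  fix D E assume D: "D \<in> flags cover" and E: "E \<in> flags cover"
  from D obtain A x where A: "A \<in> flags P" "adm x (fct A)" and DA: "D = lf x ` A"
    by (elim lift_flagE) (rule that)
  from E obtain B y where B: "B \<in> flags P" "adm y (fct B)" and EB: "E = lf y ` B"
    by (elim lift_flagE) (rule that)
  define C where "C = {G \<in> A \<inter> B. lf x G = lf y G}"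
  have int: "D \<inter> E = lf x ` C" unfolding DA EB C_def by (auto simp: lf_def)
  have CA: "C \<subseteq> A" "C \<subseteq> B" unfolding C_def by auto
  have Cch: "C \<in> Chains P" using flag_chain[OF A(1)] CA(1) unfolding Chains_def by blast
  have finC: "finite {G \<in> C. G \<noteq> greatest_face}"
    using finite_subset[OF CA(1) flag_finite[OF A(1)]] by simp
  have least: "least_face \<in> C"
  proof -
    have "upr least_face = ridges"
      using rank_bot rank_top least_face(2) unfolding upr_def ridges_def by auto
    then show ?thesis
      using least_face_in_flag A B unfolding C_def lf_def adm_def by auto
  qed
  then have ne: "least_face \<in> {G \<in> C. G \<noteq> greatest_face}" using rank_bot rank_top by auto
  define m where "m = Max (rk ` {G \<in> C. G \<noteq> greatest_face})"
  have "m \<in> rk ` {G \<in> C. G \<noteq> greatest_face}"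
    unfolding m_def using finC ne by (intro Max_in) auto
  then obtain H where H: "H \<in> C" "H \<noteq> greatest_face" "rk H = m" by auto
  have H_max: "(G, H) \<in> P \<or> G = greatest_face" if "G \<in> C" for G
  proof (cases "G = greatest_face")
    case False
    then have "rk G \<le> rk H" unfolding H(3) m_def using finC that by (intro Max_ge) auto
    then show ?thesis using flag_le_iff[OF A(1), of G H] that H(1) CA(1) by auto
  qed simp
  have "x - upr H = y - upr H" using H(1) unfolding C_def lf_def by simp
  then have z: "sd x y \<subseteq> upr H" unfolding sd_def by blast
  have xy: "finite x" "finite y" using A(2) B(2) ridges_finite unfolding adm_def by auto
  have "bdry (sd x y) (fct A) (fct B)"
    using bdry_sd[OF xy] A(2) B(2) bdry_commute unfolding adm_def by blast
  from walk_chain[OF H(1,2) H_max Cch A(1) CA(1) B(1) CA(2) z this, of x]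
  have w: "((A, x), (B, y)) \<in> walk C (upr H)" by simp
  have U: "upr H \<subseteq> upr G" if "G \<in> C" for G
    using H_max[OF that] upr_antimono[of G H] H(2) upr_ridges unfolding upr_def[of G] by auto
  show "(D, E) \<in> {(C, Da). adjacent_flags cover C Da \<and> D \<inter> E \<subseteq> C \<and> D \<inter> E \<subseteq> Da}\<^sup>*"
    using walk_lift[OF w refl A CA(1) U] unfolding int unfolding DA EB by simp
qed

lemma cover_polytope: "polytope N cover"
  unfolding polytope_def cover_Field
proof (intro conjI)
  show "\<exists>a\<in>cover_faces. \<forall>x\<in>cover_faces. (a, x) \<in> cover"
    by (rule bexI[OF _ cover_least(1)]) (simp add: cover_least(2))
  show "\<exists>b\<in>cover_faces. \<forall>x\<in>cover_faces. (x, b) \<in> cover"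
    by (rule bexI[OF _ cover_greatest(1)]) (simp add: cover_greatest(2))
qed (use cover_po[unfolded cover_Field] cover.flag_card cover_connected cover_diamond in auto)

sublocale cover: polytope_poset N cover
  by unfold_locales (rule cover_polytope)

end

lemma Field_below: "Partial_order P \<Longrightarrow> Field (Restr P {G. (G, F) \<in> P}) = {G. (G, F) \<in> P}"
  unfolding order_on_defs refl_on_def Field_def by auto

lemma poset_map_below:
  assumes f: "poset_map f P Q" and P: "Partial_order P" and Q: "Partial_order Q" and F: "F \<in> Field P"
  shows "poset_map f (Restr P {G. (G, F) \<in> P}) (Restr Q {G. (G, f F) \<in> Q})"
proof -
  interpret poset_isom f P Q using f by unfold_locales
  have sub: "{G. (G, F) \<in> P} \<subseteq> Field P" by (auto intro: FieldI1)
  have "f ` {G. (G, F) \<in> P} = {G. (G, f F) \<in> Q}"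
  proof
    show "f ` {G. (G, F) \<in> P} \<subseteq> {G. (G, f F) \<in> Q}" using le_iff[OF _ F] sub by blast
    show "{G. (G, f F) \<in> Q} \<subseteq> f ` {G. (G, F) \<in> P}"
    proof
      fix H assume H: "H \<in> {G. (G, f F) \<in> Q}"
      then have "H \<in> f ` Field P" using surj by (auto intro: FieldI1)
      then obtain G where "G \<in> Field P" "H = f G" by blast
      then show "H \<in> f ` {G. (G, F) \<in> P}" using H le_iff[OF _ F] by blast
    qed
  qed
  then have "bij_betw f {G. (G, F) \<in> P} {G. (G, f F) \<in> Q}"
    using inj_on_subset[OF inj sub] unfolding bij_betw_def by blast
  then show ?thesis
    unfolding poset_map_def Field_below[OF P] Field_below[OF Q] using le_iff sub F by auto
qed

context ridge_cover
begin

lemma cover_faces_finite: "finite cover_faces"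
proof (rule finite_subset)
  show "cover_faces \<subseteq> Field P \<times> Pow ridges"
    using cover_faces_fst cover_faces_snd by (fastforce simp: mem_Times_iff)
  show "finite (Field P \<times> Pow ridges)" using fin ridges_finite[of ridges] by simp
qed

subsection \<open>Lifting automorphisms\<close>

text \<open>The image of a chain that ends at the base facet ends at the image of the base facet;
  adding \<open>d\<close>, a chain between these two, repairs this. For fixed \<open>f\<close>, the
  choices of \<open>d\<close> differ by cycles, that is, by deck transformations.\<close>

definition lift_map :: "('a \<Rightarrow> 'a) \<Rightarrow> 'a set \<Rightarrow> 'a \<times> 'a set \<Rightarrow> 'a \<times> 'a set" where
  "lift_map f d p = (f (fst p), sd (f ` snd p) d - upr (f (fst p)))"

context
  fixes f
  assumes f: "poset_map f P P"
begin

interpretation f: poset_isom f P P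
  using f by unfold_locales

lemma map_rank_level: "f ` {r \<in> Field P. rk r = k} = {r \<in> Field P. rk r = k}"
proof
  show "f ` {r \<in> Field P. rk r = k} \<subseteq> {r \<in> Field P. rk r = k}"
    using f.map_Field f.face_rank_map by auto
  show "{r \<in> Field P. rk r = k} \<subseteq> f ` {r \<in> Field P. rk r = k}"
  proof
    fix r assume r: "r \<in> {r \<in> Field P. rk r = k}"
    then have "r \<in> f ` Field P" using f.surj by simp
    then obtain s where s: "s \<in> Field P" "r = f s" by blast
    then have "rk s = k" using r f.face_rank_map[OF s(1)] by simp
    then show "r \<in> f ` {r \<in> Field P. rk r = k}" using s by blast
  qed
qed

lemma map_ridges: "f ` ridges = ridges" and map_fcts: "f ` fcts = fcts"
  using map_rank_level unfolding ridges_def fcts_def by auto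

lemma map_greatest: "G \<in> Field P \<Longrightarrow> f G = greatest_face \<longleftrightarrow> G = greatest_face"
  using rank_eq_top f.face_rank_map f.map_Field by metis

lemma map_upr: "G \<in> Field P \<Longrightarrow> f ` upr G = upr (f G)"
proof -
  assume G: "G \<in> Field P"
  have sub: "ridges \<subseteq> Field P" unfolding ridges_def by blast
  have "f ` {r \<in> ridges. (G, r) \<in> P} = {r \<in> f ` ridges. (f G, r) \<in> P}"
    using f.le_iff[OF G] sub by blast
  then show ?thesis using map_greatest[OF G] map_ridges unfolding upr_def by simp
qed

lemma bdry_map:
  assumes x: "x \<subseteq> ridges" and F: "F \<in> fcts" "F' \<in> fcts" "bdry x F F'"
  shows "bdry (f ` x) (f F) (f F')"
  unfolding bdry_def
proof
  fix G assume "G \<in> fcts"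
  then obtain G' where G': "G' \<in> fcts" "G = f G'" using map_fcts by blast
  have sub: "x \<subseteq> Field P" "F \<in> Field P" "F' \<in> Field P" "G' \<in> Field P"
    using x F G' unfolding ridges_def fcts_def by auto
  have "{r \<in> f ` x. (r, G) \<in> P} = f ` {r \<in> x. (r, G') \<in> P}"
    using f.le_iff[OF _ sub(4)] sub(1) G'(2) by blast
  then have "card {r \<in> f ` x. (r, G) \<in> P} = card {r \<in> x. (r, G') \<in> P}"
    using f.card_image_Field[of "{r \<in> x. (r, G') \<in> P}"] sub(1) by auto
  moreover have "G = f F \<longleftrightarrow> G' = F" "G = f F' \<longleftrightarrow> G' = F'"
    using inj_on_eq_iff[OF f.inj sub(4)] sub G'(2) by auto
  ultimately show "odd (card {r \<in> f ` x. (r, G) \<in> P}) \<longleftrightarrow> (G = f F) \<noteq> (G = f F')"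
    using F(3) G'(1) unfolding bdry_def by simp
qed

context
  fixes d
  assumes d: "d \<subseteq> ridges" "bdry d (f (fct base)) (fct base)"
begin

lemma adm_lift:
  assumes "adm x F"
  shows "adm (sd (f ` x) d) (f F)"
proof -
  have x: "x \<subseteq> ridges" "F \<in> fcts" "bdry x F (fct base)" using assms unfolding adm_def by auto
  have "bdry (f ` x) (f F) (f (fct base))" using bdry_map x fct_fcts[OF base] by blast
  moreover have fx: "f ` x \<subseteq> ridges" using x(1) map_ridges by blast
  ultimately have "bdry (sd (f ` x) d) (f F) (fct base)"
    using bdry_sd[OF ridges_finite[OF fx] ridges_finite[OF d(1)] _ d(2)] by blast
  then show ?thesis using sd_subset[OF fx d(1)] x(2) map_fcts unfolding adm_def by blast
qed

lemma lift_map_lf: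
  assumes "x \<subseteq> ridges" "G \<in> Field P"
  shows "lift_map f d (lf x G) = lf (sd (f ` x) d) (f G)"
proof -
  have "ridges \<subseteq> Field P" unfolding ridges_def by blast
  then have "x - upr G \<subseteq> Field P" "upr G \<subseteq> Field P" using assms(1) upr_ridges[of G] by blast+
  from inj_on_image_set_diff[OF f.inj this]
  have "f ` (x - upr G) = f ` x - upr (f G)" using map_upr[OF assms(2)] by simp
  then show ?thesis unfolding lift_map_def lf_def sd_def by auto
qed

lemma lift_map_flag:
  assumes A: "A \<in> flags P" "adm x (fct A)"
  shows "lift_map f d ` lf x ` A = lf (sd (f ` x) d) ` f ` A"
  unfolding image_image using lift_map_lf A flag_Field unfolding adm_def by (intro image_cong) auto

lemma lift_map_in:
  assumes "p \<in> cover_faces"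
  shows "lift_map f d p \<in> cover_faces"
proof -
  obtain A x where A: "A \<in> flags P" "adm x (fct A)" "fst p \<in> A" "p = lf x (fst p)"
    using assms by (elim cover_facesE) (rule that)
  have G: "fst p \<in> Field P" using flag_Field A by blast
  have "lift_map f d p = lf (sd (f ` x) d) (f (fst p))"
    using lift_map_lf[of x "fst p"] A G unfolding adm_def by auto
  moreover have "(f (fst p), f (fct A)) \<in> P \<or> f (fst p) = greatest_face"
    using in_flag_below[OF A(1,3)] map_greatest[OF G] f.le_iff[OF G, of "fct A"] fct_fcts[OF A(1)]
    unfolding fcts_def by auto
  ultimately show ?thesis using lf_in[OF adm_lift[OF A(2)]] by simp
qed

lemma lift_map_snd:
  assumes "u \<subseteq> ridges" "v \<subseteq> ridges" "sd (f ` u) d - f ` w = sd (f ` v) d - f ` w" "w \<subseteq> ridges"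
  shows "u - w = v - w"
proof -
  have sub: "ridges \<subseteq> Field P" unfolding ridges_def by blast
  have "f ` u - f ` w = f ` v - f ` w" using assms(3) unfolding sd_def by blast
  then have "f ` (u - w) = f ` (v - w)"
    using inj_on_image_set_diff[OF f.inj] assms sub by (metis Diff_subset subset_trans)
  then show ?thesis
    using inj_on_image_eq_iff[OF f.inj, of "u - w" "v - w"] assms sub by blast
qed

lemma lift_map_poset_map: "poset_map (lift_map f d) cover cover"
proof -
  have inj: "inj_on (lift_map f d) cover_faces"
  proof (rule inj_onI)
    fix p q assume pq: "p \<in> cover_faces" "q \<in> cover_faces" and eq: "lift_map f d p = lift_map f d q"
    have fst: "fst p = fst q"
      using eq inj_onD[OF f.inj] cover_faces_fst pq unfolding lift_map_def by auto
    then have "sd (f ` snd p) d - f ` upr (fst p) = sd (f ` snd q) d - f ` upr (fst p)"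
      using eq map_upr[OF cover_faces_fst[OF pq(1)]] unfolding lift_map_def by auto
    then have "snd p - upr (fst p) = snd q - upr (fst p)"
      using lift_map_snd[of "snd p" "snd q" "upr (fst p)"] upr_ridges
        cover_faces_snd[OF pq(1)] cover_faces_snd[OF pq(2)] by blast
    then have "snd p = snd q"
      using cover_faces_snd[OF pq(1)] cover_faces_snd[OF pq(2)] fst by auto
    then show "p = q" using fst by (simp add: prod_eq_iff)
  qed
  have "lift_map f d ` cover_faces = cover_faces"
    using endo_inj_surj[OF cover_faces_finite _ inj] lift_map_in by blast
  then have bij: "bij_betw (lift_map f d) cover_faces cover_faces"
    using inj unfolding bij_betw_def by blast
  have "(p, q) \<in> cover \<longleftrightarrow> (lift_map f d p, lift_map f d q) \<in> cover"
    if pq: "p \<in> cover_faces" "q \<in> cover_faces" for p q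
  proof -
    have F: "fst p \<in> Field P" "fst q \<in> Field P" using cover_faces_fst pq by auto
    have s: "snd p \<subseteq> ridges" "snd q \<subseteq> ridges" "snd p - upr (fst p) = snd p"
      using cover_faces_snd pq by blast+
    have char: "(p, q) \<in> cover \<longleftrightarrow> (fst p, fst q) \<in> P \<and> (fst q = greatest_face \<or> snd p = snd q - upr (fst p))"
      if "p \<in> cover_faces" "q \<in> cover_faces" for p q
      using cover_leD[of p q] cover_leI[OF that] by blast
    have "snd p = snd q - upr (fst p) \<longleftrightarrow>
      sd (f ` snd p) d - upr (f (fst p)) = sd (f ` snd q) d - upr (f (fst q)) - upr (f (fst p))"
      if le: "(fst p, fst q) \<in> P" "fst q \<noteq> greatest_face"
    proof -
      have "upr (f (fst q)) \<subseteq> upr (f (fst p))"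
        using upr_antimono[OF le] map_upr[OF F(1)] map_upr[OF F(2)] by blast
      then have e: "sd (f ` snd q) d - upr (f (fst q)) - upr (f (fst p)) = sd (f ` snd q) d - f ` upr (fst p)"
        using map_upr[OF F(1)] by blast
      have "sd (f ` snd p) d - f ` upr (fst p) = sd (f ` snd q) d - f ` upr (fst p)"
        if eq: "snd p = snd q - upr (fst p)"
      proof -
        have "f ` snd p = f ` snd q - f ` upr (fst p)"
          using inj_on_image_set_diff[OF f.inj, of "snd q" "upr (fst p)"] s(2) upr_ridges eq
          unfolding ridges_def by blast
        then show ?thesis unfolding sd_def by blast
      qed
      moreover have "snd p = snd q - upr (fst p)"
        if "sd (f ` snd p) d - f ` upr (fst p) = sd (f ` snd q) d - f ` upr (fst p)"
        using lift_map_snd[OF s(1,2) that upr_ridges] s(3) by simp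
      ultimately show ?thesis unfolding e unfolding map_upr[OF F(1), symmetric] by blast
    qed
    then show ?thesis
      unfolding char[OF pq] char[OF lift_map_in[OF pq(1)] lift_map_in[OF pq(2)]]
      using f.le_iff[OF F] map_greatest[OF F(2)] by (auto simp: lift_map_def)
  qed
  then show ?thesis using bij unfolding poset_map_def cover_Field by blast
qed

end

end

text \<open>The correction \<open>d\<close> is the sum of the image of \<open>x\<close> and
  \<open>y\<close>, which has the boundary that a lift of \<open>f\<close> requires. With
  \<open>f\<close> the identity this contains the transitivity of the deck transformations on the
  lifts of a flag.\<close>

lemma lift_orbit:
  assumes A: "A \<in> flags P" "adm x (fct A)" and B: "B \<in> flags P" "adm y (fct B)"
    and f: "poset_map f P P" "f ` A = B"
  shows "\<exists>g. poset_map g cover cover \<and> g ` lf x ` A = lf y ` B"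
proof -
  interpret f: poset_isom f P P using f(1) by unfold_locales
  define d where "d = sd (f ` x) y"
  have "f (fct A) \<in> fcts"
    using fct_fcts[OF A(1)] f.map_Field f.face_rank_map unfolding fcts_def by auto
  moreover have "f (fct A) \<in> B" using f(2) face_props(1)[OF A(1), of "int n"] N by auto
  ultimately have fA: "f (fct A) = fct B" using fct_eqI[OF B(1)] by simp
  have x: "x \<subseteq> ridges" "bdry x (fct A) (fct base)" and y: "y \<subseteq> ridges" "bdry y (fct B) (fct base)"
    using A(2) B(2) unfolding adm_def by auto
  have fx: "f ` x \<subseteq> ridges" using x(1) map_ridges[OF f(1)] by blast
  have b: "bdry (f ` x) (f (fct base)) (fct B)"
    using bdry_map[OF f(1) x(1) fct_fcts[OF A(1)] fct_fcts[OF base] x(2)] fA bdry_commute by simp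
  have d: "d \<subseteq> ridges" "bdry d (f (fct base)) (fct base)"
    unfolding d_def using sd_subset[OF fx y(1)] bdry_sd[OF ridges_finite[OF fx] ridges_finite[OF y(1)] b y(2)] .
  have "sd (f ` x) d = y" unfolding d_def by simp
  then have "lift_map f d ` lf x ` A = lf y ` B"
    using lift_map_flag[OF f(1) d A] f(2) by simp
  then show ?thesis using lift_map_poset_map[OF f(1) d] by blast
qed

text \<open>Below a facet \<open>(F, x)\<close> every chain is a reduction of \<open>x\<close>, so a
  lower face determines its lift and nothing is unfolded inside a facet.\<close>

lemma cover_facet_map:
  assumes "adm x F"
  shows "poset_map fst (Restr cover {s. (s, (F, x)) \<in> cover}) (Restr P {G. (G, F) \<in> P})"
proof -
  have F: "F \<in> fcts" "F \<in> Field P" using assms unfolding adm_def fcts_def by auto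
  have lfF: "lf x F = (F, x)" using upr_fct[OF F(1)] by (simp add: lf_def)
  have le: "(lf x G, lf x H) \<in> cover \<longleftrightarrow> (G, H) \<in> P" if "(G, F) \<in> P" "(H, F) \<in> P" for G H
    using lf_le[OF assms, of G H] that cover_leD(3)[of "lf x G" "lf x H"] by auto
  have eq: "{s. (s, (F, x)) \<in> cover} = lf x ` {G. (G, F) \<in> P}"
  proof
    show "{s. (s, (F, x)) \<in> cover} \<subseteq> lf x ` {G. (G, F) \<in> P}"
    proof
      fix s assume "s \<in> {s. (s, (F, x)) \<in> cover}"
      then have s: "(s, (F, x)) \<in> cover" by simp
      then have "snd s = x - upr (fst s)" using cover_leD(4)[OF s] fct_neq_greatest[OF F(1)] by simp
      then have "s = lf x (fst s)" by (simp add: lf_def prod_eq_iff)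
      then show "s \<in> lf x ` {G. (G, F) \<in> P}" using cover_leD(3)[OF s] by auto
    qed
    show "lf x ` {G. (G, F) \<in> P} \<subseteq> {s. (s, (F, x)) \<in> cover}"
      using le[OF _ leq_refl[OF F(2)]] lfF by auto
  qed
  have "bij_betw fst (lf x ` {G. (G, F) \<in> P}) {G. (G, F) \<in> P}"
    unfolding bij_betw_def by (auto simp: inj_on_def)
  moreover have "(s, t) \<in> Restr cover {s. (s, (F, x)) \<in> cover} \<longleftrightarrow> (fst s, fst t) \<in> Restr P {G. (G, F) \<in> P}"
    if "s \<in> lf x ` {G. (G, F) \<in> P}" "t \<in> lf x ` {G. (G, F) \<in> P}" for s t
    using that le unfolding eq by auto
  moreover have "Field (Restr cover {s. (s, (F, x)) \<in> cover}) = lf x ` {G. (G, F) \<in> P}"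
    using Field_below[OF cover_po, of "(F, x)"] eq by simp
  ultimately show ?thesis
    unfolding poset_map_def Field_below[OF po] by simp
qed

text \<open>Adjacent flags of the cover cannot lie over a single flag of \<open>P\<close>: they
  share their facet or their ridge, and over a given flag either of these determines the
  chain.\<close>

lemma cover_adjacent_projection:
  assumes "adjacent_flags cover D E"
  shows "adjacent_flags P (fst ` D) (fst ` E)"
proof -
  have D: "D \<in> flags cover" and E: "E \<in> flags cover" using assms unfolding adjacent_flags_def by auto
  obtain i where i: "i < N" "E = adj cover i D" using assms by (elim cover.adjacent_adj) (rule that)
  from D obtain A x where A: "A \<in> flags P" "adm x (fct A)" and DA: "D = lf x ` A"
    by (elim lift_flagE) (rule that)
  from E obtain B y where B: "B \<in> flags P" "adm y (fct B)" and EB: "E = lf y ` B"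
    by (elim lift_flagE) (rule that)
  have same: "lf x (face A j) = lf y (face B j)" if "-1 \<le> j" "j \<le> int N" "j \<noteq> int i" for j
  proof -
    have "cover.face E j = cover.face D j" using cover.adj_face[OF D i(1) that] i(2) by simp
    then show ?thesis unfolding DA EB using cover_face[OF A that(1,2)] cover_face[OF B that(1,2)] by simp
  qed
  have "A \<noteq> B"
  proof
    assume AB: "A = B"
    have "x = y"
    proof (cases "i = n")
      case False
      then have "lf x (fct A) = lf y (fct A)" using same[of "int n"] AB N by simp
      then show ?thesis using upr_fct[OF fct_fcts[OF A(1)]] by (simp add: lf_def)
    next
      case True
      then have "lf x (rdg A) = lf y (rdg A)" using same[of "int n - 1"] AB N by simp
      then show ?thesis
        using upr_ridge[OF rdg_ridges[OF A(1)]] adm_ridge_unique[OF A] B(2) AB by (simp add: lf_def)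
    qed
    then show False using cover.adj_neq[OF D i(1)] i(2) DA EB AB by simp
  qed
  moreover have "face A j = face B j" if "-1 \<le> j" "j \<le> int N" "j \<noteq> int i" for j
    using same[OF that] by (simp add: lf_def)
  ultimately have "adjacent_flags P A B"
    using adjacent_faceI(1)[OF A(1) B(1), of "int i"] i(1) by auto
  then show ?thesis unfolding DA EB by simp
qed

lemma cover_flags_projection: "(`) fst ` flags cover = flags P"
proof
  show "(`) fst ` flags cover \<subseteq> flags P"
  proof
    fix A assume "A \<in> (`) fst ` flags cover"
    then obtain D where "D \<in> flags cover" "A = fst ` D" by blast
    then show "A \<in> flags P" by (elim lift_flagE) simp
  qed
  show "flags P \<subseteq> (`) fst ` flags cover"
  proof
    fix A assume A: "A \<in> flags P"
    then obtain x where "adm x (fct A)" using adm_ex by blast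
    from imageI[OF lift_flag[OF A this], of "(`) fst"] show "A \<in> (`) fst ` flags cover" by simp
  qed
qed

text \<open>Automorphisms lift, so the cover has at most two orbits. These do not merge: an
  automorphism from a lift of the base flag to the \<open>0\<close>-adjacent flag would fix the
  facet of both and induce on it an automorphism between adjacent flags, although the facet is
  isomorphic to the chiral polytope \<open>K\<close>.\<close>

lemma cover_chiral:
  assumes P: "chiral_polytope N P" and K: "chiral_polytope n K"
    and facets: "\<forall>L\<in>facets N P. poset_iso L K"
  shows "chiral_polytope N cover"
proof -
  interpret C: chiral_poset N P using P by (rule chiral_posetI)
  define F where "F = fct base"
  define L where "L = Restr P {G. (G, F) \<in> P}"
  have F: "F \<in> Field P" "rk F = int n" "F \<in> base"
    using fct_fcts[OF base] face_props(1)[OF base, of "int n"] N unfolding F_def fcts_def by auto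
  have "L \<in> facets N P" using F N unfolding facets_def L_def by auto
  then obtain h where "poset_map h L K" using facets unfolding poset_iso_map by blast
  from poset_isom_chiral[OF poset_map_inv[OF this] K] have Lch: "chiral_polytope n L" .
  interpret L: chiral_poset n L using Lch by (rule chiral_posetI)
  have Lpoly: "polytope n (Restr P {G. (G, F) \<in> P})" using L.poly unfolding L_def .
  define B where "B = adj P 0 base"
  have i: "0 < N" using N by simp
  have B: "B \<in> flags P" unfolding B_def using adj_flag[OF base i] .
  have fB: "fct B = F" unfolding B_def F_def using adj_face[OF base i, of "int n"] N n_pos by simp
  \<comment> \<open>Changing the \<open>0\<close>-face keeps the facet, because \<open>n\<close> is
    at least 1, so the empty chain lifts both flags.\<close>
  have admA: "adm {} (fct base)" and admB: "adm {} (fct B)" using adm_base fB F_def by auto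
  note flA = lift_flag[OF base admA] and flB = lift_flag[OF B admB]
  have FB: "F \<in> B" using face_props(1)[OF B, of "int n"] fB N by auto
  have distinct: "flag_orbit cover (lf {} ` base) \<noteq> flag_orbit cover (lf {} ` B)"
  proof
    assume eq: "flag_orbit cover (lf {} ` base) = flag_orbit cover (lf {} ` B)"
    have sub: "lf {} ` base \<subseteq> Field cover" "lf {} ` B \<subseteq> Field cover"
      using cover.flag_Field flA flB by blast+
    obtain g where g: "poset_map g cover cover" "g ` lf {} ` base = lf {} ` B"
      using eq unfolding flag_orbit_eq_iff[OF sub] by blast
    interpret g: poset_isom g cover cover using g(1) by unfold_locales
    have fixed: "g (lf {} G) = lf {} G" if G: "G \<in> base" "G \<in> B" for G
    proof -
      have GF: "lf {} G \<in> Field cover" using sub(1) G(1) by blast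
      have "g (lf {} G) \<in> lf {} ` B" using g(2) G(1) by blast
      moreover have "lf {} G \<in> lf {} ` B" using G(2) by blast
      ultimately show ?thesis
        using cover.flag_rank_inj[OF flB] g.face_rank_map[OF GF] unfolding inj_on_def by blast
    qed
    have lfF: "lf {} F = (F, {})" by (simp add: lf_def)
    let ?Q = "Restr cover {s. (s, (F, {})) \<in> cover}"
    have pQ: "(F, {}) \<in> Field cover" using sub(1) F(3) lfF by (metis image_eqI subsetD)
    have gQ: "poset_map g ?Q ?Q"
      using poset_map_below[OF g(1) cover_po cover_po pQ] fixed[OF F(3) FB] lfF by simp
    have fstQ: "poset_map fst ?Q L" unfolding L_def using cover_facet_map admA F_def by blast
    interpret fstQ: poset_isom fst ?Q L using fstQ by unfold_locales
    let ?A = "base - {greatest_face}" and ?B = "B - {greatest_face}"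
    have down: "lf {} ` ?A \<subseteq> Field ?Q"
    proof -
      have "(lf {} G, lf {} F) \<in> cover" if "G \<in> ?A" for G
        using lf_flag_le_iff[OF base admA _ F(3)] in_flag_below[OF base] that F_def by blast
      then show ?thesis unfolding Field_below[OF cover_po] lfF by blast
    qed
    have img: "g ` lf {} ` ?A = lf {} ` ?B"
    proof -
      have gr: "greatest_face \<in> base" "greatest_face \<in> B" using greatest_face_in_flag base B by auto
      have d: "lf {} ` (E - {greatest_face}) = lf {} ` E - {lf {} greatest_face}" for E
        by (auto simp: lf_def)
      have "g ` (lf {} ` base - {lf {} greatest_face}) = g ` lf {} ` base - g ` {lf {} greatest_face}"
        using inj_on_image_set_diff[OF g.inj, of "lf {} ` base" "{lf {} greatest_face}"] sub(1) gr(1) by blast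
      then show ?thesis unfolding d using g(2) fixed[OF gr] by simp
    qed
    have "inv_into (Field ?Q) fst ` ?A = lf {} ` ?A"
      using fstQ.inv_image[OF down] by simp
    then have "(fst \<circ> (g \<circ> inv_into (Field ?Q) fst)) ` ?A = ?B"
      unfolding image_comp[symmetric] using img by simp
    moreover have "poset_map (fst \<circ> (g \<circ> inv_into (Field ?Q) fst)) L L"
      using poset_map_comp[OF poset_map_comp[OF poset_map_inv[OF fstQ] gQ] fstQ] by (simp add: comp_assoc)
    moreover have "?A \<in> flags L" unfolding L_def
      using facet_flagI[OF N F(1,2) Lpoly base F(3)] .
    moreover have "?B = adj L 0 ?A"
      unfolding L_def B_def using facet_adj(1)[OF N F(1,2) Lpoly base F(3)] n_pos by simp
    moreover have "?A \<subseteq> Field L" "?B \<subseteq> Field L"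
      using L.flag_Field[OF \<open>?A \<in> flags L\<close>] L.flag_Field[OF L.adj_flag[OF \<open>?A \<in> flags L\<close>, of 0]]
        \<open>?B = adj L 0 ?A\<close> n_pos by auto
    ultimately have "\<exists>f. poset_map f L L \<and> f ` ?A = ?B" "?A \<subseteq> Field L" "?B \<subseteq> Field L" "?B = adj L 0 ?A"
      by blast+
    then have "flag_orbit L ?A = flag_orbit L (adj L 0 ?A)"
      using flag_orbit_eq_iff[of ?A L ?B] by simp
    then show False using L.adj_orbit_neq[OF \<open>?A \<in> flags L\<close>, of 0] n_pos by simp
  qed
  have proj: "fst ` D \<in> flags P" if "D \<in> flags cover" for D
    using that cover_flags_projection by blast
  have orb1: "flag_orbit cover D = flag_orbit cover E"
    if D: "D \<in> flags cover" and E: "E \<in> flags cover" and eq: "flag_orbit P (fst ` D) = flag_orbit P (fst ` E)" for D E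
  proof -
    from D obtain A x where A: "A \<in> flags P" "adm x (fct A)" and DA: "D = lf x ` A"
      by (elim lift_flagE) (rule that)
    from E obtain B y where B: "B \<in> flags P" "adm y (fct B)" and EB: "E = lf y ` B"
      by (elim lift_flagE) (rule that)
    obtain f where "poset_map f P P" "f ` A = B"
      using C.orbit_map[OF A(1) B(1)] eq DA EB by auto
    from lift_orbit[OF A B this] have "\<exists>g. poset_map g cover cover \<and> g ` D = E" unfolding DA EB .
    moreover have "D \<subseteq> Field cover" "E \<subseteq> Field cover" using cover.flag_Field D E by blast+
    ultimately show ?thesis using flag_orbit_eq_iff[of D cover E] by simp
  qed
  \<comment> \<open>If flags over different orbits of \<open>P\<close> were equivalent in the cover,
    then all its flags would be, since every flag of \<open>P\<close> lies in one of the two orbits;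
    this contradicts \<open>distinct\<close>.\<close>
  have orb2: "flag_orbit P (fst ` D) = flag_orbit P (fst ` E)"
    if D: "D \<in> flags cover" and E: "E \<in> flags cover" and eq: "flag_orbit cover D = flag_orbit cover E" for D E
  proof (rule ccontr)
    assume neq: "flag_orbit P (fst ` D) \<noteq> flag_orbit P (fst ` E)"
    have "flag_orbit cover G = flag_orbit cover D" if G: "G \<in> flags cover" for G
      using C.orbit_cases[OF proj[OF D] proj[OF E] proj[OF G] neq] orb1[OF G D] orb1[OF G E] eq by auto
    then show False using distinct flA flB by metis
  qed
  have "card (flag_orbit cover ` flags cover) = card ((\<lambda>D. flag_orbit P (fst ` D)) ` flags cover)"
    by (rule card_image_eqI) (use orb1 orb2 in blast)
  also have "(\<lambda>D. flag_orbit P (fst ` D)) ` flags cover = flag_orbit P ` flags P"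
    unfolding cover_flags_projection[symmetric] image_image ..
  finally have "card (flag_orbit cover ` flags cover) = 2" using C.two_orbits by simp
  moreover have "flag_orbit cover D \<noteq> flag_orbit cover E" if "adjacent_flags cover D E" for D E
    using C.adjacent_orbits[OF cover_adjacent_projection[OF that]] orb2[of D E] that
    unfolding adjacent_flags_def by blast
  ultimately show ?thesis using cover_polytope unfolding chiral_polytope_def by blast
qed

lemma cover_facets:
  assumes "\<forall>L\<in>facets N P. poset_iso L K"
  shows "\<forall>L\<in>facets N cover. poset_iso L K"
proof
  fix L assume "L \<in> facets N cover"
  then obtain p where p: "p \<in> cover_faces" "cover.rk p = int n" "L = Restr cover {s. (s, p) \<in> cover}"
    unfolding facets_def cover_Field using N by auto
  obtain A x where A: "A \<in> flags P" "adm x (fct A)" "fst p \<in> A" "p = lf x (fst p)"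
    using p(1) by (elim cover_facesE) (rule that)
  have F: "fst p \<in> fcts" using cover_rank p cover_faces_fst unfolding fcts_def by simp
  then have "fct A = fst p" "p = (fst p, x)" using fct_eqI A(1,3,4) upr_fct by (auto simp: lf_def)
  then have "poset_map fst L (Restr P {G. (G, fst p) \<in> P})"
    using cover_facet_map[OF A(2)] p(3) by metis
  moreover have "Restr P {G. (G, fst p) \<in> P} \<in> facets N P"
    using F N unfolding facets_def fcts_def by auto
  then obtain h where "poset_map h (Restr P {G. (G, fst p) \<in> P}) K"
    using assms unfolding poset_iso_map by blast
  ultimately show "poset_iso L K" unfolding poset_iso_map using poset_map_comp by blast
qed

subsection \<open>The cover is proper\<close>

text \<open>Rotating around a face of rank \<open>n - 2\<close> of the finite polytope returns to a facet for the
  first time after crossing some ridge exactly once.\<close>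

lemma card_cover_faces: "card (Field P) < card cover_faces"
proof -
  \<comment> \<open>One turn crosses the ridge into the next facet and then changes the ridge, which
    keeps the face of rank \<open>n - 2\<close>; the ridge just crossed is recorded in the
    chain.\<close>
  define turn where "turn = (\<lambda>(A, x). (adj P (n - 1) (adj P n A), sd x {rdg A}))"
  define s where "s = (\<lambda>k. (turn ^^ k) (base, {}))"
  define a where "a k = fst (s k)" for k
  define x where "x k = snd (s k)" for k
  have s_Suc: "s (Suc k) = (adj P (n - 1) (adj P n (a k)), sd (x k) {rdg (a k)})" for k
    unfolding s_def a_def x_def by (simp add: turn_def split_beta)
  have a_Suc: "a (Suc k) = adj P (n - 1) (adj P n (a k))" and x_Suc: "x (Suc k) = sd (x k) {rdg (a k)}" for k
    using s_Suc[of k] unfolding a_def[of "Suc k"] x_def[of "Suc k"] by auto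
  have nN: "n < N" "n - 1 < N" using N by auto
  have flag: "a k \<in> flags P" for k
  proof (induction k)
    case 0
    then show ?case using base unfolding a_def s_def by simp
  next
    case (Suc k)
    then show ?case unfolding a_Suc using adj_flag nN by simp
  qed
  have flag': "adj P n (a k) \<in> flags P" for k using adj_flag[OF flag nN(1)] .
  have fct_Suc: "fct (a (Suc k)) = fct (adj P n (a k))" for k
    unfolding a_Suc using adj_face[OF flag' nN(2), of "int n"] N n_pos by auto
  have rdg_Suc: "rdg (a (Suc k)) \<noteq> rdg (a k)" for k
  proof -
    have "rdg (adj P n (a k)) = rdg (a k)" using adj_face[OF flag nN(1), of "int n - 1"] N by simp
    then show ?thesis
      unfolding a_Suc using adj_face_neq[OF flag' nN(2), of k] n_pos by (simp add: of_nat_diff)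
  qed
  have adm: "adm (x k) (fct (a k))" for k
  proof (induction k)
    case 0
    then show ?case using adm_base unfolding a_def x_def s_def by simp
  next
    case (Suc k)
    then show ?case unfolding fct_Suc x_Suc using adm_cross[OF flag] by blast
  qed
  have ends: "{F \<in> fcts. (rdg (a k), F) \<in> P} = {fct (a k), fct (a (Suc k))}" "fct (a (Suc k)) \<noteq> fct (a k)" for k
    using ridge_facets[OF flag] unfolding fct_Suc by auto
  have "\<exists>j i. i < j \<and> fct (a i) = fct (a j)"
  proof (rule ccontr)
    assume no: "\<not> ?thesis"
    have "inj (\<lambda>k. fct (a k))"
    proof (rule injI)
      fix u v assume "fct (a u) = fct (a v)"
      then show "u = v" using no by (metis linorder_neqE_nat)
    qed
    moreover have "range (\<lambda>k. fct (a k)) \<subseteq> Field P" using fct_fcts[OF flag] unfolding fcts_def by auto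
    then have "finite (range (\<lambda>k. fct (a k)))" using finite_subset fin by blast
    ultimately show False using finite_imageD infinite_UNIV_nat by blast
  qed
  \<comment> \<open>\<open>j\<close> is the first time a facet is met again, so the facets before
    time \<open>j\<close> are pairwise distinct.\<close>
  then obtain j where j: "\<exists>i<j. fct (a i) = fct (a j)" "\<And>k. k < j \<Longrightarrow> \<not> (\<exists>i<k. fct (a i) = fct (a k))"
    using exists_least_iff[of "\<lambda>j. \<exists>i<j. fct (a i) = fct (a j)"] by blast
  then obtain i where i: "i < j" "fct (a i) = fct (a j)" by blast
  have distinct: "fct (a u) \<noteq> fct (a v)" if "u < v" "v < j" for u v
    using j(2)[OF that(2)] that(1) by blast
  \<comment> \<open>A ridge determines its two facets, so meeting the ridge of time \<open>i\<close>
    again before \<open>j\<close> is possible only at time \<open>i + 1\<close>; but consecutive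
    ridges differ.\<close>
  have once: "rdg (a k) \<noteq> rdg (a i)" if k: "i < k" "k < j" for k
  proof
    assume eq: "rdg (a k) = rdg (a i)"
    then have "fct (a k) \<in> {fct (a i), fct (a (Suc i))}" using ends(1)[of k] ends(1)[of i] by auto
    then have "k = Suc i" using distinct[OF k] distinct[of "Suc i" k] k by force
    then show False using eq rdg_Suc[of i] by simp
  qed
  \<comment> \<open>The ridge of time \<open>i\<close> enters the chain at that time and is not
    touched again before \<open>j\<close>, so the chains at \<open>i\<close> and \<open>j\<close>
    differ although they end at the same facet. This facet has two lifts.\<close>
  have "Suc i \<le> j" using i(1) by simp
  then have "rdg (a i) \<in> x j \<longleftrightarrow> rdg (a i) \<in> x (Suc i)"
  proof (induction rule: inc_induct[of "Suc i" j "\<lambda>k. (rdg (a i) \<in> x j) = (rdg (a i) \<in> x k)"])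
    case base
    then show ?case by simp
  next
    case (step k)
    then show ?case using once[of k] unfolding x_Suc sd_def by auto
  qed
  then have neq: "x i \<noteq> x j" unfolding x_Suc sd_def by auto
  have in_faces: "(fct (a k), x k) \<in> cover_faces" for k
    using lf_in[OF adm[of k], of "fct (a k)"] leq_refl upr_fct[OF fct_fcts[OF flag[of k]]] fct_fcts[OF flag[of k]]
    unfolding fcts_def lf_def by auto
  have fst_image: "fst ` cover_faces = Field P"
  proof
    show "fst ` cover_faces \<subseteq> Field P" using cover_faces_fst by blast
    show "Field P \<subseteq> fst ` cover_faces"
    proof
      fix G assume "G \<in> Field P"
      then obtain A where A: "A \<in> flags P" "G \<in> A" using in_flag by blast
      obtain y where "adm y (fct A)" using adm_ex[OF A(1)] by blast
      from lf_in[OF this in_flag_below[OF A]] show "G \<in> fst ` cover_faces" by (metis fst_lf imageI)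
    qed
  qed
  have "\<not> inj_on fst cover_faces"
    using in_faces[of i] in_faces[of j] i(2) neq unfolding inj_on_def by force
  then have "card (fst ` cover_faces) \<noteq> card cover_faces"
    using eq_card_imp_inj_on[OF cover_faces_finite] by blast
  moreover have "card (fst ` cover_faces) \<le> card cover_faces"
    by (rule card_image_le[OF cover_faces_finite])
  ultimately show ?thesis unfolding fst_image by simp
qed

end

theorem universal_chiral_infinite:
  assumes K: "chiral_polytope n K" and n: "1 \<le> n" and P: "universal_chiral n K P"
  shows "infinite (Field P)"
proof
  assume fin: "finite (Field P)"
  have Pch: "chiral_polytope (n + 1) P" and Pf: "\<forall>L\<in>facets (n + 1) P. poset_iso L K"
    and univ: "\<And>R :: nat rel. chiral_polytope (n + 1) R \<Longrightarrow> \<forall>L\<in>facets (n + 1) R. poset_iso L K \<Longrightarrow> covers P R"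
    using P unfolding universal_chiral_def by auto
  interpret C: ridge_cover "n + 1" P n
    using Pch n fin unfolding chiral_polytope_def by unfold_locales auto
  \<comment> \<open>Universality is stated for relations on \<open>nat\<close>, so the finite cover
    is relabelled by an injection. A covering is onto the faces, and counting them gives the
    contradiction.\<close>
  obtain e :: "_ \<Rightarrow> nat" where e: "inj_on e C.cover_faces"
    using finite_imp_inj_to_nat_seg[OF C.cover_faces_finite] by blast
  define R where "R = (\<lambda>(p, q). (e p, e q)) ` C.cover"
  have RI: "(e p, e q) \<in> R" if "(p, q) \<in> C.cover" for p q using that unfolding R_def by force
  have RE: "\<exists>p q. u = e p \<and> v = e q \<and> (p, q) \<in> C.cover" if "(u, v) \<in> R" for u v
    using that unfolding R_def by auto
  have RF: "Field R = e ` C.cover_faces"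
  proof
    show "Field R \<subseteq> e ` C.cover_faces"
    proof
      fix u assume "u \<in> Field R"
      then obtain v where "(u, v) \<in> R \<or> (v, u) \<in> R" unfolding Field_def by blast
      then show "u \<in> e ` C.cover_faces" using RE C.cover_leD(1,2) by blast
    qed
    show "e ` C.cover_faces \<subseteq> Field R"
      using RI[OF C.cover_refl] by (auto intro: FieldI1)
  qed
  have eR: "poset_map e C.cover R"
    unfolding poset_map_def C.cover_Field RF
  proof (intro conjI ballI)
    show "bij_betw e C.cover_faces (e ` C.cover_faces)" using e unfolding bij_betw_def by blast
    fix p q assume pq: "p \<in> C.cover_faces" "q \<in> C.cover_faces"
    show "(p, q) \<in> C.cover \<longleftrightarrow> (e p, e q) \<in> R"
    proof
      assume "(e p, e q) \<in> R"
      then obtain p' q' where "e p = e p'" "e q = e q'" "(p', q') \<in> C.cover" using RE by blast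
      then show "(p, q) \<in> C.cover"
        using inj_onD[OF e] pq C.cover_leD(1,2) by metis
    qed (rule RI)
  qed
  interpret e: poset_isom e C.cover R using eR by unfold_locales
  have Rch: "chiral_polytope (n + 1) R"
    using poset_isom_chiral[OF eR C.cover_chiral[OF Pch K Pf]] .
  interpret R: polytope_poset "n + 1" R using Rch unfolding chiral_polytope_def by unfold_locales blast
  have "\<forall>L\<in>facets (n + 1) R. poset_iso L K"
  proof
    fix L assume "L \<in> facets (n + 1) R"
    then obtain u where u: "u \<in> Field R" "face_rank R u = int (n + 1) - 1" "L = Restr R {v. (v, u) \<in> R}"
      unfolding facets_def by blast
    then obtain p where p: "p \<in> Field C.cover" "u = e p" using RF C.cover_Field by auto
    have "C.cover.rk p = int (n + 1) - 1" using e.face_rank_map[OF p(1)] p(2) u(2) by simp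
    then have "Restr C.cover {s. (s, p) \<in> C.cover} \<in> facets (n + 1) C.cover"
      using p(1) unfolding facets_def by blast
    then obtain h where h: "poset_map h (Restr C.cover {s. (s, p) \<in> C.cover}) K"
      using C.cover_facets[OF Pf] unfolding poset_iso_map by blast
    have "poset_map e (Restr C.cover {s. (s, p) \<in> C.cover}) L"
      using poset_map_below[OF eR C.cover_po R.po p(1)] u(3) p(2) by simp
    from poset_map_comp[OF poset_map_inv[OF this] h] show "poset_iso L K"
      unfolding poset_iso_map by blast
  qed
  from univ[OF Rch this] obtain g where "g ` Field P = Field R" unfolding covers_def by blast
  then have "card (Field R) \<le> card (Field P)" using card_image_le[OF fin, of g] by simp
  moreover have "card (Field R) = card C.cover_faces" unfolding RF by (rule card_image[OF e])
  ultimately show False using C.card_cover_faces by simp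
qed

section \<open>The group of words\<close>

definition inv_word :: "word \<Rightarrow> word" where
  "inv_word w = rev (map (\<lambda>(i, b). (i, \<not> b)) w)"

lemma inv_word_simps [simp]:
  "inv_word [] = []" "inv_word ((i, b) # w) = inv_word w @ [(i, \<not> b)]"
  "inv_word (u @ v) = inv_word v @ inv_word u" "inv_word (inv_word w) = w"
  by (auto simp: inv_word_def rev_map o_def case_prod_unfold)

lemma W_words_Nil [simp]: "[] \<in> W_words m"
  and W_words_Cons [simp]: "(i, b) # w \<in> W_words m \<longleftrightarrow> 1 \<le> i \<and> i < m \<and> w \<in> W_words m"
  and W_words_append [simp]: "u @ v \<in> W_words m \<longleftrightarrow> u \<in> W_words m \<and> v \<in> W_words m"
  unfolding W_words_def by auto

lemma W_words_inv [simp]: "inv_word w \<in> W_words m \<longleftrightarrow> w \<in> W_words m"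
  by (induction w) auto

lemma W_words_map [simp]: "map (\<lambda>k. (k, True)) ks \<in> W_words m \<longleftrightarrow> (\<forall>k\<in>set ks. 1 \<le> k \<and> k < m)"
  by (induction ks) auto

lemma W_words_mono: "w \<in> W_words m \<Longrightarrow> m \<le> m' \<Longrightarrow> w \<in> W_words m'"
  unfolding W_words_def by auto

lemma W_relatorsE [consumes 1, case_names cancel square]:
  assumes "r \<in> W_relators m"
  obtains i b where "1 \<le> i" "i < m" "r = [(i, b), (i, \<not> b)]"
  | i j where "1 \<le> i" "i < j" "j < m"
    "r = map (\<lambda>k. (k, True)) [i..<Suc j] @ map (\<lambda>k. (k, True)) [i..<Suc j]"
  using assms unfolding W_relators_def by fastforce

lemma W_relator_cancel: "1 \<le> i \<Longrightarrow> i < m \<Longrightarrow> [(i, b), (i, \<not> b)] \<in> W_relators m"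
  unfolding W_relators_def by auto

lemma W_relator_square: "1 \<le> i \<Longrightarrow> i < j \<Longrightarrow> j < m \<Longrightarrow>
    map (\<lambda>k. (k, True)) [i..<Suc j] @ map (\<lambda>k. (k, True)) [i..<Suc j] \<in> W_relators m"
  unfolding W_relators_def map_append[symmetric] by blast

lemma W_relators_words: "r \<in> W_relators m \<Longrightarrow> r \<in> W_words m"
  by (elim W_relatorsE) auto

lemma W_relators_mono: "r \<in> W_relators m \<Longrightarrow> m \<le> m' \<Longrightarrow> r \<in> W_relators m'"
  by (elim W_relatorsE) (auto simp del: upt_Suc intro: W_relator_cancel W_relator_square)

lemma W_eq_words: "(u, v) \<in> W_eq m \<Longrightarrow> u \<in> W_words m \<and> v \<in> W_words m"
  unfolding W_eq_def by blast

lemma W_eq_refl: "w \<in> W_words m \<Longrightarrow> (w, w) \<in> W_eq m"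
  unfolding W_eq_def by blast

lemma W_eq_sym: "(u, v) \<in> W_eq m \<Longrightarrow> (v, u) \<in> W_eq m"
  unfolding W_eq_def using symD[OF sym_rtrancl[of "W_step m \<union> (W_step m)\<inverse>"]]
  by (auto simp: sym_def)

lemma W_eq_trans: "(u, v) \<in> W_eq m \<Longrightarrow> (v, w) \<in> W_eq m \<Longrightarrow> (u, w) \<in> W_eq m"
  unfolding W_eq_def by auto

lemma W_eq_step: "u \<in> W_words m \<Longrightarrow> r \<in> W_relators m \<Longrightarrow> v \<in> W_words m \<Longrightarrow> (u @ r @ v, u @ v) \<in> W_eq m"
  unfolding W_eq_def W_step_def using W_relators_words[of r m] by auto

lemma W_eq_relator: "r \<in> W_relators m \<Longrightarrow> (r, []) \<in> W_eq m"
  using W_eq_step[of "[]" m r "[]"] by simp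

lemma W_eq_invariant:
  assumes "(u, v) \<in> W_eq m"
    and step: "\<And>u r v. u \<in> W_words m \<Longrightarrow> r \<in> W_relators m \<Longrightarrow> v \<in> W_words m \<Longrightarrow> f (u @ r @ v) = f (u @ v)"
  shows "f u = f v"
proof -
  have "(u, v) \<in> (W_step m \<union> (W_step m)\<inverse>)\<^sup>*" using assms(1) unfolding W_eq_def by blast
  then show ?thesis
    by (induction rule: rtrancl_induct) (auto simp: W_step_def step)
qed

lemma W_eq_map:
  assumes "(u, v) \<in> W_eq m"
    and words: "\<And>w. w \<in> W_words m \<Longrightarrow> f w \<in> W_words m'"
    and step: "\<And>u r v. u \<in> W_words m \<Longrightarrow> r \<in> W_relators m \<Longrightarrow> v \<in> W_words m \<Longrightarrow>
      (f (u @ r @ v), f (u @ v)) \<in> W_eq m'"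
  shows "(f u, f v) \<in> W_eq m'"
proof -
  have "(u, v) \<in> (W_step m \<union> (W_step m)\<inverse>)\<^sup>*" and u: "u \<in> W_words m"
    using assms(1) unfolding W_eq_def by blast+
  then show ?thesis
  proof (induction rule: rtrancl_induct)
    case base
    then show ?case using W_eq_refl words by blast
  next
    case (step v w)
    then have "(f v, f w) \<in> W_eq m'"
      using assms(3) W_eq_sym unfolding W_step_def by blast
    then show ?case using step.IH u W_eq_trans by blast
  qed
qed

lemma W_eq_append:
  assumes "(u, u') \<in> W_eq m" "(v, v') \<in> W_eq m"
  shows "(u @ v, u' @ v') \<in> W_eq m"
proof -
  have w: "u \<in> W_words m" "u' \<in> W_words m" "v \<in> W_words m" using assms W_eq_words by blast+
  have "(u @ v, u' @ v) \<in> W_eq m"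
    using assms(1) by (rule W_eq_map) (use w W_eq_step[of _ m _ "_ @ v"] in auto)
  moreover have "(u' @ v, u' @ v') \<in> W_eq m"
    using assms(2) by (rule W_eq_map) (use w W_eq_step[of "u' @ _" m] in auto)
  ultimately show ?thesis by (rule W_eq_trans)
qed

lemma W_eq_cancel: "w \<in> W_words m \<Longrightarrow> (w @ inv_word w, []) \<in> W_eq m"
proof (induction w)
  case Nil
  then show ?case by (simp add: W_eq_refl)
next
  case (Cons a w)
  obtain i b where a: "a = (i, b)" by fastforce
  then have w: "w \<in> W_words m" "1 \<le> i" "i < m" using Cons.prems by auto
  have "([(i, b)] @ (w @ inv_word w) @ [(i, \<not> b)], [(i, b)] @ [] @ [(i, \<not> b)]) \<in> W_eq m"
    using w by (intro W_eq_append Cons.IH W_eq_refl) auto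
  also have "([(i, b)] @ [] @ [(i, \<not> b)], []) \<in> W_eq m"
    using W_eq_relator[OF W_relator_cancel[OF w(2,3)]] by simp
  finally (W_eq_trans) show ?case using a by simp
qed

lemma W_eq_mono: "(u, v) \<in> W_eq m \<Longrightarrow> m \<le> m' \<Longrightarrow> (u, v) \<in> W_eq m'"
  by (rule W_eq_map[of u v m "\<lambda>x. x" m'])
    (auto intro: W_words_mono W_eq_step[of _ m'] W_relators_mono)

lemma W_class_self: "w \<in> W_words m \<Longrightarrow> w \<in> W_class m w"
  unfolding W_class_def using W_eq_refl by blast

lemma W_class_eq_iff:
  assumes "u \<in> W_words m"
  shows "W_class m u = W_class m v \<longleftrightarrow> (u, v) \<in> W_eq m"
proof
  assume "W_class m u = W_class m v"
  then have "u \<in> W_class m v" using W_class_self[OF assms] by simp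
  then show "(u, v) \<in> W_eq m" unfolding W_class_def using W_eq_sym by blast
next
  assume "(u, v) \<in> W_eq m"
  then show "W_class m u = W_class m v"
    unfolding W_class_def using W_eq_sym W_eq_trans by blast
qed

lemma W_class_eqI: "(u, v) \<in> W_eq m \<Longrightarrow> W_class m u = W_class m v"
  using W_class_eq_iff W_eq_words by blast

lemma W_plus_carrier: "carrier (W_plus m) = W_class m ` W_words m"
  unfolding W_plus_def quotient_def W_class_def by auto

lemma W_plus_one: "\<one>\<^bsub>W_plus m\<^esub> = W_class m []"
  unfolding W_plus_def by simp

lemma W_plus_mult:
  assumes "u \<in> W_words m" "v \<in> W_words m"
  shows "W_class m u \<otimes>\<^bsub>W_plus m\<^esub> W_class m v = W_class m (u @ v)"
proof -
  have "W_class m (u' @ v') = W_class m (u @ v)" if "u' \<in> W_class m u" "v' \<in> W_class m v" for u' v'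
    using that W_eq_append[of u u' m v v'] unfolding W_class_def by (intro W_class_eqI[symmetric, unfolded W_class_def]) auto
  then have "(\<Union>u'\<in>W_class m u. \<Union>v'\<in>W_class m v. W_class m (u' @ v')) =
    (\<Union>u'\<in>W_class m u. \<Union>v'\<in>W_class m v. W_class m (u @ v))" by simp
  also have "\<dots> = W_class m (u @ v)"
    using W_class_self[OF assms(1)] W_class_self[OF assms(2)] by (metis UN_constant empty_iff)
  finally have "(\<Union>u'\<in>W_class m u. \<Union>v'\<in>W_class m v. W_class m (u' @ v')) = W_class m (u @ v)" .
  then show ?thesis unfolding W_plus_def by simp
qed

lemma W_class_in: "w \<in> W_words m \<Longrightarrow> W_class m w \<in> carrier (W_plus m)"
  unfolding W_plus_carrier by blast

lemma group_W_plus: "group (W_plus m)"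
proof (rule groupI)
  fix x y z assume xyz: "x \<in> carrier (W_plus m)" "y \<in> carrier (W_plus m)" "z \<in> carrier (W_plus m)"
  then obtain u v w where "u \<in> W_words m" "v \<in> W_words m" "w \<in> W_words m"
    "x = W_class m u" "y = W_class m v" "z = W_class m w"
    unfolding W_plus_carrier by blast
  then show "(x \<otimes>\<^bsub>W_plus m\<^esub> y) \<otimes>\<^bsub>W_plus m\<^esub> z = x \<otimes>\<^bsub>W_plus m\<^esub> (y \<otimes>\<^bsub>W_plus m\<^esub> z)"
    by (simp add: W_plus_mult)
next
  fix x y assume "x \<in> carrier (W_plus m)" "y \<in> carrier (W_plus m)"
  then show "x \<otimes>\<^bsub>W_plus m\<^esub> y \<in> carrier (W_plus m)"
    unfolding W_plus_carrier by (auto simp: W_plus_mult)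
next
  show "\<one>\<^bsub>W_plus m\<^esub> \<in> carrier (W_plus m)" unfolding W_plus_one by (simp add: W_class_in)
next
  fix x assume "x \<in> carrier (W_plus m)"
  then obtain u where u: "u \<in> W_words m" "x = W_class m u" unfolding W_plus_carrier by blast
  then show "\<one>\<^bsub>W_plus m\<^esub> \<otimes>\<^bsub>W_plus m\<^esub> x = x" unfolding W_plus_one by (simp add: W_plus_mult)
  have "W_class m (inv_word u) \<otimes>\<^bsub>W_plus m\<^esub> x = \<one>\<^bsub>W_plus m\<^esub>"
    using u W_class_eqI[OF W_eq_cancel[of "inv_word u" m]] by (simp add: W_plus_mult W_plus_one)
  then show "\<exists>y\<in>carrier (W_plus m). y \<otimes>\<^bsub>W_plus m\<^esub> x = \<one>\<^bsub>W_plus m\<^esub>"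
    using u by (intro bexI[of _ "W_class m (inv_word u)"]) (auto simp: W_class_in)
qed

lemma W_plus_inv: "w \<in> W_words m \<Longrightarrow> inv\<^bsub>W_plus m\<^esub> (W_class m w) = W_class m (inv_word w)"
  using W_eq_cancel[of "inv_word w" m] W_class_eqI
  by (intro group.inv_equality[OF group_W_plus]) (auto simp: W_plus_mult W_plus_one W_class_in)

text \<open>A normal subgroup of \<open>W_plus m\<close> described by its preimage in the words.
  Closure under \<open>W_eq\<close> makes the set a union of classes, so that membership can be
  tested on any representative.\<close>

definition normal_words :: "nat \<Rightarrow> word set \<Rightarrow> bool" where
  "normal_words m S \<longleftrightarrow> S \<subseteq> W_words m \<and> [] \<in> S \<and> (\<forall>u\<in>S. \<forall>v\<in>S. u @ v \<in> S) \<and> (\<forall>u\<in>S. inv_word u \<in> S) \<and>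
     (\<forall>g\<in>W_words m. \<forall>u\<in>S. g @ u @ inv_word g \<in> S) \<and>
     (\<forall>u v. (u, v) \<in> W_eq m \<and> u \<in> S \<longrightarrow> v \<in> S)"

lemma normal_wordsD:
  assumes "normal_words m S"
  shows "S \<subseteq> W_words m" "[] \<in> S" "u \<in> S \<Longrightarrow> v \<in> S \<Longrightarrow> u @ v \<in> S" "u \<in> S \<Longrightarrow> inv_word u \<in> S"
    "g \<in> W_words m \<Longrightarrow> u \<in> S \<Longrightarrow> g @ u @ inv_word g \<in> S"
    "(u, v) \<in> W_eq m \<Longrightarrow> u \<in> S \<Longrightarrow> v \<in> S"
  using assms unfolding normal_words_def by blast+

lemma normal_words_class:
  assumes S: "normal_words m S"
  shows "W_class m ` S \<lhd> W_plus m"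
proof -
  interpret group "W_plus m" by (rule group_W_plus)
  note D = normal_wordsD[OF S]
  have W: "u \<in> W_words m" if "u \<in> S" for u using D(1) that by blast
  have "subgroup (W_class m ` S) (W_plus m)"
  proof (rule subgroupI)
    show "W_class m ` S \<subseteq> carrier (W_plus m)" using W W_class_in by blast
    show "W_class m ` S \<noteq> {}" using D(2) by blast
    show "inv\<^bsub>W_plus m\<^esub> x \<in> W_class m ` S" if "x \<in> W_class m ` S" for x
      using that D(4) W W_plus_inv by force
    show "x \<otimes>\<^bsub>W_plus m\<^esub> y \<in> W_class m ` S" if "x \<in> W_class m ` S" "y \<in> W_class m ` S" for x y
      using that D(3) W W_plus_mult by force
  qed
  moreover have "x \<otimes>\<^bsub>W_plus m\<^esub> h \<otimes>\<^bsub>W_plus m\<^esub> inv\<^bsub>W_plus m\<^esub> x \<in> W_class m ` S"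
    if x: "x \<in> carrier (W_plus m)" and h: "h \<in> W_class m ` S" for x h
  proof -
    obtain g u where g: "g \<in> W_words m" "x = W_class m g" and u: "u \<in> S" "h = W_class m u"
      using x h unfolding W_plus_carrier by blast
    then have "x \<otimes>\<^bsub>W_plus m\<^esub> h \<otimes>\<^bsub>W_plus m\<^esub> inv\<^bsub>W_plus m\<^esub> x = W_class m (g @ u @ inv_word g)"
      using W by (simp add: W_plus_inv W_plus_mult)
    then show ?thesis using D(5) g(1) u(1) by auto
  qed
  ultimately show ?thesis unfolding normal_inv_iff by blast
qed

lemma normal_words_Int: "normal_words m S \<Longrightarrow> normal_words m T \<Longrightarrow> normal_words m (S \<inter> T)"
  unfolding normal_words_def by blast

section \<open>Words acting on flags\<close>

text \<open>A letter changes faces of the flag instead of applying an automorphism. The resulting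
  action of words, read from the left, exists in every polytope, whatever its symmetry, and commutes
  with all automorphisms.\<close>

definition rot_step :: "'a rel \<Rightarrow> nat \<times> bool \<Rightarrow> 'a set \<Rightarrow> 'a set" where
  "rot_step P l A = (case l of (i, b) \<Rightarrow>
     if b then adj P i (adj P (i - 1) A) else adj P (i - 1) (adj P i A))"

definition act :: "'a rel \<Rightarrow> word \<Rightarrow> 'a set \<Rightarrow> 'a set" where
  "act P w A = fold (rot_step P) w A"

lemma act_simps [simp]:
  "act P [] A = A" "act P (l # w) A = act P w (rot_step P l A)"
  "act P (u @ v) A = act P v (act P u A)"
  by (auto simp: act_def)

context polytope_poset
begin

lemma rot_step_flag: "A \<in> flags P \<Longrightarrow> 1 \<le> i \<Longrightarrow> i < n \<Longrightarrow> rot_step P (i, b) A \<in> flags P"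
  unfolding rot_step_def using adj_flag by simp

lemma act_flag: "w \<in> W_words n \<Longrightarrow> A \<in> flags P \<Longrightarrow> act P w A \<in> flags P"
  by (induction w arbitrary: A) (auto simp: rot_step_flag)

lemma rot_step_cancel:
  "A \<in> flags P \<Longrightarrow> 1 \<le> i \<Longrightarrow> i < n \<Longrightarrow> rot_step P (i, \<not> b) (rot_step P (i, b) A) = A"
  unfolding rot_step_def using adj_flag adj_adj by simp

text \<open>The product telescopes: each further letter first changes the \<open>j\<close>-face back
  and then changes the face of rank \<open>j + 1\<close>.\<close>

lemma act_segment:
  assumes "A \<in> flags P" "1 \<le> i" "i \<le> j" "j < n"
  shows "act P (map (\<lambda>k. (k, True)) [i..<Suc j]) A = adj P j (adj P (i - 1) A)"
  using assms(3,4)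
proof (induction j rule: dec_induct)
  case base
  then show ?case by (simp add: rot_step_def)
next
  case (step j)
  have B: "adj P (i - 1) A \<in> flags P" using adj_flag assms(1,2) step by auto
  have "act P (map (\<lambda>k. (k, True)) [i..<Suc (Suc j)]) A = rot_step P (Suc j, True) (adj P j (adj P (i - 1) A))"
    using step by simp
  also have "\<dots> = adj P (Suc j) (adj P (i - 1) A)"
    unfolding rot_step_def using adj_adj[OF B, of j] step by simp
  finally show ?case .
qed

text \<open>By telescoping, a square relator changes the faces of ranks \<open>i - 1\<close> and
  \<open>j\<close> twice each. As \<open>i < j\<close>, these ranks differ by at least 2, and the
  changes commute and cancel.\<close>

lemma act_relator:
  assumes "r \<in> W_relators n" "A \<in> flags P"
  shows "act P r A = A"
  using assms(1)
proof (cases rule: W_relatorsE)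
  case (cancel i b)
  then show ?thesis using rot_step_cancel[OF assms(2)] by simp
next
  case (square i j)
  have B: "adj P (i - 1) A \<in> flags P" and C: "adj P j A \<in> flags P"
    using adj_flag[OF assms(2)] square by auto
  have "act P r A = adj P j (adj P (i - 1) (adj P j (adj P (i - 1) A)))"
    using square act_segment[OF assms(2)] act_segment[OF adj_flag[OF B, of j]]
    by (simp del: upt_Suc)
  also have "adj P (i - 1) (adj P j (adj P (i - 1) A)) = adj P j (adj P (i - 1) (adj P (i - 1) A))"
    using adj_commute[OF B, of "i - 1" j] square by simp
  also have "adj P j \<dots> = A" using adj_adj[OF assms(2), of "i - 1"] adj_adj[OF assms(2), of j] square by simp
  finally show ?thesis .
qed

lemma act_W_eq:
  assumes "(u, v) \<in> W_eq n" "A \<in> flags P"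
  shows "act P u A = act P v A"
  using assms(1)
  by (rule W_eq_invariant) (simp add: act_relator act_flag[OF _ assms(2)])

lemma act_inv: "w \<in> W_words n \<Longrightarrow> A \<in> flags P \<Longrightarrow> act P (inv_word w) (act P w A) = A"
  using act_W_eq[OF W_eq_cancel] by fastforce

lemma act_map:
  assumes f: "poset_map f P Q" and w: "w \<in> W_words n" and A: "A \<in> flags P"
  shows "act Q w (f ` A) = f ` act P w A"
proof -
  interpret f: poset_isom f P Q using f by unfold_locales
  show ?thesis using w A
  proof (induction w arbitrary: A)
    case (Cons l w)
    obtain i b where l: "l = (i, b)" by fastforce
    then have i: "1 \<le> i" "i < n" and w: "w \<in> W_words n" using Cons.prems by auto
    have "rot_step Q l (f ` A) = f ` rot_step P l A"
      unfolding rot_step_def l using f.adj_map[OF poly] adj_flag Cons.prems(2) i by simp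
    then show ?case using Cons.IH[OF w rot_step_flag[OF Cons.prems(2) i]] l by simp
  qed simp
qed

definition stab :: "'a set \<Rightarrow> word set" where
  "stab A = {w \<in> W_words n. act P w A = A}"

lemma stab_map:
  assumes "poset_map f P P" "A \<in> flags P"
  shows "stab (f ` A) = stab A"
proof -
  interpret f: poset_isom f P P using assms(1) by unfold_locales
  have "act P w (f ` A) = f ` A \<longleftrightarrow> act P w A = A" if "w \<in> W_words n" for w
    using act_map[OF assms(1) that assms(2)] inj_on_image_eq_iff[OF f.inj, of "act P w A" A]
      f.flag_sub[OF act_flag[OF that assms(2)]] f.flag_sub[OF assms(2)] by simp
  then show ?thesis unfolding stab_def by blast
qed

text \<open>The formulas for the bar automorphism express conjugation by the change of the
  \<open>0\<close>-face. From \<open>\<sigma>\<^sub>3\<close> on, the letters change only faces of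
  rank at least 2 and commute with it.\<close>

lemma act_bar_letter:
  assumes "2 \<le> n" "A \<in> flags P" "1 \<le> i" "i < n"
  shows "act P (bar_letter (i, b)) A = adj P 0 (rot_step P (i, b) (adj P 0 A))"
proof -
  have fl: "adj P k B \<in> flags P" if "B \<in> flags P" "k < n" for B k using adj_flag that .
  have c: "adj P k (adj P 0 B) = adj P 0 (adj P k B)" if "2 \<le> k" "k < n" "B \<in> flags P" for k B
    using adj_commute[OF that(3), of k 0] that assms(1) by auto
  have aa: "adj P k (adj P k B) = B" if "B \<in> flags P" "k < n" for B k using adj_adj that .
  consider "i = 1" | "i = 2" | "3 \<le> i" using assms(3) by linarith
  then show ?thesis
  proof cases
    case 1
    then show ?thesis using assms by (cases b) (auto simp: bar_letter_def rot_step_def aa fl)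
  next
    case 2
    then show ?thesis using assms by (cases b) (auto simp: bar_letter_def rot_step_def aa fl c)
  next
    case 3
    then show ?thesis using assms by (cases b) (auto simp: bar_letter_def rot_step_def aa fl c)
  qed
qed

lemma act_bar:
  assumes "2 \<le> n" "w \<in> W_words n" "A \<in> flags P"
  shows "act P (bar_word w) A = adj P 0 (act P w (adj P 0 A))"
  using assms(2,3)
proof (induction w arbitrary: A)
  case Nil
  then show ?case using adj_adj assms(1) by (simp add: bar_word_def)
next
  case (Cons l w)
  obtain i b where l: "l = (i, b)" by fastforce
  then have i: "1 \<le> i" "i < n" and w: "w \<in> W_words n" using Cons.prems by auto
  have B: "rot_step P l (adj P 0 A) \<in> flags P"
    using rot_step_flag adj_flag Cons.prems(2) i assms(1) l by simp
  have "act P (bar_word (l # w)) A = act P (bar_word w) (adj P 0 (rot_step P l (adj P 0 A)))"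
    using act_bar_letter[OF assms(1) Cons.prems(2) i] l by (simp add: bar_word_def)
  also have "\<dots> = adj P 0 (act P w (rot_step P l (adj P 0 A)))"
    using Cons.IH[OF w adj_flag[OF B]] adj_adj[OF B] assms(1) by simp
  finally show ?case by simp
qed

end

context rotary_poset
begin

lemma rot_step_eq:
  assumes "A \<in> flags P" "1 \<le> i" "i < n"
  shows "\<exists>f. poset_map f P P \<and> f ` A = rot_step P (i, b) A"
  using rotary assms unfolding rot_step_def by simp

lemma act_orbit:
  assumes "w \<in> W_words n" "A \<in> flags P"
  shows "\<exists>f. poset_map f P P \<and> f ` A = act P w A"
  using assms
proof (induction w arbitrary: A)
  case Nil
  show ?case using poset_map_id[of P] by (auto intro: exI[of _ id])
next
  case (Cons l w)
  obtain i b where l: "l = (i, b)" by fastforce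
  then have i: "1 \<le> i" "i < n" and w: "w \<in> W_words n" using Cons.prems by auto
  obtain f where f: "poset_map f P P" "f ` A = rot_step P l A"
    using rot_step_eq[OF Cons.prems(2) i] l by blast
  obtain g where g: "poset_map g P P" "g ` rot_step P l A = act P w (rot_step P l A)"
    using Cons.IH[OF w] rot_step_flag[OF Cons.prems(2) i] l by blast
  have "(g \<circ> f) ` A = act P (l # w) A" unfolding image_comp[symmetric] f(2) g(2) by simp
  then show ?case using poset_map_comp[OF f(1) g(1)] by blast
qed

text \<open>A word leads from \<open>A\<close> to a flag in the same orbit, and flags in one orbit
  have the same stabilizer; hence the stabilizer is closed under conjugation.\<close>

lemma stab_normal:
  assumes A: "A \<in> flags P"
  shows "normal_words n (stab A)"
proof -
  have "inv_word u \<in> stab A" if "u \<in> stab A" for u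
    using act_inv[OF _ A, of u] that unfolding stab_def by simp
  moreover have "g @ u @ inv_word g \<in> stab A" if g: "g \<in> W_words n" and u: "u \<in> stab A" for g u
  proof -
    obtain f where f: "poset_map f P P" "f ` A = act P g A" using act_orbit[OF g A] by blast
    have "u \<in> stab (act P g A)" using stab_map[OF f(1) A] f(2) u by simp
    then show ?thesis using act_inv[OF g A] g unfolding stab_def by simp
  qed
  moreover have "v \<in> stab A" if "(u, v) \<in> W_eq n" "u \<in> stab A" for u v
    using act_W_eq[OF that(1) A] W_eq_words[OF that(1)] that(2) unfolding stab_def by simp
  moreover have "u @ v \<in> stab A" if "u \<in> stab A" "v \<in> stab A" for u v
    using that unfolding stab_def by simp
  moreover have "stab A \<subseteq> W_words n" "[] \<in> stab A" unfolding stab_def by auto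
  ultimately show ?thesis unfolding normal_words_def by blast
qed

end

section \<open>Kernels\<close>

lemma word_eval_simps [simp]:
  "word_eval G s [] = \<one>\<^bsub>G\<^esub>"
  "word_eval G s ((i, b) # w) = (if b then s i else inv\<^bsub>G\<^esub> (s i)) \<otimes>\<^bsub>G\<^esub> word_eval G s w"
  by (auto simp: word_eval_def)

lemma word_eval_closed:
  assumes "group G" "\<And>i. 1 \<le> i \<Longrightarrow> i < m \<Longrightarrow> s i \<in> carrier G" "w \<in> W_words m"
  shows "word_eval G s w \<in> carrier G"
proof -
  interpret group G by fact
  show ?thesis using assms(3)
  proof (induction w)
    case (Cons l w)
    then show ?case by (cases l) (use assms(2) in auto)
  qed simp
qed

lemma word_eval_subgroup:
  assumes "group G" "subgroup H G" "\<And>i. 1 \<le> i \<Longrightarrow> i < m \<Longrightarrow> s i \<in> H" "w \<in> W_words m"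
  shows "word_eval (G\<lparr>carrier := H\<rparr>) s w = word_eval G s w"
  using assms(4)
proof (induction w)
  case (Cons l w)
  then show ?case
    by (cases l) (use assms(3) group.m_inv_consistent[OF assms(1,2)] in auto)
qed simp

lemma word_eval_DirProd:
  assumes "group G" "group H" "\<And>i. 1 \<le> i \<Longrightarrow> i < m \<Longrightarrow> s i \<in> carrier G"
    "\<And>i. 1 \<le> i \<Longrightarrow> i < m \<Longrightarrow> t i \<in> carrier H" "w \<in> W_words m"
  shows "word_eval (G \<times>\<times> H) (\<lambda>i. (s i, t i)) w = (word_eval G s w, word_eval H t w)"
  using assms(5)
proof (induction w)
  case (Cons l w)
  then show ?case
    by (cases l) (use assms(3,4) inv_DirProd[OF assms(1,2)] in auto)
qed simp

context rotary_poset
begin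

lemma rot_generate: "A \<in> flags P \<Longrightarrow> subgroup (generate (aut_group P) {rot P A i |i. 1 \<le> i \<and> i < n}) (aut_group P)"
  using rot(1) by (intro group.generate_is_subgroup[OF group_aut_group]) auto

lemma rotation_group_group: "A \<in> flags P \<Longrightarrow> group (rotation_group n P A)"
  unfolding rotation_group_def
  by (rule group.subgroup_imp_group[OF group_aut_group rot_generate])

lemma rot_in_rotation_group: "1 \<le> i \<Longrightarrow> i < n \<Longrightarrow> rot P A i \<in> carrier (rotation_group n P A)"
  unfolding rotation_group_def by (auto intro: generate.incl)

text \<open>In a product \<open>g h\<close> the automorphism \<open>h\<close> is applied before
  \<open>g\<close>, whereas \<open>act\<close> begins with the first letter. The orders agree
  because \<open>act\<close> commutes with automorphisms: the image of \<open>act P w A\<close>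
  under \<open>g\<close> is \<open>act P w\<close> applied to the image of \<open>A\<close>.\<close>

lemma word_eval_image:
  assumes w: "w \<in> W_words n" and A: "A \<in> flags P"
  shows "word_eval (aut_group P) (rot P A) w ` A = act P w A"
  using w
proof (induction w)
  case Nil
  then show ?case using flag_Field[OF A] by (simp add: aut_group_one)
next
  case (Cons l w)
  interpret G: group "aut_group P" by (rule group_aut_group)
  obtain i b where l: "l = (i, b)" by fastforce
  then have i: "1 \<le> i" "i < n" and w: "w \<in> W_words n" using Cons.prems by auto
  define g where "g = (if b then rot P A i else inv\<^bsub>aut_group P\<^esub> rot P A i)"
  define h where "h = word_eval (aut_group P) (rot P A) w"
  have r: "rot P A i \<in> carrier (aut_group P)" "rot P A i ` A = adj P i (adj P (i - 1) A)"
    using rot[OF A i] .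
  have g: "g \<in> carrier (aut_group P)" unfolding g_def using r(1) by simp
  have h: "h \<in> carrier (aut_group P)" unfolding h_def
    by (rule word_eval_closed[OF group_aut_group _ w]) (rule rot(1)[OF A])
  have gm: "poset_map g P P" using g by (simp add: aut_group_carrier)
  interpret gm: poset_isom g P P using gm by unfold_locales
  have hA: "h ` A = act P w A" using Cons.IH[OF w] unfolding h_def .
  have gA: "g ` A = rot_step P l A"
  proof (cases b)
    case True
    then show ?thesis using r(2) unfolding g_def l rot_step_def by simp
  next
    case False
    let ?B = "rot_step P (i, False) A"
    have B: "?B \<in> flags P" using rot_step_flag[OF A i] .
    have rm: "poset_map (rot P A i) P P" using r(1) by (simp add: aut_group_carrier)
    interpret rm: poset_isom "rot P A i" P P using rm by unfold_locales
    have "rot P A i ` ?B = act P [(i, False)] (rot P A i ` A)"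
      using act_map[OF rm, of "[(i, False)]" A] i A by simp
    also have "rot P A i ` A = rot_step P (i, True) A" using r(2) by (simp add: rot_step_def)
    also have "act P [(i, False)] (rot_step P (i, True) A) = A"
      using rot_step_cancel[OF A i, of True] by simp
    finally have rB: "rot P A i ` ?B = A" .
    have "compose (Field P) g (rot P A i) = (\<lambda>x\<in>Field P. x)"
      using False G.l_inv[OF r(1)] aut_group_mult[OF g r(1)] unfolding g_def aut_group_one by simp
    then have "g (rot P A i x) = x" if "x \<in> Field P" for x
      using that by (metis compose_eq restrict_apply')
    then have "g ` rot P A i ` ?B = ?B"
      using flag_Field[OF B] by (force simp: image_image)
    then show ?thesis using rB False l by simp
  qed
  have "h ` A \<subseteq> Field P" using hA flag_Field[OF act_flag[OF w A]] by blast
  have "compose (Field P) g h ` A = g ` h ` A"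
    unfolding image_image using flag_Field[OF A] by (intro image_cong) (auto simp: compose_eq)
  then have "(g \<otimes>\<^bsub>aut_group P\<^esub> h) ` A = g ` act P w A"
    using aut_group_mult[OF g h] hA by simp
  also have "\<dots> = act P w (rot_step P l A)" using act_map[OF gm w A] gA by simp
  finally show ?case unfolding l g_def h_def by simp
qed

text \<open>An automorphism that fixes one flag is the identity.\<close>

lemma word_eval_one_iff:
  assumes w: "w \<in> W_words n" and A: "A \<in> flags P"
  shows "word_eval (rotation_group n P A) (rot P A) w = \<one>\<^bsub>rotation_group n P A\<^esub> \<longleftrightarrow> w \<in> stab A"
proof -
  interpret G: group "aut_group P" by (rule group_aut_group)
  have eq: "word_eval (rotation_group n P A) (rot P A) w = word_eval (aut_group P) (rot P A) w"
    unfolding rotation_group_def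
    by (rule word_eval_subgroup[OF group_aut_group rot_generate[OF A] _ w]) (auto intro: generate.incl)
  have "word_eval (aut_group P) (rot P A) w \<in> carrier (aut_group P)"
    by (rule word_eval_closed[OF group_aut_group _ w]) (rule rot(1)[OF A])
  moreover have "\<one>\<^bsub>aut_group P\<^esub> ` A = A"
    using flag_Field[OF A] by (simp add: aut_group_one)
  ultimately have "word_eval (aut_group P) (rot P A) w = \<one>\<^bsub>aut_group P\<^esub> \<longleftrightarrow> act P w A = A"
    using aut_eqI[OF _ G.one_closed A] word_eval_image[OF w A] by metis
  then show ?thesis unfolding eq using w by (simp add: stab_def rotation_group_def)
qed

lemma rotation_kernel_stab:
  assumes "A \<in> flags P"
  shows "rotation_kernel n P A = W_class n ` stab A"
proof -
  have "{w \<in> W_words n. word_eval (rotation_group n P A) (rot P A) w = \<one>\<^bsub>rotation_group n P A\<^esub>} = stab A"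
    using word_eval_one_iff[OF _ assms] unfolding stab_def by blast
  then show ?thesis unfolding rotation_kernel_def W_kernel_def by simp
qed

end

text \<open>The mix lies in a direct product, so a word is trivial in it if and only if both
  coordinates are trivial.\<close>

lemma mix_kernel_stab:
  assumes "rotary_poset m P" "rotary_poset m Q" "A \<in> flags P" "B \<in> flags Q"
  shows "mix_kernel m P A Q B =
    W_class m ` (polytope_poset.stab m P A \<inter> polytope_poset.stab m Q B)"
proof -
  interpret P: rotary_poset m P by fact
  interpret Q: rotary_poset m Q by fact
  let ?G = "rotation_group m P A" and ?H = "rotation_group m Q B"
  let ?D = "?G \<times>\<times> ?H"
  let ?S = "{mix_gen P A Q B i |i. 1 \<le> i \<and> i < m}"
  have G: "group ?G" "group ?H" using P.rotation_group_group Q.rotation_group_group assms by auto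
  then have D: "group ?D" by (rule DirProd_group)
  have "?S \<subseteq> carrier ?D"
    using P.rot_in_rotation_group Q.rot_in_rotation_group by (auto simp: mix_gen_def)
  then have sub: "subgroup (generate ?D ?S) ?D" by (rule group.generate_is_subgroup[OF D])
  have "word_eval (mix_group m P A Q B) (mix_gen P A Q B) w = \<one>\<^bsub>mix_group m P A Q B\<^esub> \<longleftrightarrow>
    w \<in> P.stab A \<inter> Q.stab B" if w: "w \<in> W_words m" for w
  proof -
    have "word_eval (mix_group m P A Q B) (mix_gen P A Q B) w = word_eval ?D (mix_gen P A Q B) w"
      unfolding mix_group_def Let_def
      by (rule word_eval_subgroup[OF D sub _ w]) (auto intro: generate.incl)
    also have "\<dots> = (word_eval ?G (rot P A) w, word_eval ?H (rot Q B) w)"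
      unfolding mix_gen_def[abs_def]
      by (rule word_eval_DirProd[OF G P.rot_in_rotation_group Q.rot_in_rotation_group w])
    moreover have "\<one>\<^bsub>mix_group m P A Q B\<^esub> = (\<one>\<^bsub>?G\<^esub>, \<one>\<^bsub>?H\<^esub>)"
      unfolding mix_group_def Let_def by simp
    ultimately show ?thesis
      using P.word_eval_one_iff[OF w assms(3)] Q.word_eval_one_iff[OF w assms(4)] by simp
  qed
  then have "{w \<in> W_words m. word_eval (mix_group m P A Q B) (mix_gen P A Q B) w = \<one>\<^bsub>mix_group m P A Q B\<^esub>} =
    P.stab A \<inter> Q.stab B" unfolding P.stab_def by blast
  then show ?thesis unfolding mix_kernel_def W_kernel_def by simp
qed

section \<open>Mirror images\<close>

text \<open>Here \<open>a\<close> stands for \<open>\<sigma>\<^sub>1\<close> and \<open>u\<close>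
  for \<open>\<sigma>\<^sub>2 \<dots> \<sigma>\<^sub>j\<close>, whose mirror image is
  \<open>a a u\<close>. Inserting \<open>u\<close> and its inverse into the square exposes the
  trivial factor \<open>(a u) (a u)\<close> and leaves \<open>a (inv u) a u\<close>, which is the
  same square again.\<close>

lemma (in group) mirror_square:
  assumes "a \<in> carrier G" "u \<in> carrier G" "u \<otimes> u = \<one>" "(a \<otimes> u) \<otimes> (a \<otimes> u) = \<one>"
  shows "(a \<otimes> (a \<otimes> u)) \<otimes> (a \<otimes> (a \<otimes> u)) = \<one>"
proof -
  have "a \<otimes> (a \<otimes> u) \<otimes> (a \<otimes> (a \<otimes> u)) = a \<otimes> ((a \<otimes> u) \<otimes> (a \<otimes> u)) \<otimes> inv u \<otimes> (a \<otimes> u)"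
    using assms(1,2) by (simp add: m_assoc[symmetric]) (simp add: m_assoc)
  also have "\<dots> = a \<otimes> inv u \<otimes> (a \<otimes> u)" using assms by simp
  also have "inv u = u" using assms by (simp add: inv_equality)
  also have "a \<otimes> u \<otimes> (a \<otimes> u) = \<one>" by (rule assms(4))
  finally show ?thesis .
qed

lemma bar_word_simps [simp]:
  "bar_word [] = []" "bar_word (l # w) = bar_letter l @ bar_word w" "bar_word (u @ v) = bar_word u @ bar_word v"
  by (auto simp: bar_word_def)

lemma bar_letter_words: "1 \<le> i \<Longrightarrow> i < m \<Longrightarrow> bar_letter (i, b) \<in> W_words m"
  unfolding bar_letter_def by auto

lemma bar_word_words: "w \<in> W_words m \<Longrightarrow> bar_word w \<in> W_words m"
  by (induction w) (auto intro: bar_letter_words)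

lemma bar_letter_inv: "bar_letter (i, \<not> b) = inv_word (bar_letter (i, b))"
  unfolding bar_letter_def by auto

lemma bar_word_high: "\<forall>k\<in>set ks. 3 \<le> k \<Longrightarrow> bar_word (map (\<lambda>k. (k, True)) ks) = map (\<lambda>k. (k, True)) ks"
  by (induction ks) (auto simp: bar_letter_def)

text \<open>The bar changes only \<open>\<sigma>\<^sub>1\<close> and
  \<open>\<sigma>\<^sub>2\<close>. A segment starting at 1 is unchanged up to cancelling
  \<open>\<sigma>\<^sub>1\<^sup>-\<^sup>1 \<sigma>\<^sub>1\<close>, one starting at 3 or later is
  literally unchanged, and one starting at 2 needs the relator starting at 1 as well.\<close>

lemma bar_relator:
  assumes "r \<in> W_relators m"
  shows "(bar_word r, []) \<in> W_eq m"
  using assms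
proof (cases rule: W_relatorsE)
  case (cancel i b)
  then show ?thesis
    using W_eq_cancel[OF bar_letter_words[OF cancel(1,2), of b]] bar_letter_inv[of i b] by simp
next
  case (square i j)
  let ?w = "\<lambda>i. map (\<lambda>k. (k, True)) [i..<Suc j]"
  have r: "r = ?w i @ ?w i" using square(4) .
  have rel: "(?w k @ ?w k, []) \<in> W_eq m" if "1 \<le> k" "k < j" for k
    using W_eq_relator[OF W_relator_square[OF that square(3)]] .
  have W: "?w k \<in> W_words m" if "1 \<le> k" for k using that square(3) by auto
  consider "i = 1" | "i = 2" | "3 \<le> i" using square(1) by linarith
  then show ?thesis
  proof cases
    case 1
    have w1: "?w 1 = (1, True) # (2, True) # ?w 3"
      using square 1 by (simp add: upt_conv_Cons numeral_eq_Suc del: upt_Suc)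
    have b: "bar_word (?w 1) = [(1, False), (1, True)] @ ?w 1"
      unfolding w1 using bar_word_high[of "[3..<Suc j]"] by (simp add: bar_letter_def del: upt_Suc)
    have "[(1, False), (1, True)] \<in> W_relators m" using W_relator_cancel[of 1 m False] square by auto
    then have "([(1, False), (1, True)] @ ?w 1, [] @ ?w 1) \<in> W_eq m"
      by (intro W_eq_append W_eq_relator W_eq_refl W) auto
    then have e: "(bar_word (?w 1), ?w 1) \<in> W_eq m" unfolding b by simp
    have "(bar_word r, ?w 1 @ ?w 1) \<in> W_eq m"
      unfolding r 1 bar_word_simps by (intro W_eq_append e)
    then show ?thesis using rel[of 1] W_eq_trans square 1 by blast
  next
    case 2
    interpret group "W_plus m" by (rule group_W_plus)
    have w2: "?w 2 = (2, True) # ?w 3" "?w 1 = (1, True) # ?w 2"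
      using square 2 by (simp_all add: upt_conv_Cons numeral_eq_Suc del: upt_Suc)
    have b: "bar_word (?w 2) = [(1, True)] @ [(1, True)] @ ?w 2"
      unfolding w2(1) using bar_word_high[of "[3..<Suc j]"] by (simp add: bar_letter_def del: upt_Suc)
    define a where "a = W_class m [(1, True)]"
    define u where "u = W_class m (?w 2)"
    have one: "[(1, True)] \<in> W_words m" using square 2 by simp
    have W2: "?w 2 \<in> W_words m" by (rule W) simp
    have au: "a \<in> carrier (W_plus m)" "u \<in> carrier (W_plus m)"
      unfolding a_def u_def using W_class_in[OF one] W_class_in[OF W[of 2]] by auto
    have m: "a \<otimes>\<^bsub>W_plus m\<^esub> u = W_class m (?w 1)"
      unfolding a_def u_def W_plus_mult[OF one W2] w2(2) by simp
    have "u \<otimes>\<^bsub>W_plus m\<^esub> u = \<one>\<^bsub>W_plus m\<^esub>"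
      unfolding u_def using W_class_eqI[OF rel[of 2]] W[of 2] square 2
      by (simp add: W_plus_mult W_plus_one del: upt_Suc)
    moreover have "(a \<otimes>\<^bsub>W_plus m\<^esub> u) \<otimes>\<^bsub>W_plus m\<^esub> (a \<otimes>\<^bsub>W_plus m\<^esub> u) = \<one>\<^bsub>W_plus m\<^esub>"
      unfolding m using W_class_eqI[OF rel[of 1]] W[of 1] square 2
      by (simp add: W_plus_mult W_plus_one del: upt_Suc)
    ultimately have "(a \<otimes>\<^bsub>W_plus m\<^esub> (a \<otimes>\<^bsub>W_plus m\<^esub> u)) \<otimes>\<^bsub>W_plus m\<^esub> (a \<otimes>\<^bsub>W_plus m\<^esub> (a \<otimes>\<^bsub>W_plus m\<^esub> u)) = \<one>\<^bsub>W_plus m\<^esub>"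
      using mirror_square au by blast
    then have "W_class m (bar_word r) = W_class m []"
      unfolding r 2 bar_word_simps b a_def u_def using one W[of 2]
      by (simp add: W_plus_mult W_plus_one del: upt_Suc)
    moreover have "bar_word r \<in> W_words m" using bar_word_words W_relators_words[OF assms] by blast
    ultimately show ?thesis using W_class_eq_iff by blast
  next
    case 3
    then have "bar_word (?w i) = ?w i" by (intro bar_word_high) auto
    then have "bar_word r = r" unfolding r bar_word_simps by (simp only:)
    then show ?thesis using W_eq_relator[OF assms] by simp
  qed
qed

lemma bar_W_eq:
  assumes "(u, v) \<in> W_eq m"
  shows "(bar_word u, bar_word v) \<in> W_eq m"
  using assms
proof (rule W_eq_map)
  fix u r v assume "u \<in> W_words m" "r \<in> W_relators m" "v \<in> W_words m"
  then have "(bar_word u @ bar_word r @ bar_word v, bar_word u @ [] @ bar_word v) \<in> W_eq m"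
    by (intro W_eq_append W_eq_refl bar_word_words bar_relator)
  then show "(bar_word (u @ r @ v), bar_word (u @ v)) \<in> W_eq m" by simp
qed (rule bar_word_words)

lemma bar_bar_letter:
  assumes "1 \<le> i" "i < m"
  shows "(bar_word (bar_letter (i, b)), [(i, b)]) \<in> W_eq m"
proof -
  have c: "([(1, \<not> b), (1, b)], []) \<in> W_eq m" for b
    using W_eq_relator[OF W_relator_cancel[of 1 m "\<not> b"]] assms by simp
  show ?thesis
  proof (cases "i = 2")
    case False
    then show ?thesis using W_eq_refl[of "[(i, b)]" m] assms by (auto simp: bar_letter_def)
  next
    case True
    have c1: "([(1, False), (1, True)], []) \<in> W_eq m" using c[of True] by simp
    have two: "([(2, b)], [(2, b)]) \<in> W_eq m" for b using W_eq_refl[of "[(2, b)]" m] assms True by simp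
    have t: "([(1, True)], [(1, True)]) \<in> W_eq m" "([(1, False)], [(1, False)]) \<in> W_eq m"
      using W_eq_refl assms by auto
    have T: "([(1, False)] @ [(1, False), (1, True)] @ [(1, True)] @ [(2, True)], [(1, False)] @ [] @ [(1, True)] @ [(2, True)]) \<in> W_eq m"
      by (intro W_eq_append t two c1)
    have T': "([(1, False), (1, True)] @ [(2, True)], [] @ [(2, True)]) \<in> W_eq m"
      by (intro W_eq_append two c1)
    have F: "([(2, False)] @ [(1, False)] @ [(1, False), (1, True)] @ [(1, True)], [(2, False)] @ [(1, False)] @ [] @ [(1, True)]) \<in> W_eq m"
      by (intro W_eq_append t two c1)
    have F': "([(2, False)] @ [(1, False), (1, True)], [(2, False)] @ []) \<in> W_eq m"
      by (intro W_eq_append two c1)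
    show ?thesis
      using True W_eq_trans[OF T, of "[(2, True)]"] T' W_eq_trans[OF F, of "[(2, False)]"] F'
      by (cases b) (auto simp: bar_letter_def)
  qed
qed

lemma bar_bar_word: "w \<in> W_words m \<Longrightarrow> (bar_word (bar_word w), w) \<in> W_eq m"
proof (induction w)
  case (Cons l w)
  obtain i b where l: "l = (i, b)" by fastforce
  have "(bar_word (bar_letter l) @ bar_word (bar_word w), [l] @ w) \<in> W_eq m"
    using Cons bar_bar_letter l by (intro W_eq_append) auto
  then show ?case by simp
qed (simp add: W_eq_refl)

lemma W_bar_class:
  assumes "w \<in> W_words m"
  shows "W_bar m (W_class m w) = W_class m (bar_word w)"
proof -
  have "W_class m (bar_word v) = W_class m (bar_word w)" if "v \<in> W_class m w" for v
    using W_class_eqI[OF bar_W_eq[of w v m]] that unfolding W_class_def by auto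
  then show ?thesis unfolding W_bar_def using W_class_self[OF assms] by blast
qed

lemma W_bar_image:
  assumes S: "S \<subseteq> W_words m" and T: "T \<subseteq> W_words m"
    and ST: "\<And>w. w \<in> S \<Longrightarrow> bar_word w \<in> T" and TS: "\<And>w. w \<in> T \<Longrightarrow> bar_word w \<in> S"
  shows "W_bar m ` W_class m ` S = W_class m ` T"
proof -
  have "W_bar m ` W_class m ` S = W_class m ` bar_word ` S"
    unfolding image_image using S W_bar_class by (intro image_cong) auto
  moreover have "W_class m ` bar_word ` S \<subseteq> W_class m ` T" using ST by (intro image_mono) blast
  moreover have "W_class m ` T \<subseteq> W_class m ` bar_word ` S"
  proof (rule image_subsetI)
    fix w assume w: "w \<in> T"
    then have "W_class m w = W_class m (bar_word (bar_word w))"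
      using W_class_eqI[OF bar_bar_word[of w m]] T by blast
    then show "W_class m w \<in> W_class m ` bar_word ` S" using TS[OF w] by blast
  qed
  ultimately show ?thesis by (metis subset_antisym)
qed

context polytope_poset
begin

lemma bar_stab:
  assumes "2 \<le> n" "A \<in> flags P"
  shows "w \<in> stab A \<Longrightarrow> bar_word w \<in> stab (adj P 0 A)" "w \<in> stab (adj P 0 A) \<Longrightarrow> bar_word w \<in> stab A"
proof -
  have B: "adj P 0 A \<in> flags P" and BA: "adj P 0 (adj P 0 A) = A"
    using adj_flag adj_adj assms by auto
  show "w \<in> stab A \<Longrightarrow> bar_word w \<in> stab (adj P 0 A)"
    using act_bar[OF assms(1) _ B, of w] BA bar_word_words unfolding stab_def by auto
  show "w \<in> stab (adj P 0 A) \<Longrightarrow> bar_word w \<in> stab A"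
    using act_bar[OF assms(1) _ assms(2), of w] BA bar_word_words unfolding stab_def by auto
qed

lemma stab_words: "stab A \<subseteq> W_words n"
  unfolding stab_def by blast

end

section \<open>Finite index\<close>

text \<open>Formulated by representatives instead of a count of cosets, so that it is monotone in
  \<open>H\<close> and applies to products of sets before these are known to be subgroups.\<close>

definition finite_index :: "('g, 'b) monoid_scheme \<Rightarrow> 'g set \<Rightarrow> bool" where
  "finite_index G H \<longleftrightarrow> (\<exists>T. finite T \<and> T \<subseteq> carrier G \<and> (\<forall>g\<in>carrier G. \<exists>h\<in>H. \<exists>t\<in>T. g = h \<otimes>\<^bsub>G\<^esub> t))"

lemma (in group) normal_set_mult:
  assumes H: "H \<lhd> G" and K: "K \<lhd> G"
  shows "H <#> K \<lhd> G"
proof -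
  have sub: "subgroup H G" "subgroup K G" using H K normal_inv_iff by blast+
  have conj: "x \<otimes> h \<otimes> inv x \<in> H" if "x \<in> carrier G" "h \<in> H" for x h
    using H that unfolding normal_inv_iff by blast
  have c: "h \<in> carrier G" if "h \<in> H \<or> h \<in> K" for h using that sub subgroup.subset by blast
  have "subgroup (H <#> K) G"
  proof (rule subgroupI)
    show "H <#> K \<subseteq> carrier G" using c unfolding set_mult_def by blast
    have "\<one> \<otimes> \<one> \<in> H <#> K" using sub subgroup.one_closed unfolding set_mult_def by blast
    then show "H <#> K \<noteq> {}" by blast
  next
    fix y assume "y \<in> H <#> K"
    then obtain h k where hk: "h \<in> H" "k \<in> K" "y = h \<otimes> k" unfolding set_mult_def by blast
    have "inv y = (inv k \<otimes> inv h \<otimes> inv (inv k)) \<otimes> inv k"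
      using hk c by (simp add: inv_mult_group m_assoc)
    moreover have "inv k \<otimes> inv h \<otimes> inv (inv k) \<in> H" "inv k \<in> K"
      using conj[of "inv k" "inv h"] hk c subgroup.m_inv_closed[OF sub(1)] subgroup.m_inv_closed[OF sub(2)]
      by auto
    ultimately show "inv y \<in> H <#> K" unfolding set_mult_def by blast
  next
    fix y z assume "y \<in> H <#> K" "z \<in> H <#> K"
    then obtain h k h' k' where hk: "h \<in> H" "k \<in> K" "y = h \<otimes> k" "h' \<in> H" "k' \<in> K" "z = h' \<otimes> k'"
      unfolding set_mult_def by blast
    have "y \<otimes> z = (h \<otimes> (k \<otimes> h' \<otimes> inv k)) \<otimes> (k \<otimes> k')"
      using hk c by (simp add: m_assoc inv_solve_left)
    moreover have "h \<otimes> (k \<otimes> h' \<otimes> inv k) \<in> H" "k \<otimes> k' \<in> K"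
      using conj[of k h'] hk c subgroup.m_closed[OF sub(1)] subgroup.m_closed[OF sub(2)] by auto
    ultimately show "y \<otimes> z \<in> H <#> K" unfolding set_mult_def by blast
  qed
  moreover have "x \<otimes> y \<otimes> inv x \<in> H <#> K" if x: "x \<in> carrier G" and y: "y \<in> H <#> K" for x y
  proof -
    obtain h k where hk: "h \<in> H" "k \<in> K" "y = h \<otimes> k" using y unfolding set_mult_def by blast
    then have c: "h \<in> carrier G" "k \<in> carrier G" using c by blast+
    have "x \<otimes> y \<otimes> inv x = (x \<otimes> h \<otimes> inv x) \<otimes> (x \<otimes> k \<otimes> inv x)"
      using x c hk(3) by (simp add: m_assoc inv_solve_left)
    moreover have "x \<otimes> h \<otimes> inv x \<in> H" "x \<otimes> k \<otimes> inv x \<in> K"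
      using H K x hk unfolding normal_inv_iff by blast+
    ultimately show ?thesis unfolding set_mult_def by blast
  qed
  ultimately show ?thesis unfolding normal_inv_iff by blast
qed

lemma finite_image_representatives:
  assumes "finite (f ` S)"
  shows "\<exists>T. finite T \<and> T \<subseteq> S \<and> (\<forall>x\<in>S. \<exists>t\<in>T. f x = f t)"
proof -
  obtain T where "T \<subseteq> S" "finite T" "f ` S = f ` T"
    using finite_subset_image[OF assms subset_refl] by blast
  then show ?thesis by (metis image_iff)
qed

lemma (in group) finite_index_coset:
  assumes "subgroup H G" "H \<subseteq> S" "S \<subseteq> carrier G" "finite ((\<lambda>x. H #> x) ` S)"
  shows "\<exists>T. finite T \<and> T \<subseteq> S \<and> (\<forall>x\<in>S. \<exists>h\<in>H. \<exists>t\<in>T. x = h \<otimes> t)"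
proof -
  obtain T where T: "finite T" "T \<subseteq> S" "\<And>x. x \<in> S \<Longrightarrow> \<exists>t\<in>T. H #> x = H #> t"
    using finite_image_representatives[OF assms(4)] by blast
  have "\<exists>h\<in>H. \<exists>t\<in>T. x = h \<otimes> t" if x: "x \<in> S" for x
  proof -
    obtain t where t: "t \<in> T" "H #> x = H #> t" using T(3)[OF x] by blast
    have "x \<in> H #> x" using rcos_self assms(1,3) x by blast
    then show ?thesis using t unfolding r_coset_def by blast
  qed
  then show ?thesis using T(1,2) by blast
qed

subsection \<open>Adjoining the last rotation\<close>

lemma (in group) inverted_by_involution:
  assumes "u \<in> carrier G" "b \<in> carrier G" "(u \<otimes> b) \<otimes> (u \<otimes> b) = \<one>"
  shows "b \<otimes> u \<otimes> b = inv u"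
proof -
  have "u \<otimes> (b \<otimes> u \<otimes> b) = \<one>" using assms by (simp add: m_assoc)
  then show ?thesis using assms(1,2) by (metis inv_equality inv_inv m_closed inv_comm)
qed

text \<open>Here \<open>a\<close> is the common value of
  \<open>\<sigma>\<^sub>n\<^sub>-\<^sub>2\<close> and
  \<open>\<sigma>\<^sub>n\<^sub>-\<^sub>1\<close>, and \<open>b\<close> is
  \<open>\<sigma>\<^sub>n\<close>. Both \<open>b\<close> and \<open>a b\<close> turn
  \<open>a\<close> into its inverse in the sense \<open>b a b = (a b) a (a b) = inv a\<close>. As
  \<open>a b\<close> is its own inverse, this becomes \<open>b (a b) = inv b (a b)\<close>, and
  cancelling gives \<open>b = inv b\<close>.\<close>

lemma (in group) equal_rotations_involution:
  assumes c: "a \<in> carrier G" "b \<in> carrier G"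
    and 1: "(a \<otimes> b) \<otimes> (a \<otimes> b) = \<one>" and 2: "(a \<otimes> (a \<otimes> b)) \<otimes> (a \<otimes> (a \<otimes> b)) = \<one>"
  shows "b \<otimes> b = \<one>"
proof -
  have e1: "b \<otimes> a \<otimes> b = inv a" using inverted_by_involution[OF c 1] .
  have e2: "(a \<otimes> b) \<otimes> a \<otimes> (a \<otimes> b) = inv a"
    using inverted_by_involution[of a "a \<otimes> b"] c 2 by simp
  have "inv (a \<otimes> b) = a \<otimes> b" using inv_equality[of "a \<otimes> b" "a \<otimes> b"] 1 c by simp
  then have ab: "inv b \<otimes> inv a = a \<otimes> b" using c by (simp add: inv_mult_group)
  have "inv b \<otimes> inv a \<otimes> a \<otimes> (a \<otimes> b) = inv a" using e2 unfolding ab .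
  then have "inv b \<otimes> (a \<otimes> b) = inv a" using c by (simp add: m_assoc)
  then have "inv b \<otimes> (a \<otimes> b) = b \<otimes> (a \<otimes> b)" using e1 c by (simp add: m_assoc)
  then have "inv b = b" using c by simp
  then show ?thesis using c by (metis l_inv)
qed

text \<open>\<open>q\<close> is a homomorphism on words that kills the relators for
  \<open>\<sigma>\<^sub>1, \<dots>, \<sigma>\<^sub>n\<close>. The image \<open>D\<close> of the
  words without \<open>\<sigma>\<^sub>n\<close> is normalized by the involution \<open>b\<close>, so
  that \<open>D\<close> and the coset \<open>D b\<close> exhaust the whole image.\<close>

lemma (in group) finite_extension:
  fixes q :: "word \<Rightarrow> 'a"
  assumes n: "2 \<le> n"
    and car: "\<And>w. w \<in> W_words (n + 1) \<Longrightarrow> q w \<in> carrier G"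
    and mult: "\<And>u v. u \<in> W_words (n + 1) \<Longrightarrow> v \<in> W_words (n + 1) \<Longrightarrow> q (u @ v) = q u \<otimes> q v"
    and Nil: "q [] = \<one>"
    and rel: "\<And>r. r \<in> W_relators (n + 1) \<Longrightarrow> q r = \<one>"
    and fin: "finite (q ` W_words n)"
    and last: "q [(n - 1, True)] = \<one> \<or> 3 \<le> n \<and> q [(n - 1, True)] = q [(n - 2, True)]"
  shows "finite (q ` W_words (n + 1))"
proof -
  \<comment> \<open>\<open>?w i j\<close> is the word
    \<open>\<sigma>\<^sub>i \<dots> \<sigma>\<^sub>j\<^sub>-\<^sub>1\<close>, with the upper end
    excluded; it is empty for \<open>i = j\<close>.\<close>
  let ?w = "\<lambda>i j. map (\<lambda>k. (k, True)) [i..<j]"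
  define b where "b = q [(n, True)]"
  have nW: "[(n, c)] \<in> W_words (n + 1)" for c using n by simp
  have b: "b \<in> carrier G" unfolding b_def by (rule car[OF nW])
  have wW: "?w i j \<in> W_words (n + 1)" if "1 \<le> i" "j \<le> n + 1" for i j using that by auto
  have up: "W_words n \<subseteq> W_words (n + 1)" using W_words_mono by auto
  have sq: "q (?w i (Suc j)) \<otimes> q (?w i (Suc j)) = \<one>" if "1 \<le> i" "i < j" "j \<le> n" for i j
    using rel[OF W_relator_square[of i j "n + 1"]] mult[OF wW wW, of i "Suc j" i "Suc j"] that
    by (simp del: upt_Suc)
  have split: "q (?w i (Suc n)) = q (?w i n) \<otimes> b" if "1 \<le> i" "i \<le> n" for i
    using mult[OF wW nW, of i n True] that unfolding b_def by simp
  have inverse: "q (inv_word w) = inv (q w)" if w: "w \<in> W_words (n + 1)" for w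
  proof -
    \<comment> \<open>\<open>q\<close> is given on words only; since it kills the relators it is
      constant on classes, and this turns inverse words into inverse elements.\<close>
    have "q (u @ v) = q (u' @ v')" if "(u @ v, u' @ v') \<in> W_eq (n + 1)" for u v u' v'
      using that by (rule W_eq_invariant) (simp add: mult rel car W_relators_words)
    from this[of w "inv_word w" "[]" "[]"] have "q w \<otimes> q (inv_word w) = \<one>"
      using W_eq_cancel[OF w] w Nil mult by simp
    then show ?thesis using w car by (metis W_words_inv inv_equality inv_inv inv_comm inv_closed)
  qed
  have bb: "b \<otimes> b = \<one>"
    using last
  proof
    assume one: "q [(n - 1, True)] = \<one>"
    have "?w (n - 1) n = [(n - 1, True)]" using n by (simp add: upt_conv_Cons)
    then have "q (?w (n - 1) (Suc n)) = b" using split[of "n - 1"] n one b by simp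
    then show ?thesis using sq[of "n - 1" n] n by simp
  next
    assume eq: "3 \<le> n \<and> q [(n - 1, True)] = q [(n - 2, True)]"
    define a where "a = q [(n - 1, True)]"
    have aW: "[(n - 1, True)] \<in> W_words (n + 1)" "[(n - 2, True)] \<in> W_words (n + 1)" using eq by auto
    have a: "a \<in> carrier G" unfolding a_def by (rule car[OF aW(1)])
    have w: "?w (n - 1) n = [(n - 1, True)]" "?w (n - 2) n = [(n - 2, True)] @ [(n - 1, True)]"
      using eq by (simp_all add: upt_conv_Cons Suc_diff_Suc numeral_2_eq_2)
    have 1: "q (?w (n - 1) (Suc n)) = a \<otimes> b" using split[of "n - 1"] n w(1) unfolding a_def by simp
    have "q (?w (n - 2) n) = a \<otimes> a" unfolding w(2) mult[OF aW(2,1)] using eq unfolding a_def by simp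
    moreover have "q (?w (n - 2) (Suc n)) = q (?w (n - 2) n) \<otimes> b" by (rule split) (use eq in auto)
    ultimately have 2: "q (?w (n - 2) (Suc n)) = a \<otimes> (a \<otimes> b)" using a b by (simp only: m_assoc)
    have "1 \<le> n - 1" "n - 1 < n" "1 \<le> n - 2" "n - 2 < n" using eq by auto
    then show ?thesis
      using equal_rotations_involution[OF a b] sq[of "n - 1" n] sq[of "n - 2" n] unfolding 1 2 by blast
  qed
  then have binv: "inv b = b" using b by (simp add: inv_equality)
  define D where "D = q ` W_words n"
  have Dcar: "x \<in> carrier G" if "x \<in> D" for x using that car up unfolding D_def by blast
  have Dmult: "x \<otimes> y \<in> D" if xy: "x \<in> D" "y \<in> D" for x y
  proof -
    obtain u v where "u \<in> W_words n" "v \<in> W_words n" "x = q u" "y = q v" using xy unfolding D_def by blast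
    moreover from this have "x \<otimes> y = q (u @ v)" using mult up by (metis subsetD)
    ultimately show ?thesis unfolding D_def by simp
  qed
  have Dinv: "inv x \<in> D" if x: "x \<in> D" for x
  proof -
    obtain u where "u \<in> W_words n" "x = q u" using x unfolding D_def by blast
    moreover from this have "inv x = q (inv_word u)" using inverse up by (metis subsetD)
    ultimately show ?thesis unfolding D_def by simp
  qed
  have conj_mult: "b \<otimes> (x \<otimes> y) \<otimes> b = (b \<otimes> x \<otimes> b) \<otimes> (b \<otimes> y \<otimes> b)"
    if "x \<in> carrier G" "y \<in> carrier G" for x y
  proof -
    have "(b \<otimes> x \<otimes> b) \<otimes> (b \<otimes> y \<otimes> b) = b \<otimes> x \<otimes> (b \<otimes> b) \<otimes> y \<otimes> b"
      using that b by (simp add: m_assoc)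
    then show ?thesis unfolding bb using that b by (simp add: m_assoc)
  qed
  have conj_inv: "b \<otimes> inv x \<otimes> b = inv (b \<otimes> x \<otimes> b)" if "x \<in> carrier G" for x
    using that b by (simp add: inv_mult_group binv m_assoc)
  have u_conj: "b \<otimes> q (?w i n) \<otimes> b = inv (q (?w i n))" if i: "1 \<le> i" "i \<le> n" for i
  proof (cases "i = n")
    case True
    then show ?thesis using Nil bb b by simp
  next
    case False
    have "q (?w i n) \<in> carrier G" using car wW i by simp
    then show ?thesis
      using inverted_by_involution[of "q (?w i n)" b] b sq[of i n] split[OF i] i False by simp
  qed
  \<comment> \<open>A generator is a quotient of two segments,
    \<open>\<sigma>\<^sub>i = u v\<^sup>-\<^sup>1\<close> with \<open>u = \<sigma>\<^sub>i \<dots>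
    \<sigma>\<^sub>n\<^sub>-\<^sub>1\<close> and \<open>v = \<sigma>\<^sub>i\<^sub>+\<^sub>1 \<dots>
    \<sigma>\<^sub>n\<^sub>-\<^sub>1\<close>. Conjugation by \<open>b\<close> inverts both, which
    gives \<open>u\<^sup>-\<^sup>1 v\<close>, again in \<open>D\<close>.\<close>
  have gen: "b \<otimes> q [(i, True)] \<otimes> b \<in> D" if i: "1 \<le> i" "i < n" for i
  proof -
    let ?u = "q (?w i n)" and ?v = "q (?w (Suc i) n)"
    have W: "[(i, True)] \<in> W_words (n + 1)" using i by simp
    have uv: "?u \<in> carrier G" "?v \<in> carrier G" "?u \<in> D" "?v \<in> D"
      using car wW i unfolding D_def by auto
    have s: "q [(i, True)] \<in> carrier G" by (rule car[OF W])
    have "?u = q [(i, True)] \<otimes> ?v"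
      using mult[OF W wW[of "Suc i" n]] i by (simp add: upt_conv_Cons)
    then have "q [(i, True)] = ?u \<otimes> inv ?v" using uv s by (simp add: m_assoc)
    then have "b \<otimes> q [(i, True)] \<otimes> b = inv ?u \<otimes> ?v"
      using conj_mult[of ?u "inv ?v"] conj_inv[of ?v] u_conj[of i] u_conj[of "Suc i"] uv i by simp
    then show ?thesis using Dmult Dinv uv by simp
  qed
  have gen': "b \<otimes> q [(i, c)] \<otimes> b \<in> D" if i: "1 \<le> i" "i < n" for i c
  proof (cases c)
    case False
    have W: "[(i, True)] \<in> W_words (n + 1)" using i by simp
    have "q [(i, False)] = inv (q [(i, True)])" using inverse[OF W] by simp
    then show ?thesis using gen[OF i] conj_inv[OF car[OF W]] Dinv False by simp
  qed (use gen[OF i] in simp)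
  have conj: "b \<otimes> x \<otimes> b \<in> D" if x: "x \<in> D" for x
  proof -
    have "b \<otimes> q w \<otimes> b \<in> D" if "w \<in> W_words n" for w
      using that
    proof (induction w)
      case Nil
      have "\<one> \<in> D" unfolding D_def using assms(4) by (metis W_words_Nil imageI)
      then show ?case using assms(4) bb b by simp
    next
      case (Cons l w)
      obtain i c where l: "l = (i, c)" by fastforce
      then have i: "1 \<le> i" "i < n" and w: "w \<in> W_words n" using Cons.prems by auto
      have W: "[(i, c)] \<in> W_words (n + 1)" "w \<in> W_words (n + 1)" using i w up by auto
      have "q (l # w) = q [(i, c)] \<otimes> q w" using mult[OF W] l by simp
      then show ?case
        using conj_mult[OF car[OF W(1)] car[OF W(2)]] gen'[OF i] Cons.IH[OF w] Dmult by simp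
    qed
    then show ?thesis using x unfolding D_def by blast
  qed
  \<comment> \<open>The union is closed under multiplication from the left by each generator; for
    \<open>b\<close> itself this is the invariance of \<open>D\<close> under conjugation by
    \<open>b\<close>.\<close>
  have "q w \<in> D \<union> (\<lambda>d. d \<otimes> b) ` D" if "w \<in> W_words (n + 1)" for w
    using that
  proof (induction w)
    case Nil
    then show ?case unfolding D_def using W_words_Nil by blast
  next
    case (Cons l w)
    obtain i c where l: "l = (i, c)" by fastforce
    then have i: "1 \<le> i" "i \<le> n" and w: "w \<in> W_words (n + 1)" using Cons.prems by auto
    have W: "[(i, c)] \<in> W_words (n + 1)" using i by simp
    have e: "q (l # w) = q [(i, c)] \<otimes> q w" using mult[OF W w] l by simp
    consider d where "d \<in> D" "q w = d" | d where "d \<in> D" "q w = d \<otimes> b"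
      using Cons.IH[OF w] by blast
    note IH = this
    show ?case
    proof (cases "i = n")
      case False
      then have s: "q [(i, c)] \<in> D" unfolding D_def using i by auto
      show ?thesis
        using IH
      proof cases
        case (1 d)
        then show ?thesis using e Dmult[OF s] by simp
      next
        case (2 d)
        then have "q (l # w) = (q [(i, c)] \<otimes> d) \<otimes> b" using e s Dcar b by (simp add: m_assoc)
        then show ?thesis using Dmult[OF s 2(1)] by blast
      qed
    next
      case True
      have "q [(n, False)] = inv b" using inverse[OF nW[of True]] unfolding b_def by simp
      then have s: "q [(i, c)] = b" using True binv unfolding b_def by (cases c) auto
      show ?thesis
        using IH
      proof cases
        case (1 d)
        have "(b \<otimes> d \<otimes> b) \<otimes> b = b \<otimes> d \<otimes> (b \<otimes> b)" using Dcar[OF 1(1)] b by (simp add: m_assoc)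
        then have "q (l # w) = (b \<otimes> d \<otimes> b) \<otimes> b" using e s 1 bb Dcar[OF 1(1)] b by simp
        then show ?thesis using conj[OF 1(1)] by blast
      next
        case (2 d)
        then have "q (l # w) = b \<otimes> d \<otimes> b" using e s Dcar[OF 2(1)] b by (simp add: m_assoc)
        then show ?thesis using conj[OF 2(1)] by simp
      qed
    qed
  qed
  then have "q ` W_words (n + 1) \<subseteq> D \<union> (\<lambda>d. d \<otimes> b) ` D" by blast
  moreover have "finite (D \<union> (\<lambda>d. d \<otimes> b) ` D)" using fin unfolding D_def by blast
  ultimately show ?thesis by (rule finite_subset)
qed

lemma chiral_rank:
  assumes "chiral_polytope n P"
  shows "2 \<le> n"
proof (rule ccontr)
  assume "\<not> 2 \<le> n"
  interpret chiral_poset n P using assms by (rule chiral_posetI)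
  obtain x y where xy: "flag_orbit P ` flags P = {x, y}" "x \<noteq> y"
    using two_orbits unfolding card_2_iff by blast
  then obtain A B where A: "A \<in> flags P" and B: "B \<in> flags P" and AB: "x = flag_orbit P A" "y = flag_orbit P B"
    by (metis (no_types, lifting) image_iff insertI1 insertI2)
  from \<open>\<not> 2 \<le> n\<close> consider "n = 0" | "n = 1" by linarith
  then show False
  proof cases
    case 1
    have "face A i = face B i" if "-1 \<le> i" "i \<le> int n" for i
    proof -
      have "i = -1 \<or> i = int n" using that 1 by auto
      then show ?thesis using face_bot face_top A B by auto
    qed
    then have "A = B" using flag_eqI[OF A B] by blast
    then show False using xy(2) AB by simp
  next
    case 2
    define C where "C = adj P 0 A"
    have C: "C \<in> flags P" unfolding C_def using adj_flag[OF A] 2 by simp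
    define v where "v = face A 0"
    define w where "w = face C 0"
    have vw: "v \<noteq> w" unfolding v_def w_def C_def using adj_face_neq[OF A, of 0] 2 by simp
    obtain G where G: "{H. (least_face, H) \<in> P \<and> (H, greatest_face) \<in> P \<and> H \<noteq> least_face \<and> H \<noteq> greatest_face} = {v, G}"
      using between[OF A, of 0] face_bot[OF A] face_top[OF A] 2 unfolding v_def by auto
    have rv: "rk v = 0" "rk w = 0" "v \<in> Field P" "w \<in> Field P"
      using face_props[OF A, of 0] face_props[OF C, of 0] flag_Field A C 2 unfolding v_def w_def by auto
    have mid: "H = v \<or> H = G" if "H \<in> Field P" "rk H = 0" for H
    proof -
      have "H \<noteq> least_face" "H \<noteq> greatest_face" using that(2) rank_bot rank_top 2 by auto
      then have "H \<in> {H. (least_face, H) \<in> P \<and> (H, greatest_face) \<in> P \<and> H \<noteq> least_face \<and> H \<noteq> greatest_face}"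
        using least_face(2)[OF that(1)] greatest_face(2)[OF that(1)] by blast
      then show ?thesis unfolding G by simp
    qed
    then have "w = G" using rv vw by metis
    have cases: "H = least_face \<or> H = greatest_face \<or> H = v \<or> H = w" if "H \<in> Field P" for H
      using rank_range[OF that] rank_eq_bot[OF that] rank_eq_top[OF that] mid[OF that] \<open>w = G\<close> 2 by force
    have neq: "v \<noteq> least_face" "w \<noteq> least_face" "v \<noteq> greatest_face" "w \<noteq> greatest_face"
      using rv rank_bot rank_top 2 by auto
    define f where "f = (\<lambda>H. if H = v then w else if H = w then v else H)"
    have ff: "f (f H) = H" for H unfolding f_def by auto
    have fF: "f H \<in> Field P" if "H \<in> Field P" for H using that rv unfolding f_def by auto
    have bij: "bij_betw f (Field P) (Field P)"
      by (rule bij_betw_byWitness[of _ f]) (use ff fF in auto)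
    have char: "(H, J) \<in> P \<longleftrightarrow> H = J \<or> H = least_face \<or> J = greatest_face"
      if "H \<in> Field P" "J \<in> Field P" for H J
    proof
      assume le: "(H, J) \<in> P"
      show "H = J \<or> H = least_face \<or> J = greatest_face"
      proof (rule ccontr)
        assume "\<not> ?thesis"
        then show False
          using rank_less[OF le] rank_range[OF that(1)] rank_range[OF that(2)]
            rank_eq_bot[OF that(1)] rank_eq_top[OF that(2)] 2 by auto
      qed
    qed (use that leq_refl least_face(2) greatest_face(2) in auto)
    have "(H, J) \<in> P \<longleftrightarrow> (f H, f J) \<in> P" if "H \<in> Field P" "J \<in> Field P" for H J
    proof -
      have "f H = f J \<longleftrightarrow> H = J" using ff by metis
      moreover have "f H = least_face \<longleftrightarrow> H = least_face" "f J = greatest_face \<longleftrightarrow> J = greatest_face"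
        using neq vw unfolding f_def by auto
      ultimately show ?thesis unfolding char[OF that] char[OF fF[OF that(1)] fF[OF that(2)]] by simp
    qed
    then have "poset_map f P P" using bij unfolding poset_map_def by blast
    moreover have "f ` A = C"
    proof -
      have "{-1..int n} = {-1, 0, 1}" using 2 by auto
      then have "A = {least_face, v, greatest_face}" "C = {least_face, w, greatest_face}"
        using flag_eq_faces[OF A] flag_eq_faces[OF C] face_bot[OF A] face_bot[OF C] face_top[OF A] face_top[OF C] 2
        unfolding v_def w_def by auto
      then show ?thesis using neq unfolding f_def by auto
    qed
    moreover have "A \<subseteq> Field P" "C \<subseteq> Field P" using flag_Field A C by blast+
    ultimately have "flag_orbit P A = flag_orbit P C" using flag_orbit_eq_iff[of A P C] by blast
    then show False using adj_orbit_neq[OF A, of 0] 2 unfolding C_def by simp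
  qed
qed

section \<open>Orbits of flags under words, inside a facet and in the whole polytope\<close>

context polytope_poset
begin

lemma facet_act:
  assumes m: "n = Suc m" and F: "F \<in> Field P" "rk F = int m"
    and L: "polytope m (Restr P {G. (G, F) \<in> P})"
    and A: "A \<in> flags P" "F \<in> A" and w: "w \<in> W_words m"
  shows "act (Restr P {G. (G, F) \<in> P}) w (A - {greatest_face}) = act P w A - {greatest_face} \<and> F \<in> act P w A"
  using w A
proof (induction w arbitrary: A)
  case (Cons l w)
  obtain i b where l: "l = (i, b)" by fastforce
  then have i: "1 \<le> i" "i < m" and w: "w \<in> W_words m" using Cons.prems by auto
  note adj = facet_adj[OF m F L]
  have "rot_step (Restr P {G. (G, F) \<in> P}) l (A - {greatest_face}) = rot_step P l A - {greatest_face}"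
    "F \<in> rot_step P l A" "rot_step P l A \<in> flags P"
    unfolding rot_step_def l using adj[OF Cons.prems(2,3)] adj adj_flag Cons.prems(2) i m by auto
  then show ?case using Cons.IH[OF w] by simp
qed simp

lemma flags_finite_Field:
  assumes "finite (flags P)"
  shows "finite (Field P)"
proof (rule finite_subset)
  show "Field P \<subseteq> \<Union> (flags P)" using in_flag by blast
  show "finite (\<Union> (flags P))" using assms flag_finite by blast
qed

text \<open>Words reach every flag up to a change of the \<open>0\<close>-face: the word
  \<open>\<sigma>\<^sub>1 \<dots> \<sigma>\<^sub>i\<close> changes the \<open>0\<close>-face and
  then the \<open>i\<close>-face, so the orbit together with its \<open>0\<close>-adjacent flags is
  closed under all adjacencies.\<close>

lemma finite_orbit_Field:
  assumes A: "A \<in> flags P" and n: "1 \<le> n" and fin: "finite ((\<lambda>w. act P w A) ` W_words n)"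
  shows "finite (Field P)"
proof -
  let ?S = "(\<lambda>w. act P w A) ` W_words n"
  have "flags P \<subseteq> ?S \<union> adj P 0 ` ?S"
  proof
    fix B assume B: "B \<in> flags P"
    show "B \<in> ?S \<union> adj P 0 ` ?S"
    proof (rule flag_connected[OF _ A B])
      show "A \<in> ?S \<union> adj P 0 ` ?S" by (auto intro!: image_eqI[of _ _ "[]"])
    next
      fix D i assume D: "D \<in> ?S \<union> adj P 0 ` ?S" "D \<in> flags P" and i: "i < n"
      let ?w = "map (\<lambda>k. (k, True)) [1..<Suc i]"
      have wW: "?w \<in> W_words n" using i by auto
      have seg: "act P ?w E = adj P i (adj P 0 E)" if "E \<in> flags P" "i \<noteq> 0" for E
        using act_segment[OF that(1), of 1 i] that(2) i by simp
      consider w where "w \<in> W_words n" "D = act P w A" | w where "w \<in> W_words n" "D = adj P 0 (act P w A)"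
        using D(1) by blast
      then show "adj P i D \<in> ?S \<union> adj P 0 ` ?S"
      proof cases
        case (1 w)
        show ?thesis
        proof (cases "i = 0")
          case False
          have E: "adj P 0 (adj P i D) \<in> flags P" using adj_flag D(2) i by simp
          have "act P (inv_word ?w) (act P ?w (adj P 0 (adj P i D))) = adj P 0 (adj P i D)"
            using act_inv[OF wW E] .
          moreover have "act P ?w (adj P 0 (adj P i D)) = D"
            using seg[OF E False] adj_adj D(2) adj_flag i by simp
          ultimately have "act P (w @ inv_word ?w) A = adj P 0 (adj P i D)" using 1(2) by simp
          then have "adj P 0 (adj P i D) \<in> ?S" using 1(1) wW by (metis W_words_append W_words_inv imageI)
          then have "adj P 0 (adj P 0 (adj P i D)) \<in> adj P 0 ` ?S" by blast
          then show ?thesis using adj_adj[OF adj_flag[OF D(2) i], of 0] i by simp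
        qed (use 1 in auto)
      next
        case (2 w)
        have E: "act P w A \<in> flags P" using act_flag[OF 2(1) A] .
        show ?thesis
        proof (cases "i = 0")
          case True
          then show ?thesis using adj_adj[OF E, of 0] i 2 by auto
        next
          case False
          then have "adj P i D = act P (w @ ?w) A" using seg[OF E] 2(2) by simp
          then show ?thesis using 2(1) wW by (metis UnI1 W_words_append imageI)
        qed
      qed
    qed
  qed
  then have "finite (flags P)" using fin finite_subset by blast
  then show ?thesis by (rule flags_finite_Field)
qed

end

section \<open>Finite index under products and intersections\<close>

lemma finite_index_mono: "finite_index G H \<Longrightarrow> H \<subseteq> H' \<Longrightarrow> finite_index G H'"
  unfolding finite_index_def
proof (elim exE conjE)
  fix T assume "H \<subseteq> H'" "finite T" "T \<subseteq> carrier G" "\<forall>g\<in>carrier G. \<exists>h\<in>H. \<exists>t\<in>T. g = h \<otimes>\<^bsub>G\<^esub> t"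
  then show "\<exists>T. finite T \<and> T \<subseteq> carrier G \<and> (\<forall>g\<in>carrier G. \<exists>h\<in>H'. \<exists>t\<in>T. g = h \<otimes>\<^bsub>G\<^esub> t)"
    by (intro exI[of _ T]) (meson subsetD)
qed

lemma (in group) finite_index_trans:
  assumes "finite_index G S" "S \<subseteq> carrier G" "H \<subseteq> carrier G"
    and T: "finite T" "T \<subseteq> carrier G" "\<forall>x\<in>S. \<exists>h\<in>H. \<exists>t\<in>T. x = h \<otimes> t"
  shows "finite_index G H"
proof -
  obtain U where U: "finite U" "U \<subseteq> carrier G" "\<forall>g\<in>carrier G. \<exists>s\<in>S. \<exists>u\<in>U. g = s \<otimes> u"
    using assms(1) unfolding finite_index_def by blast
  have "\<exists>h\<in>H. \<exists>v\<in>(\<lambda>(t, u). t \<otimes> u) ` (T \<times> U). g = h \<otimes> v" if g: "g \<in> carrier G" for g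
  proof -
    obtain s u where s: "s \<in> S" "u \<in> U" "g = s \<otimes> u" using U(3) g by blast
    obtain h t where h: "h \<in> H" "t \<in> T" "s = h \<otimes> t" using T(3) s(1) by blast
    have "g = h \<otimes> (t \<otimes> u)" using s h U(2) T(2) assms(3) by (simp add: m_assoc subset_iff)
    moreover have "t \<otimes> u \<in> (\<lambda>(t, u). t \<otimes> u) ` (T \<times> U)" using h(2) s(2) by force
    ultimately show ?thesis using h(1) by blast
  qed
  moreover have "(\<lambda>(t, u). t \<otimes> u) ` (T \<times> U) \<subseteq> carrier G" using T(2) U(2) by auto
  moreover have "finite ((\<lambda>(t, u). t \<otimes> u) ` (T \<times> U))" using T(1) U(1) by simp
  ultimately show ?thesis unfolding finite_index_def by blast
qed

text \<open>Only finitely many cosets of \<open>J\<close> exist, and two elements of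
  \<open>A\<close> in the same one differ by an element of \<open>A \<inter> J\<close>; the
  representatives can be taken in \<open>A\<close>.\<close>

lemma (in group) finite_index_restrict:
  assumes J: "subgroup J G" "finite_index G J" and A: "subgroup A G"
  shows "\<exists>T. finite T \<and> T \<subseteq> A \<and> (\<forall>a\<in>A. \<exists>h\<in>A \<inter> J. \<exists>t\<in>T. a = h \<otimes> t)"
proof -
  obtain U where U: "finite U" "U \<subseteq> carrier G" "\<forall>g\<in>carrier G. \<exists>h\<in>J. \<exists>u\<in>U. g = h \<otimes> u"
    using J(2) unfolding finite_index_def by blast
  have cA: "a \<in> carrier G" if "a \<in> A" for a using subgroup.subset[OF A] that by blast
  have "J #> a \<in> (\<lambda>u. J #> u) ` U" if a: "a \<in> A" for a
  proof -
    obtain h u where h: "h \<in> J" "u \<in> U" "a = h \<otimes> u" using U(3) cA[OF a] by blast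
    then have "a \<in> J #> u" unfolding r_coset_def by blast
    then have "J #> u = J #> a" using repr_independence J(1) U(2) h(2) by blast
    then show ?thesis using h(2) by blast
  qed
  then have "finite ((\<lambda>a. J #> a) ` A)" using U(1) by (meson finite_imageI finite_subset image_subsetI)
  from finite_image_representatives[OF this]
  obtain T where T: "finite T" "T \<subseteq> A" "\<forall>a\<in>A. \<exists>t\<in>T. J #> a = J #> t" by blast
  have "\<exists>h\<in>A \<inter> J. \<exists>t\<in>T. a = h \<otimes> t" if a: "a \<in> A" for a
  proof -
    obtain t where t: "t \<in> T" "J #> a = J #> t" using T(3) a by blast
    have tA: "t \<in> A" using t(1) T(2) by blast
    have "a \<in> J #> t" using rcos_self[OF cA[OF a] J(1)] t(2) by simp
    then obtain h where h: "h \<in> J" "a = h \<otimes> t" unfolding r_coset_def by blast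
    have hc: "h \<in> carrier G" using subgroup.subset[OF J(1)] h(1) by blast
    have "h = a \<otimes> inv t" using h(2) hc cA[OF tA] by (simp add: m_assoc)
    then have "h \<in> A" using subgroup.m_closed[OF A a] subgroup.m_inv_closed[OF A tA] by simp
    then show ?thesis using h t(1) by blast
  qed
  then show ?thesis using T(1,2) by blast
qed

text \<open>Intersecting both factors with \<open>J\<close> costs only a finite index, so a mix with
  a finite polytope preserves the finiteness obtained for \<open>P\<close>. In
  \<open>a b = h s k r\<close>, with finitely many \<open>s\<close> and \<open>r\<close>, the factor
  \<open>k\<close> is moved to the left past \<open>s\<close>; its conjugate stays in
  \<open>B \<inter> J\<close> by normality.\<close>

lemma (in group) finite_index_mult_Int:
  assumes A: "A \<lhd> G" and B: "B \<lhd> G" and J: "J \<lhd> G"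
    and AB: "finite_index G (A <#> B)" and fJ: "finite_index G J"
  shows "finite_index G ((A \<inter> J) <#> (B \<inter> J))"
proof -
  have sub: "subgroup A G" "subgroup B G" "subgroup J G" using A B J unfolding normal_inv_iff by blast+
  have c: "x \<in> carrier G" if "x \<in> A \<or> x \<in> B \<or> x \<in> J" for x
    using that subgroup.subset[OF sub(1)] subgroup.subset[OF sub(2)] subgroup.subset[OF sub(3)] by blast
  obtain S where S: "finite S" "S \<subseteq> A" "\<forall>a\<in>A. \<exists>h\<in>A \<inter> J. \<exists>t\<in>S. a = h \<otimes> t"
    using finite_index_restrict[OF sub(3) fJ sub(1)] by blast
  obtain R where R: "finite R" "R \<subseteq> B" "\<forall>b\<in>B. \<exists>h\<in>B \<inter> J. \<exists>t\<in>R. b = h \<otimes> t"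
    using finite_index_restrict[OF sub(3) fJ sub(2)] by blast
  have r1: "\<exists>h\<in>(A \<inter> J) <#> (B \<inter> J). \<exists>t\<in>(\<lambda>(s, r). s \<otimes> r) ` (S \<times> R). x = h \<otimes> t" if x: "x \<in> A <#> B" for x
  proof -
    obtain a b where ab: "a \<in> A" "b \<in> B" "x = a \<otimes> b" using x unfolding set_mult_def by blast
    obtain h s where h: "h \<in> A \<inter> J" "s \<in> S" "a = h \<otimes> s" using S(3) ab(1) by blast
    obtain k r where k: "k \<in> B \<inter> J" "r \<in> R" "b = k \<otimes> r" using R(3) ab(2) by blast
    have cc: "h \<in> carrier G" "s \<in> carrier G" "k \<in> carrier G" "r \<in> carrier G" using c h k S(2) R(2) by blast+
    have "s \<otimes> k \<otimes> inv s \<in> B \<inter> J" using B J cc(2) k(1) unfolding normal_inv_iff by blast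
    then have "h \<otimes> (s \<otimes> k \<otimes> inv s) \<in> (A \<inter> J) <#> (B \<inter> J)" using h(1) unfolding set_mult_def by blast
    moreover have "x = (h \<otimes> (s \<otimes> k \<otimes> inv s)) \<otimes> (s \<otimes> r)"
      using ab(3) h(3) k(3) cc by (simp add: m_assoc inv_solve_left)
    moreover have "s \<otimes> r \<in> (\<lambda>(s, r). s \<otimes> r) ` (S \<times> R)" using h(2) k(2) by force
    ultimately show ?thesis by blast
  qed
  have c1: "A <#> B \<subseteq> carrier G" "(A \<inter> J) <#> (B \<inter> J) \<subseteq> carrier G"
    using c unfolding set_mult_def by blast+
  have c2: "(\<lambda>(s, r). s \<otimes> r) ` (S \<times> R) \<subseteq> carrier G" using c S(2) R(2) by auto
  have f: "finite ((\<lambda>(s, r). s \<otimes> r) ` (S \<times> R))" using S(1) R(1) by simp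
  show ?thesis by (rule finite_index_trans[OF AB c1 f c2]) (rule ballI, rule r1)
qed

context polytope_poset
begin

text \<open>The kernel of the action on all flags. It lies in the stabilizer of a base flag and in
  that of the \<open>0\<close>-adjacent flag alike, so it can be intersected with the kernel of the
  other polytope and with its mirror image at the same time.\<close>

definition core :: "word set" where
  "core = {w \<in> W_words n. \<forall>A\<in>flags P. act P w A = A}"

lemma core_normal: "normal_words n core"
proof -
  have "inv_word u \<in> core" if u: "u \<in> core" for u
  proof -
    have "act P (inv_word u) A = A" if "A \<in> flags P" for A
      using act_inv[OF _ that, of u] u that unfolding core_def by simp
    then show ?thesis using u unfolding core_def by simp
  qed
  moreover have "g @ u @ inv_word g \<in> core" if "g \<in> W_words n" "u \<in> core" for g u
    using that act_inv[OF that(1)] act_flag[OF that(1)] unfolding core_def by simp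
  moreover have "v \<in> core" if "(u, v) \<in> W_eq n" "u \<in> core" for u v
    using act_W_eq[OF that(1)] W_eq_words[OF that(1)] that(2) unfolding core_def by simp
  moreover have "u @ v \<in> core" if "u \<in> core" "v \<in> core" for u v
    using that unfolding core_def by simp
  moreover have "core \<subseteq> W_words n" "[] \<in> core" unfolding core_def by auto
  ultimately show ?thesis unfolding normal_words_def by blast
qed

lemma core_finite_index:
  assumes fin: "finite (flags P)"
  shows "finite_index (W_plus n) (W_class n ` core)"
proof -
  let ?f = "\<lambda>w. restrict (act P w) (flags P)"
  have "?f ` W_words n \<subseteq> (flags P \<rightarrow>\<^sub>E flags P)" using act_flag by auto
  then have "finite (?f ` W_words n)" using finite_subset finite_PiE[OF fin, of "\<lambda>_. flags P"] fin by blast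
  from finite_image_representatives[OF this]
  obtain T where T: "finite T" "T \<subseteq> W_words n" "\<forall>w\<in>W_words n. \<exists>t\<in>T. ?f w = ?f t" by blast
  have "\<exists>h\<in>W_class n ` core. \<exists>t\<in>W_class n ` T. g = h \<otimes>\<^bsub>W_plus n\<^esub> t" if g: "g \<in> carrier (W_plus n)" for g
  proof -
    obtain w where w: "w \<in> W_words n" "g = W_class n w" using g unfolding W_plus_carrier by blast
    obtain t where t: "t \<in> T" "?f w = ?f t" using T(3) w(1) by blast
    have tW: "t \<in> W_words n" using t(1) T(2) by blast
    have "act P w A = act P t A" if "A \<in> flags P" for A using t(2) that by (metis restrict_apply')
    then have "w @ inv_word t \<in> core" using act_inv[OF tW] w(1) tW unfolding core_def by simp
    moreover have "W_class n w = W_class n (w @ inv_word t) \<otimes>\<^bsub>W_plus n\<^esub> W_class n t"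
    proof -
      have "(w @ inv_word t @ t, w @ []) \<in> W_eq n"
        using W_eq_cancel[of "inv_word t" n] tW w(1) by (intro W_eq_append W_eq_refl) auto
      then have "W_class n w = W_class n (w @ inv_word t @ t)" using W_class_eqI by fastforce
      then show ?thesis using w(1) tW by (simp add: W_plus_mult)
    qed
    ultimately show ?thesis using t(1) w(2) by blast
  qed
  moreover have "W_class n ` T \<subseteq> carrier (W_plus n)" using T(2) W_class_in by blast
  ultimately show ?thesis
    unfolding finite_index_def using T(1) by (intro exI[of _ "W_class n ` T"]) simp
qed

lemma core_stab: "A \<in> flags P \<Longrightarrow> core \<subseteq> stab A"
  unfolding core_def stab_def by blast

end

text \<open>Since \<open>W_class m\<close> is not injective on words, a class in both images may
  come from two different words. That \<open>S'\<close> is a union of classes makes one word serve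
  for both.\<close>

lemma normal_words_class_Int:
  assumes S: "normal_words m S" and C: "C \<subseteq> S'" and S': "normal_words m S'"
  shows "W_class m ` S \<inter> W_class m ` C \<subseteq> W_class m ` (S \<inter> S')"
proof
  fix x assume "x \<in> W_class m ` S \<inter> W_class m ` C"
  then obtain u c where u: "u \<in> S" "x = W_class m u" and c: "c \<in> C" "x = W_class m c" by blast
  have "u \<in> W_words m" using normal_wordsD(1)[OF S] u(1) by blast
  then have "(u, c) \<in> W_eq m" using W_class_eq_iff u(2) c(2) by metis
  then have "u \<in> S'" using normal_wordsD(6)[OF S'] W_eq_sym c(1) C by blast
  then show "x \<in> W_class m ` (S \<inter> S')" using u by blast
qed

text \<open>The facet of \<open>P\<close> in its base flag is \<open>K\<close> up to the choice of the base flag of \<open>K\<close>, that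
  is, up to taking mirror images.\<close>

lemma facet_stab:
  assumes P: "polytope (n + 1) P" and K: "chiral_polytope n K" and n: "1 \<le> n"
    and \<Psi>: "\<Psi> \<in> flags P" and \<Phi>: "\<Phi> \<in> flags K"
    and facets: "\<forall>L\<in>facets (n + 1) P. poset_iso L K"
  shows "finite (Field K) \<Longrightarrow> finite ((\<lambda>w. act P w \<Psi>) ` W_words n)"
    "polytope_poset.stab n K \<Phi> \<union> polytope_poset.stab n K (adj K 0 \<Phi>) \<subseteq>
      polytope_poset.stab (n + 1) P \<Psi> \<union> polytope_poset.stab (n + 1) P (adj P 0 \<Psi>)"
proof -
  interpret P: polytope_poset "n + 1" P using P by unfold_locales
  interpret K: chiral_poset n K using K by (rule chiral_posetI)
  define F where "F = P.face \<Psi> (int n)"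
  define L where "L = Restr P {G. (G, F) \<in> P}"
  let ?d = "\<lambda>A. A - {P.greatest_face}"
  have F: "F \<in> Field P" "P.rk F = int n" "F \<in> \<Psi>"
    using P.face_props[OF \<Psi>, of "int n"] P.flag_Field[OF \<Psi>] unfolding F_def by auto
  have "L \<in> facets (n + 1) P" using F unfolding facets_def L_def by auto
  then obtain h where h: "poset_map h L K" using facets unfolding poset_iso_map by blast
  interpret h: poset_isom h L K using h by unfold_locales
  interpret hi: poset_isom "inv_into (Field L) h" K L by (rule h.inv_isom)
  have Lpoly: "polytope n L" using hi.polytope_map[OF K.poly] .
  interpret L: polytope_poset n L using Lpoly by unfold_locales
  have m: "n + 1 = Suc n" by simp
  note Lpoly' = Lpoly[unfolded L_def]
  define \<Psi>' where "\<Psi>' = adj P 0 \<Psi>"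
  have \<Psi>': "\<Psi>' \<in> flags P" "F \<in> \<Psi>'"
    using P.adj_flag[OF \<Psi>] P.facet_adj(2)[OF m F(1,2) Lpoly' \<Psi> F(3), of 0] n unfolding \<Psi>'_def by auto
  have LF: "Field L = {G. (G, F) \<in> P}" unfolding L_def by (rule Field_below[OF P.po])
  show "finite ((\<lambda>w. act P w \<Psi>) ` W_words n)" if finK: "finite (Field K)"
  proof (rule finite_subset)
    show "(\<lambda>w. act P w \<Psi>) ` W_words n \<subseteq> Pow (insert P.greatest_face (Field L))"
    proof (rule image_subsetI)
      fix w assume w: "w \<in> W_words n"
      have "F \<in> act P w \<Psi>" using P.facet_act[OF m F(1,2) Lpoly' \<Psi> F(3) w] by blast
      moreover have "act P w \<Psi> \<in> flags P"
        using P.act_flag[OF W_words_mono[OF w, of "n + 1"] \<Psi>] by simp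
      ultimately show "act P w \<Psi> \<in> Pow (insert P.greatest_face (Field L))"
        using P.facet_flag_down[OF m F(1,2) Lpoly'] unfolding LF by blast
    qed
    show "finite (Pow (insert P.greatest_face (Field L)))"
      using bij_betw_finite[OF h.bij] finK by simp
  qed
  \<comment> \<open>A flag through \<open>F\<close> is its part in the facet together with the
    greatest face, so a word in the rotations of the facet that fixes that part fixes the flag of
    \<open>P\<close>.\<close>
  have stab: "w \<in> P.stab A" if A: "A \<in> flags P" "F \<in> A" and w: "w \<in> K.stab (h ` ?d A)" for A w
  proof -
    have wW: "w \<in> W_words n" "w \<in> W_words (n + 1)" using w W_words_mono[of w n "n + 1"] unfolding K.stab_def by auto
    have dA: "?d A \<in> flags L" unfolding L_def using P.facet_flagI[OF m F(1,2) Lpoly' A] .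
    have B: "act P w A \<in> flags P" "F \<in> act P w A" "act L w (?d A) = ?d (act P w A)"
      using P.act_flag[OF wW(2) A(1)] P.facet_act[OF m F(1,2) Lpoly' A wW(1)] unfolding L_def by auto
    have "h ` act L w (?d A) = h ` ?d A" using L.act_map[OF h wW(1) dA] w unfolding K.stab_def by simp
    then have "act L w (?d A) = ?d A"
      using inj_on_image_eq_iff[OF h.inj] h.flag_sub[OF L.act_flag[OF wW(1) dA]] h.flag_sub[OF dA] by blast
    then have "act P w A = A"
      using B P.greatest_face_in_flag[OF A(1)] P.greatest_face_in_flag[OF B(1)] by auto
    then show ?thesis using wW unfolding P.stab_def by simp
  qed
  define A where "A = h ` ?d \<Psi>"
  have d\<Psi>: "?d \<Psi> \<in> flags L" unfolding L_def using P.facet_flagI[OF m F(1,2) Lpoly' \<Psi> F(3)] .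
  have A: "A \<in> flags K" unfolding A_def using h.flag_image[OF d\<Psi>] .
  have A': "h ` ?d \<Psi>' = adj K 0 A"
    unfolding A_def \<Psi>'_def
    using h.adj_map[OF Lpoly d\<Psi>, of 0] P.facet_adj(1)[OF m F(1,2) Lpoly' \<Psi> F(3), of 0] n
    unfolding L_def by simp
  have sub: "K.stab A \<subseteq> P.stab \<Psi>" "K.stab (adj K 0 A) \<subseteq> P.stab \<Psi>'"
    using stab[OF \<Psi> F(3)] stab[OF \<Psi>'] unfolding A' A_def[symmetric] by auto
  have i: "0 < n" using n by simp
  have B: "adj K 0 A \<in> flags K" using K.adj_flag[OF A i] .
  \<comment> \<open>The isomorphism of the facet with \<open>K\<close> takes the base flag to some
    flag \<open>A\<close>, perhaps not in the orbit of \<open>\<Phi>\<close>. As \<open>K\<close>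
    has two orbits, represented by \<open>A\<close> and its \<open>0\<close>-adjacent flag, only two
    stabilizers occur.\<close>
  have "K.stab C \<subseteq> K.stab A \<union> K.stab (adj K 0 A)" if C: "C \<in> flags K" for C
  proof -
    consider "flag_orbit K C = flag_orbit K A" | "flag_orbit K C = flag_orbit K (adj K 0 A)"
      using K.orbit_cases[OF A B C K.adj_orbit_neq[OF A i]] by blast
    then show ?thesis
    proof cases
      case 1
      then obtain f where f: "poset_map f K K" "f ` C = A" using K.orbit_map[OF C A] by blast
      show ?thesis using K.stab_map[OF f(1) C] f(2) by simp
    next
      case 2
      then obtain f where f: "poset_map f K K" "f ` C = adj K 0 A" using K.orbit_map[OF C B] by blast
      show ?thesis using K.stab_map[OF f(1) C] f(2) by simp
    qed
  qed
  then show "K.stab \<Phi> \<union> K.stab (adj K 0 \<Phi>) \<subseteq> P.stab \<Psi> \<union> P.stab (adj P 0 \<Psi>)"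
    using sub \<Phi> K.adj_flag[OF \<Phi> i] unfolding \<Psi>'_def by blast
qed

theorem theorem5p4:
  fixes n :: nat
    and K :: "'k rel" and P :: "'p rel" and Q :: "'q rel"
    and \<Phi> :: "'k set" and \<Psi> :: "'p set" and \<Omega> :: "'q set"
    and M :: "word set set"
  assumes K_chiral: "chiral_polytope n K" and K_finite: "finite (Field K)"
    and K_facets: "\<forall>L\<in>facets n K. directly_regular_polytope (n - 1) L"
    and P_universal: "universal_chiral n K P"
    and Q_regular: "directly_regular_polytope (n + 1) Q" and Q_finite: "finite (Field Q)"
    and base_flags: "\<Phi> \<in> flags K" "\<Psi> \<in> flags P" "\<Omega> \<in> flags Q"
    and M_def: "M = rotation_kernel n K \<Phi>"
    and comix_relation:
      "comix_gen n M (W_bar n ` M) (n - 1) = \<one>\<^bsub>comix n M (W_bar n ` M)\<^esub> \<or>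
       comix_gen n M (W_bar n ` M) (n - 1) = comix_gen n M (W_bar n ` M) (n - 2)"
  shows "mix_chiral (n + 1) P \<Psi> Q \<Omega> \<and>
         infinite (carrier (chirality_group (n + 1) (mix_kernel (n + 1) P \<Psi> Q \<Omega>)))"
proof -
  have n: "2 \<le> n" using chiral_rank[OF K_chiral] .
  define m where "m = n + 1"
  have P_chiral: "chiral_polytope m P" and P_facets: "\<forall>L\<in>facets m P. poset_iso L K"
    using P_universal unfolding universal_chiral_def m_def by auto
  have P_infinite: "infinite (Field P)"
    using universal_chiral_infinite[OF K_chiral _ P_universal] n by simp
  interpret K: chiral_poset n K using K_chiral by (rule chiral_posetI)
  interpret P: chiral_poset m P using P_chiral by (rule chiral_posetI)
  interpret Q: rotary_poset m Q
    using Q_regular regular_rotary unfolding directly_regular_polytope_def m_def by blast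
  have m: "2 \<le> m" "n \<le> m" using n unfolding m_def by auto
  interpret W: group "W_plus m" by (rule group_W_plus)
  interpret V: group "W_plus n" by (rule group_W_plus)

  \<comment> \<open>The kernel of the mix and its mirror image as stabilizers\<close>
  define \<Phi>' where "\<Phi>' = adj K 0 \<Phi>"
  define \<Psi>' where "\<Psi>' = adj P 0 \<Psi>"
  define \<Omega>' where "\<Omega>' = adj Q 0 \<Omega>"
  note fl = base_flags
  have fl': "\<Phi>' \<in> flags K" "\<Psi>' \<in> flags P" "\<Omega>' \<in> flags Q"
    unfolding \<Phi>'_def \<Psi>'_def \<Omega>'_def using K.adj_flag P.adj_flag Q.adj_flag fl n m by auto
  let ?A = "W_class m ` P.stab \<Psi>" and ?B = "W_class m ` P.stab \<Psi>'"
  let ?J = "W_class m ` Q.core"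
  define N where "N = W_class m ` (P.stab \<Psi> \<inter> Q.stab \<Omega>)"
  define N' where "N' = W_class m ` (P.stab \<Psi>' \<inter> Q.stab \<Omega>')"
  have N: "mix_kernel m P \<Psi> Q \<Omega> = N"
    unfolding N_def using mix_kernel_stab[OF P.rotary_poset_axioms Q.rotary_poset_axioms fl(2,3)] .
  have N': "W_bar m ` N = N'"
    unfolding N_def N'_def
  proof (rule W_bar_image)
    show "P.stab \<Psi> \<inter> Q.stab \<Omega> \<subseteq> W_words m" "P.stab \<Psi>' \<inter> Q.stab \<Omega>' \<subseteq> W_words m"
      using P.stab_words by blast+
    show "bar_word w \<in> P.stab \<Psi>' \<inter> Q.stab \<Omega>'" if "w \<in> P.stab \<Psi> \<inter> Q.stab \<Omega>" for w
      using that P.bar_stab(1)[OF _ fl(2)] Q.bar_stab(1)[OF _ fl(3)] m unfolding \<Psi>'_def \<Omega>'_def by simp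
    show "bar_word w \<in> P.stab \<Psi> \<inter> Q.stab \<Omega>" if "w \<in> P.stab \<Psi>' \<inter> Q.stab \<Omega>'" for w
      using that P.bar_stab(2)[OF _ fl(2)] Q.bar_stab(2)[OF _ fl(3)] m unfolding \<Psi>'_def \<Omega>'_def by simp
  qed
  have nA: "?A \<lhd> W_plus m" and nB: "?B \<lhd> W_plus m" and nJ: "?J \<lhd> W_plus m"
    and nN: "N \<lhd> W_plus m" and nN': "N' \<lhd> W_plus m"
    unfolding N_def N'_def
    using normal_words_class P.stab_normal Q.stab_normal Q.core_normal normal_words_Int fl fl' by blast+

  \<comment> \<open>Finiteness of the quotient by the kernel of \<open>P\<close> and its mirror
    image\<close>
  define L where "L = ?A <#>\<^bsub>W_plus m\<^esub> ?B"
  have nL: "L \<lhd> W_plus m" unfolding L_def by (rule W.normal_set_mult[OF nA nB])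
  have sL: "subgroup L (W_plus m)" using nL unfolding W.normal_inv_iff by blast
  interpret L: normal L "W_plus m" by (rule nL)
  define q where "q w = L #>\<^bsub>W_plus m\<^esub> W_class m w" for w
  interpret G: group "W_plus m Mod L" by (rule L.factorgroup_is_group)
  have q_in: "q w \<in> carrier (W_plus m Mod L)" if "w \<in> W_words m" for w
    unfolding q_def carrier_FactGroup using W_class_in[OF that] by blast
  have q_mult: "q (u @ v) = q u \<otimes>\<^bsub>W_plus m Mod L\<^esub> q v" if "u \<in> W_words m" "v \<in> W_words m" for u v
    using hom_mult[OF L.r_coset_hom_Mod W_class_in[OF that(1)] W_class_in[OF that(2)]] W_plus_mult[OF that]
    unfolding q_def by simp
  have q_eq: "q u = q v" if "(u, v) \<in> W_eq m" for u v
    unfolding q_def using W_class_eqI[OF that] by simp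
  have q_one: "q w = \<one>\<^bsub>W_plus m Mod L\<^esub>" if "W_class m w \<in> L" for w
  proof -
    have "W_class m w \<in> carrier (W_plus m)" using that subgroup.subset[OF sL] by blast
    then show ?thesis unfolding q_def using W.coset_join2[OF _ sL that] by simp
  qed
  have oneAB: "\<one>\<^bsub>W_plus m\<^esub> \<in> ?A" "\<one>\<^bsub>W_plus m\<^esub> \<in> ?B"
    using nA nB subgroup.one_closed unfolding W.normal_inv_iff by blast+
  have cAB: "?A \<subseteq> carrier (W_plus m)" "?B \<subseteq> carrier (W_plus m)"
    using nA nB subgroup.subset unfolding W.normal_inv_iff by blast+
  have AL: "?A \<subseteq> L" "?B \<subseteq> L"
  proof -
    show "?A \<subseteq> L"
    proof
      fix x assume x: "x \<in> ?A"
      then have "x \<otimes>\<^bsub>W_plus m\<^esub> \<one>\<^bsub>W_plus m\<^esub> \<in> L" unfolding L_def set_mult_def using oneAB(2) by blast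
      moreover have "x \<in> carrier (W_plus m)" using x cAB(1) by (rule rev_subsetD)
      ultimately show "x \<in> L" by simp
    qed
    show "?B \<subseteq> L"
    proof
      fix x assume x: "x \<in> ?B"
      then have "\<one>\<^bsub>W_plus m\<^esub> \<otimes>\<^bsub>W_plus m\<^esub> x \<in> L" unfolding L_def set_mult_def using oneAB(1) by blast
      moreover have "x \<in> carrier (W_plus m)" using x cAB(2) by (rule rev_subsetD)
      ultimately show "x \<in> L" by simp
    qed
  qed
  have q_stab: "q w = \<one>\<^bsub>W_plus m Mod L\<^esub>" if "w \<in> P.stab \<Psi> \<union> P.stab \<Psi>'" for w
    using q_one that AL by blast
  note facet = facet_stab[where n = n, folded m_def, OF P.poly K_chiral _ fl(2,1) P_facets]
  have stabs: "K.stab \<Phi> \<union> K.stab \<Phi>' \<subseteq> P.stab \<Psi> \<union> P.stab \<Psi>'"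
    unfolding \<Phi>'_def \<Psi>'_def using facet(2) n by simp
  \<comment> \<open>Words with the same effect on \<open>\<Psi>\<close> differ by an element of its
    stabilizer, which \<open>q\<close> kills. So \<open>q\<close> takes at most as many values on
    \<open>W_words n\<close> as there are flags in the orbit of \<open>\<Psi>\<close> under these
    words, and these flags all share the facet isomorphic to the finite \<open>K\<close>.\<close>
  have q_fin: "finite (q ` W_words n)"
  proof -
    have "finite ((\<lambda>w. act P w \<Psi>) ` W_words n)" using facet(1)[OF _ K_finite] n by simp
    from finite_image_representatives[OF this]
    obtain T where T: "finite T" "T \<subseteq> W_words n" "\<forall>w\<in>W_words n. \<exists>t\<in>T. act P w \<Psi> = act P t \<Psi>" by blast
    have "q w \<in> q ` T" if w: "w \<in> W_words n" for w
    proof -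
      obtain t where t: "t \<in> T" "act P w \<Psi> = act P t \<Psi>" using T(3) w by blast
      have W: "w \<in> W_words m" "t \<in> W_words m" using w t(1) T(2) W_words_mono m(2) by auto
      have "act P (w @ inv_word t) \<Psi> = \<Psi>" using P.act_inv[OF W(2) fl(2)] t(2) by simp
      then have "w @ inv_word t \<in> P.stab \<Psi>" using W unfolding P.stab_def by simp
      then have one: "q (w @ inv_word t) = \<one>\<^bsub>W_plus m Mod L\<^esub>" using q_stab by blast
      have "q ((w @ inv_word t) @ t) = q (w @ inv_word t) \<otimes>\<^bsub>W_plus m Mod L\<^esub> q t"
        by (rule q_mult) (use W in auto)
      also have "\<dots> = q t" unfolding one by (rule G.l_one[OF q_in[OF W(2)]])
      finally have "q ((w @ inv_word t) @ t) = q t" .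
      moreover have "(w @ inv_word t @ t, w @ []) \<in> W_eq m"
        using W_eq_cancel[of "inv_word t" m] W by (intro W_eq_append W_eq_refl) auto
      ultimately have "q w = q t" using q_eq by fastforce
      then show ?thesis using t(1) by blast
    qed
    then show ?thesis using T(1) by (meson finite_imageI finite_subset image_subsetI)
  qed
  have q_last: "q [(n - 1, True)] = \<one>\<^bsub>W_plus m Mod L\<^esub> \<or> 3 \<le> n \<and> q [(n - 1, True)] = q [(n - 2, True)]"
  proof -
    let ?MM = "W_class n ` K.stab \<Phi> <#>\<^bsub>W_plus n\<^esub> W_class n ` K.stab \<Phi>'"
    have M: "M = W_class n ` K.stab \<Phi>" unfolding M_def using K.rotation_kernel_stab[OF fl(1)] .
    have M': "W_bar n ` M = W_class n ` K.stab \<Phi>'"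
      unfolding M \<Phi>'_def
      by (rule W_bar_image[OF K.stab_words K.stab_words K.bar_stab(1)[OF n fl(1)] K.bar_stab(2)[OF n fl(1)]])
    have nM: "?MM \<lhd> W_plus n"
      by (intro V.normal_set_mult normal_words_class K.stab_normal fl fl')
    then have sM: "subgroup ?MM (W_plus n)" unfolding V.normal_inv_iff by blast
    let ?s = "[(n - 1, True)]" and ?t = "[(n - 2, True)]"
    have sW: "?s \<in> W_words n" using n by simp
    have self: "W_class n ?s \<in> ?MM #>\<^bsub>W_plus n\<^esub> W_class n ?s"
      using V.rcos_self[OF W_class_in[OF sW] sM] .
    \<comment> \<open>Carries relations of the comix, a quotient of \<open>W_plus n\<close>, over to
      the quotient of \<open>W_plus m\<close>: the stabilizers in \<open>K\<close> are among those
      in \<open>P\<close>, up to exchanging mirror images, and \<open>q\<close> kills both of the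
      latter.\<close>
    have MM: "q w = \<one>\<^bsub>W_plus m Mod L\<^esub>" if w: "W_class n w \<in> ?MM" "w \<in> W_words n" for w
    proof -
      obtain u v where u: "u \<in> K.stab \<Phi>" and v: "v \<in> K.stab \<Phi>'"
        and "W_class n w = W_class n u \<otimes>\<^bsub>W_plus n\<^esub> W_class n v"
        using w(1) unfolding set_mult_def by blast
      moreover have W: "u \<in> W_words n" "v \<in> W_words n" using u v K.stab_words by blast+
      ultimately have "(w, u @ v) \<in> W_eq n" using W_plus_mult W_class_eq_iff[OF w(2)] by metis
      then have "q w = q (u @ v)" using q_eq W_eq_mono[of w "u @ v" n m] m by simp
      also have "\<dots> = q u \<otimes>\<^bsub>W_plus m Mod L\<^esub> q v"
        using q_mult W W_words_mono[of _ n m] m by simp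
      also have "\<dots> = \<one>\<^bsub>W_plus m Mod L\<^esub> \<otimes>\<^bsub>W_plus m Mod L\<^esub> \<one>\<^bsub>W_plus m Mod L\<^esub>"
        using q_stab[of u] q_stab[of v] stabs u v by (simp add: subset_iff del: one_FactGroup mult_FactGroup)
      also have "\<dots> = \<one>\<^bsub>W_plus m Mod L\<^esub>" by (rule G.l_one[OF G.one_closed])
      finally show ?thesis .
    qed
    from comix_relation show ?thesis
    proof
      assume "comix_gen n M (W_bar n ` M) (n - 1) = \<one>\<^bsub>comix n M (W_bar n ` M)\<^esub>"
      then have "?MM #>\<^bsub>W_plus n\<^esub> W_class n ?s = ?MM"
        unfolding comix_gen_def comix_def W_gen_def M' unfolding M by simp
      then show ?thesis using MM[OF _ sW] self by simp
    next
      assume "comix_gen n M (W_bar n ` M) (n - 1) = comix_gen n M (W_bar n ` M) (n - 2)"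
      then have "W_class n ?s \<in> ?MM #>\<^bsub>W_plus n\<^esub> W_class n ?t"
        using self unfolding comix_gen_def W_gen_def M' unfolding M by simp
      then obtain x where x: "x \<in> ?MM" "W_class n ?s = x \<otimes>\<^bsub>W_plus n\<^esub> W_class n ?t"
        unfolding r_coset_def by blast
      have n3: "3 \<le> n"
      proof (rule ccontr)
        assume "\<not> 3 \<le> n"
        \<comment> \<open>then \<open>\<sigma>\<^sub>n\<^sub>-\<^sub>2\<close> is not a generator, and its class is the junk value \<open>{}\<close>\<close>
        then have "W_class n ?t = {}" using n unfolding W_class_def W_eq_def by auto
        then have "W_class n ?s = {}" using x(2) unfolding W_plus_def by simp
        then show False using W_class_self[OF sW] by simp
      qed
      have tW: "?t \<in> W_words n" using n3 by simp
      have "x \<in> carrier (W_plus n)" using x(1) subgroup.subset[OF sM] by blast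
      then obtain w where w: "w \<in> W_words n" "x = W_class n w" unfolding W_plus_carrier by blast
      have "(?s, w @ ?t) \<in> W_eq n"
        using x(2) w tW W_plus_mult W_class_eq_iff[OF sW] by metis
      then have "q ?s = q (w @ ?t)" using q_eq W_eq_mono[of ?s "w @ ?t" n m] m by simp
      also have "\<dots> = q w \<otimes>\<^bsub>W_plus m Mod L\<^esub> q ?t"
        using q_mult w(1) tW W_words_mono[of _ n m] m by simp
      also have "q w = \<one>\<^bsub>W_plus m Mod L\<^esub>" using MM x(1) w by simp
      also have "\<one>\<^bsub>W_plus m Mod L\<^esub> \<otimes>\<^bsub>W_plus m Mod L\<^esub> q ?t = q ?t"
        by (rule G.l_one[OF q_in]) (use tW W_words_mono[of _ n m] m in simp)
      finally show ?thesis using n3 by blast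
    qed
  qed
  have q_Nil: "q [] = \<one>\<^bsub>W_plus m Mod L\<^esub>"
    using q_one subgroup.one_closed[OF sL] unfolding W_plus_one by blast
  have q_rel: "q r = \<one>\<^bsub>W_plus m Mod L\<^esub>" if "r \<in> W_relators m" for r
    using q_eq[OF W_eq_relator[OF that]] q_Nil by simp
  have "finite (q ` W_words m)"
    using G.finite_extension[where n = n and q = q, folded m_def, OF n q_in q_mult q_Nil q_rel q_fin q_last] .
  then have "finite ((\<lambda>x. L #>\<^bsub>W_plus m\<^esub> x) ` carrier (W_plus m))"
    unfolding q_def W_plus_carrier image_image .
  from W.finite_index_coset[OF sL subgroup.subset[OF sL] subset_refl this]
  have fL: "finite_index (W_plus m) L" unfolding finite_index_def by blast

  \<comment> \<open>Passing from \<open>P\<close> to the mix with \<open>Q\<close>\<close>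
  have "finite (flags Q)"
    using finite_subset[of "flags Q" "Pow (Field Q)"] Q_finite Q.flag_Field by blast
  then have fJ: "finite_index (W_plus m) ?J" by (rule Q.core_finite_index)
  have "finite_index (W_plus m) ((?A \<inter> ?J) <#>\<^bsub>W_plus m\<^esub> (?B \<inter> ?J))"
    using W.finite_index_mult_Int[OF nA nB nJ fL[unfolded L_def] fJ] .
  \<comment> \<open>Words that fix all flags of \<open>Q\<close> fix both \<open>\<Omega>\<close>
    and \<open>\<Omega>'\<close>.\<close>
  moreover have "?A \<inter> ?J \<subseteq> N" "?B \<inter> ?J \<subseteq> N'"
    unfolding N_def N'_def
    by (intro normal_words_class_Int P.stab_normal Q.stab_normal Q.core_stab fl fl')+
  ultimately have fNN: "finite_index (W_plus m) (N <#>\<^bsub>W_plus m\<^esub> N')"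
    using finite_index_mono mono_set_mult by metis
  have sN: "subgroup N (W_plus m)" "subgroup N' (W_plus m)"
    using nN nN' unfolding W.normal_inv_iff by blast+

  \<comment> \<open>The chirality group is infinite and the mix is chiral\<close>
  let ?X = "chirality_group m N"
  have car: "carrier ?X = (\<lambda>x. N #>\<^bsub>W_plus m\<^esub> x) ` (N <#>\<^bsub>W_plus m\<^esub> N')"
    unfolding chirality_group_def N' carrier_FactGroup by (simp add: r_coset_def)
  have infinite: "infinite (carrier ?X)"
  proof
    assume "finite (carrier ?X)"
    then have fin: "finite ((\<lambda>x. N #>\<^bsub>W_plus m\<^esub> x) ` (N <#>\<^bsub>W_plus m\<^esub> N'))" unfolding car .
    have NNN: "N \<subseteq> N <#>\<^bsub>W_plus m\<^esub> N'"
    proof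
      fix x assume x: "x \<in> N"
      then have "x \<otimes>\<^bsub>W_plus m\<^esub> \<one>\<^bsub>W_plus m\<^esub> \<in> N <#>\<^bsub>W_plus m\<^esub> N'"
        unfolding set_mult_def using subgroup.one_closed[OF sN(2)] by blast
      moreover have "x \<in> carrier (W_plus m)" using x subgroup.subset[OF sN(1)] by blast
      ultimately show "x \<in> N <#>\<^bsub>W_plus m\<^esub> N'" by simp
    qed
    have cNN: "N <#>\<^bsub>W_plus m\<^esub> N' \<subseteq> carrier (W_plus m)"
      using W.setmult_subset_G subgroup.subset sN by blast
    obtain T where T: "finite T" "T \<subseteq> N <#>\<^bsub>W_plus m\<^esub> N'"
      "\<forall>x\<in>N <#>\<^bsub>W_plus m\<^esub> N'. \<exists>h\<in>N. \<exists>t\<in>T. x = h \<otimes>\<^bsub>W_plus m\<^esub> t"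
      using W.finite_index_coset[OF sN(1) NNN cNN fin] by blast
    \<comment> \<open>A finite chirality group would make \<open>N\<close> of finite index in
      \<open>N N'\<close>, which in turn has finite index in the whole group.\<close>
    have "finite_index (W_plus m) N"
      using W.finite_index_trans[OF fNN cNN subgroup.subset[OF sN(1)] T(1) _ T(3)] T(2) cNN by blast
    then obtain U where U: "finite U" "U \<subseteq> carrier (W_plus m)"
      "\<forall>g\<in>carrier (W_plus m). \<exists>h\<in>N. \<exists>t\<in>U. g = h \<otimes>\<^bsub>W_plus m\<^esub> t"
      unfolding finite_index_def by blast
    \<comment> \<open>Elements of \<open>N\<close> fix \<open>\<Psi>\<close>, so the image of
      \<open>\<Psi>\<close> depends only on the representative \<open>t\<close> in \<open>U\<close>;
      the choice operator selects a word in the class \<open>t\<close>. The orbit of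
      \<open>\<Psi>\<close> is then finite, against the infinity of \<open>P\<close>.\<close>
    have "act P w \<Psi> \<in> (\<lambda>t. act P (SOME v. v \<in> W_words m \<and> t = W_class m v) \<Psi>) ` U"
      if w: "w \<in> W_words m" for w
    proof -
      obtain h t where h: "h \<in> N" "t \<in> U" "W_class m w = h \<otimes>\<^bsub>W_plus m\<^esub> t"
        using U(3) W_class_in[OF w] by blast
      obtain u where u: "u \<in> P.stab \<Psi>" "h = W_class m u" using h(1) unfolding N_def by blast
      define v where "v = (SOME v. v \<in> W_words m \<and> t = W_class m v)"
      have "\<exists>v. v \<in> W_words m \<and> t = W_class m v" using h(2) U(2) unfolding W_plus_carrier by blast
      from someI_ex[OF this] have v: "v \<in> W_words m" "t = W_class m v" unfolding v_def by auto
      have uW: "u \<in> W_words m" using u(1) P.stab_words by blast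
      have "(w, u @ v) \<in> W_eq m"
        using h(3) u(2) v W_plus_mult[OF uW v(1)] W_class_eq_iff[OF w] by metis
      then have "act P w \<Psi> = act P v \<Psi>" using P.act_W_eq[OF _ fl(2)] u(1) unfolding P.stab_def by fastforce
      then show ?thesis using h(2) unfolding v_def by blast
    qed
    then have "finite ((\<lambda>w. act P w \<Psi>) ` W_words m)"
      using U(1) by (meson finite_imageI finite_subset image_subsetI)
    then show False using P.finite_orbit_Field[OF fl(2)] P_infinite m by simp
  qed
  moreover have "mix_chiral m P \<Psi> Q \<Omega>"
    unfolding mix_chiral_def N
  proof
    assume "W_bar m ` N = N"
    then have eq: "N' = N" using N' by simp
    \<comment> \<open>If \<open>N\<close> were its own mirror image, the chirality group would have
      a single element, yet it is infinite.\<close>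
    have "N #>\<^bsub>W_plus m\<^esub> x = N" if "x \<in> N <#>\<^bsub>W_plus m\<^esub> N'" for x
    proof -
      have "x \<in> N" using that subgroup.m_closed[OF sN(1)] unfolding eq set_mult_def by blast
      then show ?thesis using W.coset_join2[OF _ sN(1)] subgroup.subset[OF sN(1)] by blast
    qed
    then have "carrier ?X \<subseteq> {N}" unfolding car by blast
    then show False using infinite finite_subset by blast
  qed
  ultimately show ?thesis unfolding m_def[symmetric] N by blast
qed

end
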